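(* Let $(\mathsf{Q},\mathbf{a})$ be a seed with cluster algebra $\mathcal{A}=\mathcal{A}(\mathsf{Q},\mathbf{a})$. If a run of the Banff algorithm on input $(\mathsf{Q},\mathbf{a})$ outputs a finite set of acyclic seeds $\{(\mathsf{Q}_i,\mathbf{a}_i)\}$, then these seeds define a finite acyclic cover of $\mathcal{X}_{\mathcal{A}}$ (that is, each $\mathcal{X}_{\mathcal{A}(\mathsf{Q}_i,\mathbf{a}_i)}$ is an acyclic cluster chart of $\mathcal{X}_{\mathcal{A}}$ and these charts cover $\mathcal{X}_{\mathcal{A}}$), and so $\mathcal{A}$ is locally acyclic.
   Context: **Ice quivers and seeds.** An ice quiver $\mathsf{Q}$ is a finite quiver without loops or directed 2-cycles, together with a distinguished subset of vertices called frozen; the other vertices are called mutable. $\mathsf{Q}_{mut}$ is the induced subquiver on the mutable vertices. For vertices $i,j$ put $\mathsf{Q}_{ij}:=\#(\text{arrows from } i \text{ to } j)-\#(\text{arrows from } j\text{ to } i)$; this skew-symmetric integer matrix determines $\mathsf{Q}$. A seed $(\mathsf{Q},\mathbf{a})$ of rank $n$ is an ice quiver on vertices $1,\dots,n$ together with a cluster $\mathbf{a}=\{a_1,\dots,a_n\}$, an $n$-tuple of algebraically independent elements generating the field $\mathbb{Q}(x_1,\dots,x_n)$. The element $a_i$ is called mutable (resp. frozen) if vertex $i$ is. **Mutation.** For a mutable vertex $k$, the mutation of $(\mathsf{Q},\mathbf{a})$ at $k$ is the seed $(\mu_k(\mathsf{Q}),\mu_k(\mathbf{a}))$ with the same frozen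 vertices, with $\mu_k(\mathsf{Q})_{ij}=-\mathsf{Q}_{ij}$ if $k\in\{i,j\}$ and $\mu_k(\mathsf{Q})_{ij}=\mathsf{Q}_{ij}+\frac{|\mathsf{Q}_{ik}|\mathsf{Q}_{kj}+\mathsf{Q}_{ik}|\mathsf{Q}_{kj}|}{2}$ otherwise, and with $\mu_k(a_i)=a_i$ for $i\neq k$ and $\mu_k(a_k)=\left(\prod_{\mathsf{Q}_{kj}>0}a_j^{\mathsf{Q}_{kj}}+\prod_{\mathsf{Q}_{kj}<0}a_j^{-\mathsf{Q}_{kj}}\right)a_k^{-1}$. Seeds related by finite sequences of mutations are (mutation) equivalent. **Cluster algebras.** The cluster algebra $\mathcal{A}(\mathsf{Q},\mathbf{a})$ is the subring of $\mathbb{Q}(x_1,\dots,x_n)$ generated by all cluster variables (the elements of the clusters of all seeds mutation equivalent to $(\mathsf{Q},\mathbf{a})$) and the inverses of the frozen variables. Those seeds are the seeds of $\mathcal{A}$. A seed is acyclic if $\mathsf{Q}_{mut}$ has no directed cycles; a cluster algebra is acyclic if it has an acyclic seed. Put $\mathcal{X}_{\mathcal{A}}:=\mathrm{Spec}(\mathcal{A})$. **Local acyclicity.** Given a seed $(\mathsf{Q},\mathbf{a})$ of $\mathcal{A}$ and a set $\{a_1,\dots,a_i\}$ of mutable variables in $\mathbf{a}$, the freezing of $\mathcal{A}$ at this set is the cluster algebra $\mathcal{A}'$ of the seed obtained from $(\mathsf{Q},\mathbf{a})$ by declaring the corresponding vertices frozen as well. The freezing $\mathcal{A}'$ is a cluster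 localization of $\mathcal{A}$ if $\mathcal{A}'=\mathcal{A}[a_1^{-1},\dots,a_i^{-1}]$ as subrings of $\mathbb{Q}(x_1,\dots,x_n)$; the corresponding open subscheme $\mathcal{X}_{\mathcal{A}'}\subseteq\mathcal{X}_{\mathcal{A}}$ is a cluster chart, called acyclic if $\mathcal{A}'$ is acyclic. $\mathcal{A}$ is locally acyclic if $\mathcal{X}_{\mathcal{A}}$ has a finite cover by acyclic cluster charts. **Covering pairs.** A bi-infinite path in $\mathsf{Q}$ is a sequence of mutable vertices $(i_k)_{k\in\mathbb{Z}}$ with $\mathsf{Q}_{i_k,i_{k+1}}>0$ for all $k$; an arrow is in it if (after shifting indices) its source is $i_1$ and its target is $i_2$. A covering pair in $\mathsf{Q}$ is a pair of mutable vertices $(i_1,i_2)$ such that there is an arrow from $i_1$ to $i_2$ but this arrow is not in any bi-infinite path. **Banff algorithm** (branching and non-deterministic). Input: a seed $(\mathsf{Q},\mathbf{a})$. Step 1: if $(\mathsf{Q},\mathbf{a})$ is mutation equivalent to an acyclic seed, stop (this branch outputs that acyclic seed). Step 2: otherwise, mutate $(\mathsf{Q},\mathbf{a})$ (by some finite sequence of mutations) to a seed $(\mathsf{Q}',\mathbf{a}')$ with a covering pair $(i_1,i_2)$; if this is impossible, the algorithm fails. Step 3: consider the two seeds obtained from $(\mathsf{Q}',\mathbf{a}')$ by declaring $i_1$ frozen, respectively $i_2$ frozen, and apply the procedure from Step 1 to each. Output: the finite set of acyclic seeds at which the branches stop, or failure (if some branch fails). *)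

theory Defs
  imports
    "HOL-Algebra.Algebraic_Closure_Type"
    "HOL-Algebra.Generated_Fields"
    "HOL-Library.Poly_Mapping"
    "HOL-Computational_Algebra.Fraction_Field"
begin

section \<open>Rational functions\<close>

text \<open>
  A multivariate polynomial over the rationals is a finitely supported function from
  monomials to coefficients; a monomial is a finitely supported function from variable
  indices to exponents.  The type \<open>ratfun\<close> is the field of rational functions in the countably
  many variables \<open>x\<^sub>0, x\<^sub>1, x\<^sub>2, \<dots>\<close>; the field of rational functions in
  \<open>x\<^sub>1, \<dots>, x\<^sub>n\<close> is its subfield \<open>ratfun_field n\<close>.
\<close>

type_synonym qmpoly = "(nat \<Rightarrow>\<^sub>0 nat) \<Rightarrow>\<^sub>0 rat"
type_synonym ratfun = "qmpoly fract"

abbreviation RF :: "ratfun ring"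
  where "RF \<equiv> ring_of_type_algebra"

definition ratfun_const :: "rat \<Rightarrow> ratfun"
  where "ratfun_const c = Fract (Poly_Mapping.single 0 c) 1"

definition ratfun_var :: "nat \<Rightarrow> ratfun"
  where "ratfun_var i = Fract (Poly_Mapping.single (Poly_Mapping.single i 1) 1) 1"

definition ratfun_field :: "nat \<Rightarrow> ratfun set"
  where "ratfun_field n = generate_field RF (ratfun_var ` {1..n})"

definition qmpoly_eval :: "qmpoly \<Rightarrow> (nat \<Rightarrow> ratfun) \<Rightarrow> ratfun"
  where "qmpoly_eval P a =
    (\<Sum>m\<in>Poly_Mapping.keys P. ratfun_const (Poly_Mapping.lookup P m) *
       (\<Prod>i\<in>Poly_Mapping.keys m. a i ^ Poly_Mapping.lookup m i))"

definition alg_indep_tuple :: "nat \<Rightarrow> (nat \<Rightarrow> ratfun) \<Rightarrow> bool"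
  where "alg_indep_tuple n a \<longleftrightarrow>
    (\<forall>P. (\<forall>m\<in>Poly_Mapping.keys P. Poly_Mapping.keys m \<subseteq> {1..n}) \<longrightarrow>
         qmpoly_eval P a = 0 \<longrightarrow> P = 0)"


section \<open>Ice quivers, seeds and mutation\<close>

text \<open>
  A finite quiver on the vertices \<open>1, \<dots>, n\<close> without loops or directed 2-cycles is
  encoded by its skew-symmetric integer matrix: \<open>arr Q i j\<close> is the number of arrows from \<open>i\<close>
  to \<open>j\<close> minus the number of arrows from \<open>j\<close> to \<open>i\<close>, so there is an arrow from \<open>i\<close> to \<open>j\<close>
  if and only if \<open>arr Q i j > 0\<close>.
\<close>

record ice_quiver =
  nvert :: nat
  frozen :: "nat set"
  arr :: "nat \<Rightarrow> nat \<Rightarrow> int"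

record seed = ice_quiver +
  clus :: "nat \<Rightarrow> ratfun"

definition vertices :: "'a ice_quiver_scheme \<Rightarrow> nat set"
  where "vertices Q = {1..nvert Q}"

definition mutables :: "'a ice_quiver_scheme \<Rightarrow> nat set"
  where "mutables Q = vertices Q - frozen Q"

definition is_ice_quiver :: "'a ice_quiver_scheme \<Rightarrow> bool"
  where "is_ice_quiver Q \<longleftrightarrow>
    frozen Q \<subseteq> vertices Q \<and>
    (\<forall>i j. arr Q i j = - arr Q j i) \<and>
    (\<forall>i j. arr Q i j \<noteq> 0 \<longrightarrow> i \<in> vertices Q \<and> j \<in> vertices Q)"

text \<open>The values of \<open>clus s\<close> outside \<open>vertices s\<close> are irrelevant.\<close>

definition is_seed :: "seed \<Rightarrow> bool"
  where "is_seed s \<longleftrightarrow>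
    is_ice_quiver s \<and>
    alg_indep_tuple (nvert s) (clus s) \<and>
    generate_field RF (clus s ` vertices s) = ratfun_field (nvert s)"

text \<open>The division by 2 is exact.\<close>

definition mutate_arr :: "nat \<Rightarrow> (nat \<Rightarrow> nat \<Rightarrow> int) \<Rightarrow> nat \<Rightarrow> nat \<Rightarrow> int"
  where "mutate_arr k q i j =
    (if k \<in> {i, j} then - q i j
     else q i j + (\<bar>q i k\<bar> * q k j + q i k * \<bar>q k j\<bar>) div 2)"

definition mutate_clus :: "nat \<Rightarrow> seed \<Rightarrow> nat \<Rightarrow> ratfun"
  where "mutate_clus k s i =
    (if i \<noteq> k then clus s i
     else ((\<Prod>j\<in>{j \<in> vertices s. arr s k j > 0}. clus s j ^ nat (arr s k j)) +
           (\<Prod>j\<in>{j \<in> vertices s. arr s k j < 0}. clus s j ^ nat (- arr s k j)))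
          * inverse (clus s k))"

definition mutate :: "nat \<Rightarrow> seed \<Rightarrow> seed"
  where "mutate k s = s\<lparr>arr := mutate_arr k (arr s), clus := mutate_clus k s\<rparr>"

text \<open>
  On seeds, mutation at \<open>k\<close> is an involution, so the reflexive transitive closure is an
  equivalence relation there.
\<close>

definition mut_equiv :: "seed \<Rightarrow> seed \<Rightarrow> bool"
  where "mut_equiv = (\<lambda>s t. \<exists>k\<in>mutables s. t = mutate k s)\<^sup>*\<^sup>*"

definition freeze :: "nat set \<Rightarrow> seed \<Rightarrow> seed"
  where "freeze S s = s\<lparr>frozen := frozen s \<union> S\<rparr>"

definition acyclic_seed :: "seed \<Rightarrow> bool"
  where "acyclic_seed s \<longleftrightarrow>
    acyclic {(i, j). i \<in> mutables s \<and> j \<in> mutables s \<and> arr s i j > 0}"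


section \<open>Cluster algebras\<close>

definition cluster_variables :: "seed \<Rightarrow> ratfun set"
  where "cluster_variables s = (\<Union>t\<in>{t. mut_equiv s t}. clus t ` vertices t)"

text \<open>
  Notions that depend on a cluster algebra together with its seeds are stated for any one
  of its seeds.
\<close>

definition cluster_algebra :: "seed \<Rightarrow> ratfun set"
  where "cluster_algebra s =
    generate_ring RF (cluster_variables s \<union> inverse ` clus s ` frozen s)"

definition acyclic_cluster_algebra :: "seed \<Rightarrow> bool"
  where "acyclic_cluster_algebra s \<longleftrightarrow> (\<exists>t. mut_equiv s t \<and> acyclic_seed t)"


section \<open>Spectra, cluster charts and covers\<close>

definition Spec :: "ratfun set \<Rightarrow> ratfun set set"
  where "Spec A = {P. primeideal P (RF\<lparr>carrier := A\<rparr>)}"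

text \<open>
  For subrings \<open>A \<subseteq> B\<close>, this is the set of points of \<open>Spec A\<close> in the image of the
  morphism \<open>Spec B \<rightarrow> Spec A\<close> induced by the inclusion.  If \<open>B\<close> is the localization of \<open>A\<close> at
  finitely many elements, that morphism is an open immersion, and the image is the point
  set of the open subscheme \<open>Spec B\<close> of \<open>Spec A\<close>.
\<close>

definition Spec_image :: "ratfun set \<Rightarrow> ratfun set \<Rightarrow> ratfun set set"
  where "Spec_image A B = (\<lambda>P. P \<inter> A) ` Spec B"

text \<open>
  \<open>is_freezing s s' S t\<close>: \<open>t\<close> is a seed of the freezing, at the mutable variables
  \<open>clus s' ` S\<close> of the seed \<open>s'\<close>, of the cluster algebra of \<open>s\<close>.
\<close>

definition is_freezing :: "seed \<Rightarrow> seed \<Rightarrow> nat set \<Rightarrow> seed \<Rightarrow> bool"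
  where "is_freezing s s' S t \<longleftrightarrow>
    mut_equiv s s' \<and> S \<subseteq> mutables s' \<and> mut_equiv (freeze S s') t"

definition cluster_localization :: "seed \<Rightarrow> seed \<Rightarrow> bool"
  where "cluster_localization s t \<longleftrightarrow>
    (\<exists>s' S. is_freezing s s' S t \<and>
       cluster_algebra t = generate_ring RF (cluster_algebra s \<union> inverse ` clus s' ` S))"

definition acyclic_cluster_chart :: "seed \<Rightarrow> seed \<Rightarrow> bool"
  where "acyclic_cluster_chart s t \<longleftrightarrow>
    cluster_localization s t \<and> acyclic_cluster_algebra t"

definition finite_acyclic_cover :: "seed \<Rightarrow> seed set \<Rightarrow> bool"
  where "finite_acyclic_cover s T \<longleftrightarrow>
    finite T \<and>
    (\<forall>t\<in>T. acyclic_cluster_chart s t) \<and>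
    (\<Union>t\<in>T. Spec_image (cluster_algebra s) (cluster_algebra t)) = Spec (cluster_algebra s)"

definition locally_acyclic :: "seed \<Rightarrow> bool"
  where "locally_acyclic s \<longleftrightarrow> (\<exists>T. finite_acyclic_cover s T)"


section \<open>Covering pairs and the Banff algorithm\<close>

definition bi_infinite_path :: "'a ice_quiver_scheme \<Rightarrow> (int \<Rightarrow> nat) \<Rightarrow> bool"
  where "bi_infinite_path Q p \<longleftrightarrow>
    (\<forall>k. p k \<in> mutables Q) \<and> (\<forall>k. arr Q (p k) (p (k + 1)) > 0)"

definition covering_pair :: "'a ice_quiver_scheme \<Rightarrow> nat \<Rightarrow> nat \<Rightarrow> bool"
  where "covering_pair Q i j \<longleftrightarrow>
    i \<in> mutables Q \<and> j \<in> mutables Q \<and> arr Q i j > 0 \<and>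
    \<not> (\<exists>p. bi_infinite_path Q p \<and> p 1 = i \<and> p 2 = j)"

text \<open>
  \<open>banff_run s T\<close>: some run of the Banff algorithm on input \<open>s\<close> terminates without failure
  and outputs the set \<open>T\<close>.  The derivations are the finite branching trees of such runs; a
  run in which some branch fails or does not terminate has no derivation.
\<close>

inductive banff_run :: "seed \<Rightarrow> seed set \<Rightarrow> bool"
  where
    stop: "\<lbrakk>mut_equiv s t; acyclic_seed t\<rbrakk> \<Longrightarrow> banff_run s {t}"
  | branch: "\<lbrakk>\<not> (\<exists>t. mut_equiv s t \<and> acyclic_seed t);
              mut_equiv s s'; covering_pair s' i\<^sub>1 i\<^sub>2;
              banff_run (freeze {i\<^sub>1} s') T\<^sub>1; banff_run (freeze {i\<^sub>2} s') T\<^sub>2\<rbrakk>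
             \<Longrightarrow> banff_run s (T\<^sub>1 \<union> T\<^sub>2)"

end

theory Submission
  imports Defs
begin

text \<open>
  Freezing one vertex of a covering pair should invert one cluster variable and nothing else.
  In the direction \<open>A(freeze {k} s) \<subseteq> A(s)[a\<^sub>k\<inverse>]\<close> this is immediate; the content lies in the
  converse, because the cluster variables obtained by mutating at the vertex \<open>k\<close> are not cluster
  variables of the freezing.  To control them, the proof works with the set \<open>reachable s\<close> of all
  elements that arise from the cluster of \<open>s\<close> by mutating at arbitrary vertices, frozen ones
  included.  This set contains the cluster variables of \<open>s\<close> and does not change when \<open>s\<close> is mutated
  or frozen, so it bounds all the freezings of \<open>s\<close> at the same time.  The key claim is
  \<open>reachable s \<subseteq> cluster_algebra s\<close> for every seed \<open>s\<close> on which the Banff algorithm succeeds.  It takes the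
  place of the equality of a locally acyclic cluster algebra with its upper cluster algebra, and it
  implies that all freezings occurring in a run are cluster localizations
  (\<open>cluster_algebra_freeze\<close>).

  The claim and the covering property both come from comaximality.  Let \<open>(i, j)\<close> be a covering
  pair and suppose that no infinite path of mutable vertices starts at \<open>j\<close> (otherwise no
  infinite path ends at \<open>i\<close>, and the arrows are reversed).  Modulo \<open>a\<^sub>i\<close> and \<open>a\<^sub>j\<close> the exchange relation at \<open>j\<close> says that the product
  of the variables at the heads of the arrows out of \<open>j\<close> vanishes; by well-founded induction
  each of these is a unit modulo \<open>a\<^sub>j\<close>, so \<open>a\<^sub>i\<close> and \<open>a\<^sub>j\<close> generate the unit ideal
  (\<open>covering_pair_comaximal\<close>).  Hence no prime contains both, which makes the two charts a cover,
  and an element of both \<open>A[a\<^sub>i\<inverse>]\<close> and \<open>A[a\<^sub>j\<inverse>]\<close> lies in \<open>A\<close>, which passes the claim from the two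
  freezings to \<open>s\<close>.  In an acyclic seed every arrow between mutable vertices is a covering pair, so
  the same step reduces acyclic seeds to seeds without arrows between mutable vertices.

  For these isolated seeds, write an element \<open>f\<close> of \<open>reachable s\<close> as a Laurent polynomial in the
  initial cluster.  By the Laurent phenomenon it is also a Laurent polynomial in each cluster
  obtained by mutating at a set \<open>N\<close> of mutable vertices, that is, after substituting \<open>E\<^sub>k / x\<^sub>k\<close> for
  \<open>x\<^sub>k\<close> (\<open>k \<in> N\<close>), where the exchange polynomial \<open>E\<^sub>k\<close> contains no mutable variable.
  Comparing the terms of one multidegree
  \<open>\<alpha>\<close> in the mutable variables, with \<open>N\<close> the set of negative entries of \<open>\<alpha>\<close>, shows that their
  coefficient is divisible by \<open>\<Prod>k\<in>N. E\<^sub>k ^ (- \<alpha>\<^sub>k)\<close>; so \<open>f\<close> is a polynomial in the \<open>x\<^sub>k\<close>, the mutated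
  variables \<open>E\<^sub>k / x\<^sub>k\<close> and the frozen variables with their inverses
  (\<open>flipped_laurent_in_subring\<close>).

  The Laurent phenomenon is proved by induction on the number of mutations.  For a path that
  starts with mutations at \<open>j \<noteq> k\<close>, let \<open>y\<close>, \<open>z\<close>, \<open>u\<close> be the new variables after mutating at \<open>j\<close>, at
  \<open>k\<close> and at \<open>j\<close> again.  The induction hypothesis, applied to the seed after one mutation and to
  the seed after three, puts all later variables into \<open>L[y\<inverse>] \<inter> L[(z u)\<inverse>]\<close>, where \<open>L\<close> is the Laurent
  polynomial ring of the initial cluster.  If some frozen vertex has exactly one arrow, and that at
  \<open>j\<close>, then \<open>y\<close> is prime and divides neither \<open>z\<close> nor \<open>u\<close>, and the intersection is \<open>L\<close>.
  Such a vertex can always be added first and its variable set to 1 afterwards.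

  The algebraic independence of the cluster enters only through the fact that expressions without
  subtraction do not vanish: all clusters stay in a subset of the field that is closed under
  addition, multiplication and division and does not contain 0 (\<open>cone\<close>, \<open>positive_seed\<close>).
\<close>


section \<open>Ring homomorphisms out of Laurent polynomials\<close>

locale ring_morphism =
  fixes h :: "'a::comm_ring_1 \<Rightarrow> 'b::comm_ring_1"
  assumes one [simp]: "h 1 = 1"
    and add [simp]: "h (x + y) = h x + h y"
    and mult [simp]: "h (x * y) = h x * h y"
begin

lemma zero [simp]: "h 0 = 0"
  using add[of 0 0] by simp

lemma uminus [simp]: "h (- x) = - h x"
  using add[of x "- x"] by (simp add: eq_neg_iff_add_eq_0 add.commute)

lemma diff [simp]: "h (x - y) = h x - h y"
  using add[of x "- y"] by simp

lemma power [simp]: "h (x ^ n) = h x ^ n"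
  by (induction n) auto

lemma sum: "h (\<Sum>i\<in>A. f i) = (\<Sum>i\<in>A. h (f i))"
  by (induction A rule: infinite_finite_induct) auto

lemma prod: "h (\<Prod>i\<in>A. f i) = (\<Prod>i\<in>A. h (f i))"
  by (induction A rule: infinite_finite_induct) auto

end

lemma ring_morphism_comp:
  "ring_morphism g \<Longrightarrow> ring_morphism h \<Longrightarrow> ring_morphism (\<lambda>x. g (h x))"
  by (simp add: ring_morphism_def)

lemma ring_morphism_of_int: "ring_morphism (of_int :: int \<Rightarrow> 'a::comm_ring_1)"
  by unfold_locales auto

lemma poly_mapping_sum_singles:
  "(\<Sum>m\<in>Poly_Mapping.keys f. Poly_Mapping.single m (Poly_Mapping.lookup f m)) = f"
  by (rule poly_mapping_eqI)
     (simp add: lookup_sum lookup_single when_def in_keys_iff)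

lemma prod_single_one:
  "(\<Prod>i\<in>A. Poly_Mapping.single (g i) (1::'c::comm_ring_1)) =
   Poly_Mapping.single (\<Sum>i\<in>A. g i) 1"
  by (induction A rule: infinite_finite_induct) (auto simp: mult_single)

text \<open>
  This covers both kinds of evaluation: a morphism \<open>c\<close> on the coefficients and a multiplicative map
  \<open>\<chi>\<close> on the monomials, with natural or with integer exponents.
\<close>

definition linear_extension ::
    "('c::comm_ring_1 \<Rightarrow> 'r::comm_ring_1) \<Rightarrow> ('m::comm_monoid_add \<Rightarrow> 'r) \<Rightarrow> ('m \<Rightarrow>\<^sub>0 'c) \<Rightarrow> 'r"
  where "linear_extension c \<chi> f =
    (\<Sum>m\<in>Poly_Mapping.keys f. c (Poly_Mapping.lookup f m) * \<chi> m)"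

lemma linear_extension_superset:
  assumes "ring_morphism c" "finite A" "Poly_Mapping.keys f \<subseteq> A"
  shows "linear_extension c \<chi> f = (\<Sum>m\<in>A. c (Poly_Mapping.lookup f m) * \<chi> m)"
  unfolding linear_extension_def
  by (rule sum.mono_neutral_left)
     (use assms in \<open>auto simp: in_keys_iff ring_morphism.zero\<close>)

lemma linear_extension_add:
  assumes "ring_morphism c"
  shows "linear_extension c \<chi> (f + g) = linear_extension c \<chi> f + linear_extension c \<chi> g"
proof -
  let ?A = "Poly_Mapping.keys f \<union> Poly_Mapping.keys g"
  have "Poly_Mapping.keys (f + g) \<subseteq> ?A"
    by (rule keys_add)
  then show ?thesis
    using assms
    by (simp add: linear_extension_superset[of c ?A] lookup_add ring_morphism.add
        sum.distrib ring_distribs)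
qed

lemma linear_extension_sum:
  assumes "ring_morphism c"
  shows "linear_extension c \<chi> (\<Sum>i\<in>A. f i) = (\<Sum>i\<in>A. linear_extension c \<chi> (f i))"
proof (induction A rule: infinite_finite_induct)
  case (insert x F)
  then show ?case by (simp add: linear_extension_add[OF assms])
qed (simp_all add: linear_extension_def)

lemma linear_extension_single:
  assumes "ring_morphism c"
  shows "linear_extension c \<chi> (Poly_Mapping.single m x) = c x * \<chi> m"
  using linear_extension_superset[of c "{m}" "Poly_Mapping.single m x" \<chi>] assms by auto

lemma ring_morphism_linear_extension:
  fixes c :: "'c::comm_ring_1 \<Rightarrow> 'r::comm_ring_1" and \<chi> :: "'m::comm_monoid_add \<Rightarrow> 'r"
  assumes c: "ring_morphism c" and \<chi>: "\<chi> 0 = 1" "\<And>m n. \<chi> (m + n) = \<chi> m * \<chi> n"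
  shows "ring_morphism (linear_extension c \<chi>)"
proof
  fix f g :: "'m \<Rightarrow>\<^sub>0 'c"
  let ?E = "linear_extension c \<chi>"
  let ?f = "\<lambda>m. Poly_Mapping.single m (Poly_Mapping.lookup f m)"
  let ?g = "\<lambda>m. Poly_Mapping.single m (Poly_Mapping.lookup g m)"
  show "?E 1 = 1"
    using linear_extension_single[OF c, of \<chi> 0 1] \<chi> c by (simp add: ring_morphism.one)
  show "?E (f + g) = ?E f + ?E g"
    by (rule linear_extension_add[OF c])
  have "f * g = (\<Sum>m\<in>Poly_Mapping.keys f. ?f m) * (\<Sum>m\<in>Poly_Mapping.keys g. ?g m)"
    by (simp only: poly_mapping_sum_singles)
  also have "\<dots> = (\<Sum>m\<in>Poly_Mapping.keys f. \<Sum>n\<in>Poly_Mapping.keys g. ?f m * ?g n)"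
    by (rule sum_product)
  finally have "?E (f * g) =
      (\<Sum>m\<in>Poly_Mapping.keys f. \<Sum>n\<in>Poly_Mapping.keys g. ?E (?f m * ?g n))"
    by (simp only: linear_extension_sum[OF c])
  also have "\<dots> = (\<Sum>m\<in>Poly_Mapping.keys f. \<Sum>n\<in>Poly_Mapping.keys g.
      (c (Poly_Mapping.lookup f m) * \<chi> m) * (c (Poly_Mapping.lookup g n) * \<chi> n))"
    by (simp add: mult_single linear_extension_single[OF c] ring_morphism.mult[OF c] \<chi> mult_ac)
  also have "\<dots> = ?E f * ?E g"
    by (simp add: linear_extension_def sum_product)
  finally show "?E (f * g) = ?E f * ?E g" .
qed

text \<open>
  The \<open>z\<close>-th power of a unit \<open>a\<close> with inverse \<open>b\<close>.  The inverse is a separate argument so that units of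
  rings that are not fields, such as variables in a Laurent polynomial ring, can be substituted.
\<close>

definition unit_power :: "'r::comm_ring_1 \<Rightarrow> 'r \<Rightarrow> int \<Rightarrow> 'r"
  where "unit_power a b z = (if 0 \<le> z then a ^ nat z else b ^ nat (- z))"

lemma unit_power_diff:
  assumes "a * b = 1"
  shows "unit_power a b (int p - int q) = a ^ p * b ^ q"
proof (cases "q \<le> p")
  case True
  then have "a ^ p * b ^ q = a ^ (p - q) * (a ^ q * b ^ q)"
    by (simp add: power_add[symmetric] mult.assoc[symmetric])
  with True assms show ?thesis
    by (simp add: unit_power_def nat_diff_distrib flip: power_mult_distrib)
next
  case False
  then have "a ^ p * b ^ q = (a ^ p * b ^ p) * b ^ (q - p)"
    by (simp add: power_add[symmetric] mult.assoc)
  with False assms show ?thesis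
    by (simp add: unit_power_def nat_diff_distrib flip: power_mult_distrib)
qed

lemma unit_power_add:
  assumes "a * b = 1"
  shows "unit_power a b (z + w) = unit_power a b z * unit_power a b w"
proof -
  obtain p q where z: "z = int p - int q" by (metis int_diff_cases)
  obtain r s where w: "w = int r - int s" by (metis int_diff_cases)
  have "z + w = int (p + r) - int (q + s)" using z w by simp
  then have "unit_power a b (z + w) = a ^ (p + r) * b ^ (q + s)"
    by (simp only: unit_power_diff[OF assms])
  then show ?thesis
    by (simp add: z w unit_power_diff[OF assms] power_add mult_ac)
qed

lemma unit_power_0 [simp]: "unit_power a b 0 = 1"
  by (simp add: unit_power_def)

definition unit_monomial :: "(nat \<Rightarrow> 'r::comm_ring_1) \<Rightarrow> (nat \<Rightarrow> 'r) \<Rightarrow> (nat \<Rightarrow>\<^sub>0 int) \<Rightarrow> 'r"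
  where "unit_monomial a b m =
    (\<Prod>i\<in>Poly_Mapping.keys m. unit_power (a i) (b i) (Poly_Mapping.lookup m i))"

lemma unit_monomial_superset:
  assumes "finite A" "Poly_Mapping.keys m \<subseteq> A"
  shows "unit_monomial a b m = (\<Prod>i\<in>A. unit_power (a i) (b i) (Poly_Mapping.lookup m i))"
  unfolding unit_monomial_def
  by (rule prod.mono_neutral_left) (use assms in \<open>auto simp: in_keys_iff\<close>)

lemma unit_monomial_add:
  assumes "\<And>i. a i * b i = 1"
  shows "unit_monomial a b (m + n) = unit_monomial a b m * unit_monomial a b n"
proof -
  let ?A = "Poly_Mapping.keys m \<union> Poly_Mapping.keys n"
  have "Poly_Mapping.keys (m + n) \<subseteq> ?A"
    by (rule keys_add)
  then show ?thesis
    by (simp add: unit_monomial_superset[of ?A] lookup_add unit_power_add[OF assms] prod.distrib)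
qed

text \<open>
  Integral Laurent polynomials in countably many variables.  The formal ring is an integral domain
  with an evaluation at any tuple of units, so an identity proved once for indeterminates can be
  transported to every seed.
\<close>

type_synonym laurent = "(nat \<Rightarrow>\<^sub>0 int) \<Rightarrow>\<^sub>0 int"

definition laurent_eval :: "(nat \<Rightarrow> 'r::comm_ring_1) \<Rightarrow> (nat \<Rightarrow> 'r) \<Rightarrow> laurent \<Rightarrow> 'r"
  where "laurent_eval a b = linear_extension of_int (unit_monomial a b)"

lemma ring_morphism_laurent_eval:
  assumes "\<And>i. a i * b i = 1"
  shows "ring_morphism (laurent_eval a b)"
  unfolding laurent_eval_def
  by (rule ring_morphism_linear_extension)
     (auto simp: ring_morphism_of_int unit_monomial_add[OF assms], simp add: unit_monomial_def)

definition lvar :: "nat \<Rightarrow> laurent"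
  where "lvar i = Poly_Mapping.single (Poly_Mapping.single i 1) 1"

definition linv :: "nat \<Rightarrow> laurent"
  where "linv i = Poly_Mapping.single (Poly_Mapping.single i (- 1)) 1"

lemma lvar_linv [simp]: "lvar i * linv i = 1"
  by (simp add: lvar_def linv_def mult_single flip: single_add)

lemma lvar_nonzero [simp]: "lvar i \<noteq> 0"
  by (metis lvar_linv mult_zero_left zero_neq_one)

lemma laurent_eval_lvar [simp]: "laurent_eval a b (lvar i) = a i"
  by (simp add: laurent_eval_def lvar_def linear_extension_single ring_morphism_of_int
      unit_monomial_def unit_power_def)

lemma laurent_eval_linv [simp]: "laurent_eval a b (linv i) = b i"
  by (simp add: laurent_eval_def linv_def linear_extension_single ring_morphism_of_int
      unit_monomial_def unit_power_def)

definition subring_set :: "'r::comm_ring_1 set \<Rightarrow> bool"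
  where "subring_set R \<longleftrightarrow>
    1 \<in> R \<and> (\<forall>x\<in>R. - x \<in> R) \<and> (\<forall>x\<in>R. \<forall>y\<in>R. x + y \<in> R \<and> x * y \<in> R)"

lemma subring_setI:
  assumes "1 \<in> R" "\<And>x. x \<in> R \<Longrightarrow> - x \<in> R"
    "\<And>x y. x \<in> R \<Longrightarrow> y \<in> R \<Longrightarrow> x + y \<in> R" "\<And>x y. x \<in> R \<Longrightarrow> y \<in> R \<Longrightarrow> x * y \<in> R"
  shows "subring_set R"
  using assms by (auto simp: subring_set_def)

context
  fixes R :: "'r::comm_ring_1 set"
  assumes R: "subring_set R"
begin

lemma subring_set_one: "1 \<in> R"
  and subring_set_uminus: "x \<in> R \<Longrightarrow> - x \<in> R"
  and subring_set_add: "x \<in> R \<Longrightarrow> y \<in> R \<Longrightarrow> x + y \<in> R"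
  and subring_set_mult: "x \<in> R \<Longrightarrow> y \<in> R \<Longrightarrow> x * y \<in> R"
  using R by (auto simp: subring_set_def)

lemma subring_set_zero: "0 \<in> R"
  using subring_set_add[OF subring_set_one subring_set_uminus[OF subring_set_one]] by simp

lemma subring_set_power: "x \<in> R \<Longrightarrow> x ^ n \<in> R"
  by (induction n) (auto intro: subring_set_one subring_set_mult)

lemma subring_set_prod: "(\<And>i. i \<in> A \<Longrightarrow> f i \<in> R) \<Longrightarrow> (\<Prod>i\<in>A. f i) \<in> R"
  by (induction A rule: infinite_finite_induct) (auto intro: subring_set_one subring_set_mult)

lemma subring_set_sum: "(\<And>i. i \<in> A \<Longrightarrow> f i \<in> R) \<Longrightarrow> (\<Sum>i\<in>A. f i) \<in> R"
  by (induction A rule: infinite_finite_induct) (auto intro: subring_set_zero subring_set_add)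

lemma subring_set_of_int: "of_int z \<in> R"
proof -
  have "of_nat n \<in> R" for n
    by (induction n) (auto intro: subring_set_zero subring_set_one subring_set_add)
  then show ?thesis
    by (cases z rule: int_cases2) (auto intro: subring_set_uminus)
qed

lemma laurent_eval_in_subring:
  assumes "\<And>i. a i \<in> R" "\<And>i. b i \<in> R"
  shows "laurent_eval a b f \<in> R"
  unfolding laurent_eval_def linear_extension_def unit_monomial_def unit_power_def
  by (auto intro!: subring_set_sum subring_set_mult subring_set_of_int subring_set_prod
      subring_set_power assms)

end

lemma unit_monomial_vars: "unit_monomial lvar linv m = Poly_Mapping.single m 1"
proof -
  have pow: "Poly_Mapping.single x (1::int) ^ n = Poly_Mapping.single (\<Sum>_<n. x) 1"
    for x :: "nat \<Rightarrow>\<^sub>0 int" and n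
    by (induction n) (auto simp: mult_single add.commute simp del: sum_constant)
  have sum: "(\<Sum>_<n. Poly_Mapping.single i z) = Poly_Mapping.single i (of_nat n * z)"
    for n i and z :: int
    by (induction n) (auto simp: algebra_simps simp del: sum_constant simp flip: single_add)
  have "unit_power (lvar i) (linv i) z = Poly_Mapping.single (Poly_Mapping.single i z) 1" for i z
    by (simp add: unit_power_def lvar_def linv_def pow sum del: sum_constant)
  then show ?thesis
    by (simp add: unit_monomial_def prod_single_one poly_mapping_sum_singles)
qed

lemma laurent_eval_vars: "laurent_eval lvar linv f = f"
proof -
  have "of_int c * (Poly_Mapping.single m 1 :: laurent) = Poly_Mapping.single m c" for c m
  proof -
    have "(of_int c :: laurent) = Poly_Mapping.single 0 c"
      using single_of_int[of c, where 'a="nat \<Rightarrow>\<^sub>0 int" and 'b=int] by simp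
    then show ?thesis by (simp add: mult_single)
  qed
  then show ?thesis
    unfolding laurent_eval_def linear_extension_def
    by (simp add: unit_monomial_vars poly_mapping_sum_singles)
qed

text \<open>
  Used as an induction principle: a property that defines a subring holds for all Laurent
  polynomials once it holds for the variables and their inverses.
\<close>

lemma laurent_in_subring:
  assumes "subring_set R" "\<And>i. lvar i \<in> R" "\<And>i. linv i \<in> R"
  shows "f \<in> R"
  using laurent_eval_in_subring[of R lvar linv f] assms by (simp add: laurent_eval_vars)

lemma ring_morphism_laurent_unique:
  fixes g h :: "laurent \<Rightarrow> 'r::comm_ring_1"
  assumes "ring_morphism g" "ring_morphism h" "\<And>i. g (lvar i) = h (lvar i)"
  shows "g f = h f"
proof -
  interpret g: ring_morphism g by fact
  interpret h: ring_morphism h by fact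
  have "g (linv i) = h (linv i)" for i
  proof -
    have "h (linv i) = h (linv i) * (g (lvar i) * g (linv i))"
      by (simp flip: g.mult)
    also have "\<dots> = (h (lvar i) * h (linv i)) * g (linv i)"
      by (simp add: assms(3))
    also have "\<dots> = g (linv i)"
      by (simp flip: h.mult)
    finally show ?thesis ..
  qed
  moreover have "subring_set {f. g f = h f}"
    by (rule subring_setI) auto
  ultimately show ?thesis
    using laurent_in_subring[of "{f. g f = h f}" f] assms(3) by auto
qed

section \<open>Mutation of exchange matrices and of tuples in a field\<close>

definition skew_on :: "nat set \<Rightarrow> (nat \<Rightarrow> nat \<Rightarrow> int) \<Rightarrow> bool"
  where "skew_on V B \<longleftrightarrow>
    finite V \<and> (\<forall>i j. B i j = - B j i) \<and> (\<forall>i j. B i j \<noteq> 0 \<longrightarrow> i \<in> V \<and> j \<in> V)"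

lemma skew_onD:
  assumes "skew_on V B"
  shows "finite V" "B i j = - B j i" "B i i = 0" "B i j \<noteq> 0 \<Longrightarrow> i \<in> V" "B i j \<noteq> 0 \<Longrightarrow> j \<in> V"
proof -
  show *: "B i j = - B j i" for i j using assms unfolding skew_on_def by blast
  show "B i i = 0" using *[of i i] by simp
  show "finite V" "B i j \<noteq> 0 \<Longrightarrow> i \<in> V" "B i j \<noteq> 0 \<Longrightarrow> j \<in> V"
    using assms unfolding skew_on_def by blast+
qed

lemma skew_onI:
  assumes "finite V" "\<And>i j. B i j = - B j i" "\<And>i j. B i j \<noteq> 0 \<Longrightarrow> i \<in> V \<and> j \<in> V"
  shows "skew_on V B"
  using assms unfolding skew_on_def by blast

text \<open>
  The case distinction makes the division by 2 disappear: the numerator is plus or minus twice the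
  product when both entries have the same sign, and 0 otherwise.
\<close>

lemma mutation_term:
  "(\<bar>x\<bar> * y + x * \<bar>y\<bar>) div 2 =
   (if 0 < x \<and> 0 < y then x * y else if x < 0 \<and> y < 0 then - (x * y) else (0::int))"
  by (auto simp: abs_if not_less mult_nonneg_nonpos mult_nonpos_nonneg)

lemma mutate_arr_skew:
  assumes "skew_on V B"
  shows "skew_on V (mutate_arr k B)"
proof -
  note B = skew_onD[OF assms]
  have "mutate_arr k B i j = - mutate_arr k B j i" for i j
  proof -
    have *: "B j i = - B i j" "B k i = - B i k" "B j k = - B k j" using B(2) by blast+
    show ?thesis unfolding mutate_arr_def mutation_term * by simp
  qed
  moreover have "i \<in> V \<and> j \<in> V" if "mutate_arr k B i j \<noteq> 0" for i j
  proof (rule ccontr)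
    assume "\<not> (i \<in> V \<and> j \<in> V)"
    then have "B i j = 0" "B i k = 0 \<or> B k j = 0"
      using B(4,5) by blast+
    then show False
      using that by (auto simp: mutate_arr_def split: if_splits)
  qed
  ultimately show ?thesis
    using B(1) unfolding skew_on_def by blast
qed

lemma mutate_arr_involution:
  assumes "skew_on V B"
  shows "mutate_arr k (mutate_arr k B) = B"
  using skew_onD(3)[OF assms, of k]
  by (intro ext) (auto simp: mutate_arr_def mutation_term)

lemma mutate_arr_reverse: "mutate_arr k (\<lambda>i j. - B i j) = (\<lambda>i j. - mutate_arr k B i j)"
  by (intro ext) (auto simp: mutate_arr_def mutation_term)

text \<open>
  The numerator of the exchange relation at \<open>k\<close>.  Since \<open>nat\<close> is 0 on negative numbers, both products
  may run over all vertices.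
\<close>

definition exchange :: "nat set \<Rightarrow> (nat \<Rightarrow> nat \<Rightarrow> int) \<Rightarrow> nat \<Rightarrow> (nat \<Rightarrow> 'a::comm_semiring_1) \<Rightarrow> 'a"
  where "exchange V B k a = (\<Prod>i\<in>V. a i ^ nat (B k i)) + (\<Prod>i\<in>V. a i ^ nat (- B k i))"

lemma exchange_reverse: "exchange V (\<lambda>i j. - B i j) k a = exchange V B k a"
  by (simp add: exchange_def add.commute)

lemma exchange_cong:
  assumes "\<And>i. i \<in> V \<Longrightarrow> B k i \<noteq> 0 \<Longrightarrow> a i = b i"
  shows "exchange V B k a = exchange V B k b"
proof -
  have "a i ^ nat (B k i) = b i ^ nat (B k i)" "a i ^ nat (- B k i) = b i ^ nat (- B k i)"
    if "i \<in> V" for i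
    using assms[of i] that by (cases "B k i = 0"; simp)+
  then show ?thesis by (simp add: exchange_def)
qed

lemma (in ring_morphism) exchange:
  "h (exchange V B k a) = exchange V B k (\<lambda>i. h (a i))"
  by (simp add: exchange_def prod)

definition mutate_at ::
    "nat set \<Rightarrow> (nat \<Rightarrow> nat \<Rightarrow> int) \<Rightarrow> nat \<Rightarrow> (nat \<Rightarrow> 'a::field) \<Rightarrow> nat \<Rightarrow> 'a"
  where "mutate_at V B k a = a(k := exchange V B k a / a k)"

lemma mutate_at_reverse: "mutate_at V (\<lambda>i j. - B i j) k a = mutate_at V B k a"
  by (simp add: mutate_at_def exchange_reverse)

fun mutate_along ::
    "nat set \<Rightarrow> nat list \<Rightarrow> (nat \<Rightarrow> nat \<Rightarrow> int) \<Rightarrow> (nat \<Rightarrow> 'a::field) \<Rightarrow> nat \<Rightarrow> 'a"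
  where
    "mutate_along V [] B a = a"
  | "mutate_along V (k # ks) B a = mutate_along V ks (mutate_arr k B) (mutate_at V B k a)"

fun stays_in ::
    "nat set \<Rightarrow> 'a::field set \<Rightarrow> nat list \<Rightarrow> (nat \<Rightarrow> nat \<Rightarrow> int) \<Rightarrow> (nat \<Rightarrow> 'a) \<Rightarrow> bool"
  where
    "stays_in V R [] B a \<longleftrightarrow> range a \<subseteq> R"
  | "stays_in V R (k # ks) B a \<longleftrightarrow>
      range a \<subseteq> R \<and> stays_in V R ks (mutate_arr k B) (mutate_at V B k a)"

lemma stays_in_start: "stays_in V R ks B a \<Longrightarrow> range a \<subseteq> R"
  by (cases ks) auto

lemma stays_in_end: "stays_in V R ks B a \<Longrightarrow> range (mutate_along V ks B a) \<subseteq> R"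
  by (induction ks arbitrary: B a) auto

lemma stays_in_append:
  "stays_in V R (ks @ ls) B a \<Longrightarrow>
   stays_in V R ls (fold mutate_arr ks B) (mutate_along V ks B a)"
  by (induction ks arbitrary: B a) auto

lemma stays_in_mono: "stays_in V R ks B a \<Longrightarrow> R \<subseteq> R' \<Longrightarrow> stays_in V R' ks B a"
  by (induction ks arbitrary: B a) auto

lemma stays_in_Int:
  "stays_in V R ks B a \<Longrightarrow> stays_in V R' ks B a \<Longrightarrow> stays_in V (R \<inter> R') ks B a"
  by (induction ks arbitrary: B a) auto

text \<open>
  Reversing all arrows exchanges the two monomials of every exchange relation, so a sign of one
  entry of \<open>B\<close> can be chosen freely.
\<close>

lemma stays_in_reverse: "stays_in V R ks (\<lambda>i j. - B i j) a \<longleftrightarrow> stays_in V R ks B a"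
proof (induction ks arbitrary: B a)
  case (Cons k ks)
  then show ?case by (simp add: mutate_arr_reverse mutate_at_reverse)
qed simp

lemma mutate_at_involution:
  assumes "skew_on V B" "a k \<noteq> 0" "exchange V B k a \<noteq> 0"
  shows "mutate_at V (mutate_arr k B) k (mutate_at V B k a) = a"
proof -
  have "exchange V (mutate_arr k B) k (mutate_at V B k a) = exchange V (\<lambda>i j. - B i j) k (mutate_at V B k a)"
    by (simp add: exchange_def mutate_arr_def)
  also have "\<dots> = exchange V B k a"
    unfolding exchange_reverse
    by (rule exchange_cong) (auto simp: mutate_at_def skew_onD(3)[OF assms(1)])
  finally show ?thesis
    using assms by (auto simp: mutate_at_def)
qed

subsection \<open>Cones\<close>

text \<open>
  Mutation uses addition, multiplication and division only, so a tuple in a cone never leaves it, and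
  no denominator ever vanishes.
\<close>

definition cone :: "'a::field set \<Rightarrow> bool"
  where "cone P \<longleftrightarrow> 1 \<in> P \<and> 0 \<notin> P \<and> (\<forall>x\<in>P. \<forall>y\<in>P. x + y \<in> P \<and> x * y \<in> P \<and> x / y \<in> P)"

lemma cone_power: "cone P \<Longrightarrow> x \<in> P \<Longrightarrow> x ^ n \<in> P"
  by (induction n) (auto simp: cone_def)

lemma cone_prod: "cone P \<Longrightarrow> (\<And>i. i \<in> A \<Longrightarrow> f i \<in> P) \<Longrightarrow> (\<Prod>i\<in>A. f i) \<in> P"
  by (induction A rule: infinite_finite_induct) (auto simp: cone_def)

lemma cone_exchange:
  assumes "cone P" "\<And>i. i \<in> V \<Longrightarrow> a i \<in> P"
  shows "exchange V B k a \<in> P"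
proof -
  have "(\<Prod>i\<in>V. a i ^ nat (B k i)) \<in> P" "(\<Prod>i\<in>V. a i ^ nat (- B k i)) \<in> P"
    using assms by (auto intro!: cone_prod cone_power)
  then show ?thesis using assms(1) by (simp add: exchange_def cone_def)
qed

lemma cone_mutate_at:
  assumes "cone P" "range a \<subseteq> P"
  shows "range (mutate_at V B k a) \<subseteq> P"
  using assms cone_exchange[OF assms(1), of V a B k] by (auto simp: mutate_at_def cone_def)

lemma stays_in_cone: "cone P \<Longrightarrow> range a \<subseteq> P \<Longrightarrow> stays_in V P ks B a"
proof (induction ks arbitrary: B a)
  case (Cons k ks)
  then show ?case using cone_mutate_at[of P a V B k] by simp
qed simp

lemma stays_nonzero: "cone P \<Longrightarrow> range a \<subseteq> P \<Longrightarrow> stays_in V (- {0}) ks B a"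
  by (rule stays_in_mono[OF stays_in_cone]) (auto simp: cone_def)

text \<open>
  Quotients of values of \<open>h\<close> at elements that are positive in some sense form a cone, as soon as no
  positive element is sent to 0.
\<close>

lemma cone_of_fractions:
  fixes h :: "'a::comm_ring_1 \<Rightarrow> 'k::field"
  assumes h: "ring_morphism h"
    and S: "1 \<in> S" "\<And>p q. p \<in> S \<Longrightarrow> q \<in> S \<Longrightarrow> p + q \<in> S" "\<And>p q. p \<in> S \<Longrightarrow> q \<in> S \<Longrightarrow> p * q \<in> S"
      "\<And>p. p \<in> S \<Longrightarrow> h p \<noteq> 0"
  shows "cone {h p / h q | p q. p \<in> S \<and> q \<in> S}" (is "cone ?P")
proof -
  interpret ring_morphism h by (rule h)
  have add_in: "x + y \<in> ?P" and mult_in: "x * y \<in> ?P" and div_in: "x / y \<in> ?P"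
    if "x \<in> ?P" "y \<in> ?P" for x y
  proof -
    obtain p q r s where pq: "p \<in> S" "q \<in> S" "r \<in> S" "s \<in> S"
      and x: "x = h p / h q" and y: "y = h r / h s"
      using \<open>x \<in> ?P\<close> \<open>y \<in> ?P\<close> by auto
    note nz = pq[THEN S(4)]
    have *: "h p' / h q' \<in> ?P" if "p' \<in> S" "q' \<in> S" for p' q'
      using that by blast
    have sum: "x + y = h (p * s + r * q) / h (q * s)"
      and prod: "x * y = h (p * r) / h (q * s)" and quot: "x / y = h (p * s) / h (q * r)"
      using nz by (simp_all add: x y field_simps)
    show "x + y \<in> ?P" unfolding sum using pq by (intro * S(2,3))
    show "x * y \<in> ?P" unfolding prod using pq by (intro * S(2,3))
    show "x / y \<in> ?P" unfolding quot using pq by (intro * S(2,3))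
  qed
  have "1 = h 1 / h 1" by simp
  with S(1) have "1 \<in> ?P" by (intro CollectI exI[of _ 1]) simp
  moreover have "0 \<notin> ?P" using S(4) by auto
  ultimately show ?thesis
    unfolding cone_def using add_in mult_in div_in by (intro conjI ballI)
qed

subsection \<open>Transport of mutations along ring homomorphisms\<close>

text \<open>
  An exchange relation whose new variable lies in the image of the injective map \<open>\<iota>\<close> is an identity
  in the ring \<open>'a\<close>, and \<open>h\<close> maps it to the corresponding exchange relation in the field \<open>'k\<close>.
\<close>

lemma mutate_at_transfer:
  fixes \<iota> :: "'a::comm_ring_1 \<Rightarrow> 'f::field" and h :: "'a \<Rightarrow> 'k::field"
  assumes "ring_morphism \<iota>" "inj \<iota>" "ring_morphism h"
    and "range (mutate_at V B k (\<lambda>i. \<iota> (f i))) \<subseteq> range \<iota>"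
    and "\<iota> (f k) \<noteq> 0" "h (f k) \<noteq> 0"
  obtains g where "mutate_at V B k (\<lambda>i. \<iota> (f i)) = (\<lambda>i. \<iota> (g i))"
    "mutate_at V B k (\<lambda>i. h (f i)) = (\<lambda>i. h (g i))"
proof -
  interpret \<iota>: ring_morphism \<iota> by fact
  interpret h: ring_morphism h by fact
  have "exchange V B k (\<lambda>i. \<iota> (f i)) / \<iota> (f k) \<in> range \<iota>"
    using assms(4) by (force simp: mutate_at_def)
  then obtain c where c: "exchange V B k (\<lambda>i. \<iota> (f i)) / \<iota> (f k) = \<iota> c" by auto
  have "\<iota> (exchange V B k f) = \<iota> (c * f k)"
    using c assms(5) by (simp add: \<iota>.exchange divide_eq_eq)
  then have "exchange V B k f = c * f k"
    by (rule injD[OF assms(2)])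
  then have "exchange V B k (\<lambda>i. h (f i)) = h c * h (f k)"
    by (simp flip: h.exchange h.mult)
  then have "exchange V B k (\<lambda>i. h (f i)) / h (f k) = h c"
    using assms(6) by simp
  with c show thesis
    by (intro that[of "f(k := c)"]) (auto simp: mutate_at_def fun_eq_iff)
qed

text \<open>
  A mutation path that stays in the ring \<open>'a\<close> can be mapped to any field.  With \<open>'a\<close> the Laurent
  polynomials and \<open>h\<close> an evaluation, this passes from indeterminates to an arbitrary cluster.
\<close>

lemma stays_in_transfer:
  fixes \<iota> :: "'a::comm_ring_1 \<Rightarrow> 'f::field" and h :: "'a \<Rightarrow> 'k::field"
  assumes "ring_morphism \<iota>" "inj \<iota>" "ring_morphism h"
    and "stays_in V (range \<iota>) ks B (\<lambda>i. \<iota> (f i))"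
    and "stays_in V (- {0}) ks B (\<lambda>i. \<iota> (f i))" "stays_in V (- {0}) ks B (\<lambda>i. h (f i))"
  shows "stays_in V (range h) ks B (\<lambda>i. h (f i)) \<and>
    (\<exists>g. mutate_along V ks B (\<lambda>i. \<iota> (f i)) = (\<lambda>i. \<iota> (g i)) \<and>
         mutate_along V ks B (\<lambda>i. h (f i)) = (\<lambda>i. h (g i)))"
  using assms(4-6)
proof (induction ks arbitrary: B f)
  case (Cons k ks)
  have "range (mutate_at V B k (\<lambda>i. \<iota> (f i))) \<subseteq> range \<iota>"
    using Cons.prems(1) by (intro stays_in_start[of V _ ks "mutate_arr k B"]) simp
  moreover have "\<iota> (f k) \<noteq> 0" "h (f k) \<noteq> 0"
    using Cons.prems(2,3) by auto
  ultimately obtain g where g: "mutate_at V B k (\<lambda>i. \<iota> (f i)) = (\<lambda>i. \<iota> (g i))"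
    "mutate_at V B k (\<lambda>i. h (f i)) = (\<lambda>i. h (g i))"
    using mutate_at_transfer[OF assms(1-3)] by metis
  have "stays_in V (range h) ks (mutate_arr k B) (\<lambda>i. h (g i)) \<and>
    (\<exists>g'. mutate_along V ks (mutate_arr k B) (\<lambda>i. \<iota> (g i)) = (\<lambda>i. \<iota> (g' i)) \<and>
         mutate_along V ks (mutate_arr k B) (\<lambda>i. h (g i)) = (\<lambda>i. h (g' i)))"
    using Cons.IH[of "mutate_arr k B" g] Cons.prems by (simp add: g)
  then show ?case by (auto simp: g)
qed auto

subsection \<open>Adding a disconnected vertex\<close>

text \<open>
  A vertex \<open>m\<close> at which the path never mutates and whose variable is 1 contributes only factors 1,
  so its arrows can be deleted.
\<close>

lemma stays_in_extend_vertex: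
  assumes "finite V" "m \<notin> V" "m \<notin> set ks" "stays_in (insert m V) R ks C b"
    and "\<And>i j. i \<noteq> m \<Longrightarrow> j \<noteq> m \<Longrightarrow> C i j = B i j" "\<And>i. B i m = 0" "\<And>i. B m i = 0"
    and "\<And>i. i \<noteq> m \<Longrightarrow> a i = b i" "b m = 1" "a m \<in> R"
  shows "stays_in V R ks B a"
  using assms(3-)
proof (induction ks arbitrary: B C a b)
  case Nil
  have "a i \<in> R" for i
    using Nil by (cases "i = m") auto
  then show ?case by auto
next
  case (Cons k ks)
  have k: "k \<noteq> m" using Cons.prems by auto
  have "a i \<in> R" for i
    using Cons.prems by (cases "i = m") auto
  then have 1: "range a \<subseteq> R" by auto
  have e: "(\<Prod>i\<in>insert m V. b i ^ nat (s * C k i)) = (\<Prod>i\<in>V. a i ^ nat (s * B k i))" for s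
  proof -
    have "b i ^ nat (s * C k i) = a i ^ nat (s * B k i)" if "i \<in> V" for i
    proof -
      have "i \<noteq> m" using that assms(2) by auto
      then show ?thesis using Cons.prems(3)[OF k, of i] Cons.prems(6)[of i] by simp
    qed
    then show ?thesis
      using assms(1,2) \<open>b m = 1\<close> by simp
  qed
  have "exchange (insert m V) C k b = exchange V B k a"
    using e[of 1] e[of "-1"] by (simp add: exchange_def)
  then have eq: "mutate_at V B k a i = mutate_at (insert m V) C k b i" if "i \<noteq> m" for i
    using that Cons.prems(6) by (auto simp: mutate_at_def)
  have "stays_in V R ks (mutate_arr k B) (mutate_at V B k a)"
  proof (rule Cons.IH[where C = "mutate_arr k C" and b = "mutate_at (insert m V) C k b"])
    show "stays_in (insert m V) R ks (mutate_arr k C) (mutate_at (insert m V) C k b)"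
      using Cons.prems(2) by simp
    show "mutate_arr k C i j = mutate_arr k B i j" if "i \<noteq> m" "j \<noteq> m" for i j
      using that k Cons.prems(3) by (simp add: mutate_arr_def)
  qed (use Cons.prems k eq in \<open>auto simp: mutate_arr_def mutate_at_def\<close>)
  with 1 show ?case by simp
qed

subsection \<open>The field of fractions of the Laurent polynomials\<close>

definition frac_of :: "'a::idom \<Rightarrow> 'a fract"
  where "frac_of p = Fract p 1"

lemma ring_morphism_frac_of: "ring_morphism frac_of"
  by unfold_locales (auto simp: frac_of_def One_fract_def)

interpretation frac: ring_morphism frac_of
  by (rule ring_morphism_frac_of)

lemma inj_frac_of: "inj frac_of"
  by (rule injI) (simp add: frac_of_def eq_fract)

lemma frac_of_eq_iff [simp]: "frac_of p = frac_of q \<longleftrightarrow> p = q"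
  by (rule inj_eq[OF inj_frac_of])

lemma frac_of_eq_0_iff [simp]: "frac_of p = 0 \<longleftrightarrow> p = 0"
  using frac_of_eq_iff[of p 0] by (simp del: frac_of_eq_iff)

definition coeff_sum :: "laurent \<Rightarrow> int"
  where "coeff_sum = laurent_eval (\<lambda>_. 1) (\<lambda>_. 1)"

interpretation coeff_sum: ring_morphism coeff_sum
  unfolding coeff_sum_def by (rule ring_morphism_laurent_eval) simp

lemma coeff_sum_lvar [simp]: "coeff_sum (lvar i) = 1"
  by (simp add: coeff_sum_def)

lemma coeff_sum_linv [simp]: "coeff_sum (linv i) = 1"
  by (simp add: coeff_sum_def)

text \<open>
  A Laurent polynomial with positive coefficient sum, that is, positive value where all variables are 1,
  is not 0.  The variables themselves have coefficient sum 1.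
\<close>

definition laurent_cone :: "laurent fract set"
  where "laurent_cone =
    {frac_of p / frac_of q | p q. p \<in> {p. coeff_sum p > 0} \<and> q \<in> {p. coeff_sum p > 0}}"

lemma cone_laurent_cone: "cone laurent_cone"
  unfolding laurent_cone_def
  by (rule cone_of_fractions[OF ring_morphism_frac_of]) auto

lemma frac_of_in_laurent_cone: "coeff_sum p > 0 \<Longrightarrow> frac_of p \<in> laurent_cone"
  unfolding laurent_cone_def by (force intro: exI[of _ p] exI[of _ 1])

lemma vars_in_laurent_cone: "frac_of (lvar i) \<in> laurent_cone"
  by (rule frac_of_in_laurent_cone) simp

section \<open>The Laurent phenomenon\<close>

text \<open>
  For \<open>B j k \<ge> 0\<close> the row of \<open>k\<close> changes only through the negative entries of row \<open>j\<close>; likewise for row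
  \<open>j\<close> in the second mutation below.
\<close>

lemma mutate_arr_row:
  assumes "skew_on V B" "0 \<le> B j k" "i \<noteq> j" "i \<noteq> k" "j \<noteq> k"
  shows "mutate_arr j B k i = B k i - B j k * int (nat (- B j i))"
proof -
  have "B k j = - B j k" using skew_onD(2)[OF assms(1)] by blast
  then show ?thesis
    using assms by (auto simp: mutate_arr_def mutation_term)
qed

lemma mutate_arr_mutate_arr_row:
  assumes "skew_on V B" "0 \<le> B j k" "i \<noteq> j" "i \<noteq> k" "j \<noteq> k"
  shows "mutate_arr k (mutate_arr j B) j i =
    - B j i - B j k * int (nat (- mutate_arr j B k i))"
proof -
  have "mutate_arr j B j k = - B j k" "mutate_arr j B j i = - B j i"
    by (simp_all add: mutate_arr_def)
  then show ?thesis
    using assms by (auto simp: mutate_arr_def[of k] mutation_term)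
qed

lemma prod_power_split:
  fixes a :: "nat \<Rightarrow> 'a::comm_semiring_1"
  assumes "finite V" "v j \<le> 0" "k \<notin> V \<Longrightarrow> v k \<le> 0" "j \<noteq> k"
  shows "(\<Prod>i\<in>V. a i ^ nat (v i)) = a k ^ nat (v k) * (\<Prod>i\<in>V - {j, k}. a i ^ nat (v i))"
proof -
  have "(\<Prod>i\<in>V - {k}. a i ^ nat (v i)) = (\<Prod>i\<in>V - {j, k}. a i ^ nat (v i))"
    using assms(1,2) by (intro prod.mono_neutral_right) auto
  moreover have "(\<Prod>i\<in>V. a i ^ nat (v i)) = a k ^ nat (v k) * (\<Prod>i\<in>V - {k}. a i ^ nat (v i))"
    using assms(1,3) by (cases "k \<in> V") (simp_all add: prod.remove)
  ultimately show ?thesis by simp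
qed

text \<open>
  The hypothesis says that \<open>w\<close> can be cancelled modulo \<open>y\<close>; it can then be cancelled modulo every
  power of \<open>y\<close>.
\<close>

lemma dvd_power_cancel_prime_like:
  fixes y :: "'a::idom"
  assumes y: "y \<noteq> 0" and prime: "\<And>f. y dvd f * w \<Longrightarrow> y dvd f"
  shows "y ^ p dvd f * w \<Longrightarrow> y ^ p dvd f"
proof (induction p arbitrary: f)
  case (Suc p)
  have "y dvd y ^ Suc p" by simp
  then have "y dvd f * w"
    using Suc.prems by (rule dvd_trans)
  then obtain g where g: "f = y * g" using prime by blast
  with Suc.prems y have "y ^ p dvd g * w"
    by (simp add: mult.assoc)
  then have "y ^ p dvd g" by (rule Suc.IH)
  then show ?case by (simp add: g)
qed simp

subsection \<open>Localizations\<close>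

definition localization_at :: "'a::idom \<Rightarrow> 'a fract set"
  where "localization_at w = {x. \<exists>p g. x * frac_of w ^ p = frac_of g}"

lemma subring_localization_at: "subring_set (localization_at w)"
proof (rule subring_setI)
  show "1 \<in> localization_at w"
    unfolding localization_at_def by (intro CollectI exI[of _ 0] exI[of _ 1]) simp
next
  fix x assume "x \<in> localization_at w"
  then obtain p g where "x * frac_of w ^ p = frac_of g" by (auto simp: localization_at_def)
  then have "- x * frac_of w ^ p = frac_of (- g)" by simp
  then show "- x \<in> localization_at w" unfolding localization_at_def by blast
next
  fix x y assume "x \<in> localization_at w" "y \<in> localization_at w"
  then obtain p g q h where gh: "x * frac_of w ^ p = frac_of g" "y * frac_of w ^ q = frac_of h"
    by (auto simp: localization_at_def)
  have "(x + y) * frac_of w ^ (p + q) =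
      (x * frac_of w ^ p) * frac_of w ^ q + (y * frac_of w ^ q) * frac_of w ^ p"
    by (simp add: power_add algebra_simps)
  also have "\<dots> = frac_of (g * w ^ q + h * w ^ p)"
    by (simp add: gh)
  finally show "x + y \<in> localization_at w"
    unfolding localization_at_def by blast
  have "(x * y) * frac_of w ^ (p + q) = (x * frac_of w ^ p) * (y * frac_of w ^ q)"
    by (simp add: power_add algebra_simps)
  also have "\<dots> = frac_of (g * h)"
    by (simp add: gh)
  finally show "x * y \<in> localization_at w"
    unfolding localization_at_def by blast
qed

lemma frac_of_in_localization: "frac_of g \<in> localization_at w"
  unfolding localization_at_def by (intro CollectI exI[of _ 0] exI[of _ g]) simp

lemma inverse_in_localization:
  assumes "v dvd w" "w \<noteq> 0"
  shows "inverse (frac_of v) \<in> localization_at w"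
proof -
  obtain g where g: "w = v * g" using assms(1) by blast
  then have "inverse (frac_of v) * frac_of w ^ 1 = frac_of g"
    using assms(2) by simp
  then show ?thesis unfolding localization_at_def by blast
qed

lemma inverse_lvar: "inverse (frac_of (lvar i)) = frac_of (linv i)"
proof -
  have "frac_of (lvar i) * frac_of (linv i) = 1"
    by (simp flip: frac.mult)
  then show ?thesis by (rule inverse_unique)
qed

lemma frac_of_div_lvar: "frac_of x / frac_of (lvar i) = frac_of (x * linv i)"
  by (simp add: divide_inverse inverse_lvar)

lemma mutate_at_lvar:
  "mutate_at V B j (\<lambda>i. frac_of (lvar i)) i = frac_of ((lvar(j := exchange V B j lvar * linv j)) i)"
proof -
  have "exchange V B j (\<lambda>i. frac_of (lvar i)) / frac_of (lvar j) = frac_of (exchange V B j lvar * linv j)"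
    by (simp only: frac_of_div_lvar flip: frac.exchange)
  then show ?thesis by (simp add: mutate_at_def)
qed

subsection \<open>Three consecutive mutations\<close>

text \<open>
  The first two mutations of a path are at \<open>j\<close> and \<open>k\<close>.  The vertex \<open>m\<close> carries a generic coefficient:
  its variable occurs in the exchange polynomial of \<open>j\<close> with exponent 1, and not in that of \<open>k\<close>.
\<close>

locale mutation_pair =
  fixes V B j k m
  assumes skew: "skew_on V B"
    and distinct: "j \<noteq> k" "m \<noteq> j" "m \<noteq> k"
    and sign: "0 \<le> B j k"
    and coeff: "B j m = 1" "B k m = 0"
begin

abbreviation "B1 \<equiv> mutate_arr j B"
abbreviation "B2 \<equiv> mutate_arr k (mutate_arr j B)"

definition "b = nat (B j k)"
definition "rest = V - {j, k}"

text \<open>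
  Products over the vertices other than \<open>j\<close> and \<open>k\<close>.  All three exchange relations below have the form
  of a binomial in such monomials and one power of \<open>a j\<close> or \<open>a k\<close>.
\<close>

abbreviation mon :: "(nat \<Rightarrow> 'a::comm_semiring_1) \<Rightarrow> (nat \<Rightarrow> int) \<Rightarrow> 'a"
  where "mon a v \<equiv> (\<Prod>i\<in>rest. a i ^ nat (v i))"

lemma finite_V: "finite V"
  using skew_onD(1)[OF skew] .

lemma finite_rest: "finite rest"
  using finite_V by (simp add: rest_def)

lemma m_rest: "m \<in> rest"
proof -
  have "m \<in> V" using skew_onD(5)[OF skew, of j m] coeff by simp
  then show ?thesis using distinct by (simp add: rest_def)
qed

lemma k_in_V: "B j k \<noteq> 0 \<Longrightarrow> k \<in> V"
  by (rule skew_onD(5)[OF skew])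

lemma int_b: "int b = B j k"
  using sign by (simp add: b_def)

lemma exchange_first:
  "exchange V B j a = a k ^ b * mon a (B j) + mon a (\<lambda>i. - B j i)"
proof -
  have "B j j = 0" using skew_onD(3)[OF skew] .
  then have "(\<Prod>i\<in>V. a i ^ nat (B j i)) = a k ^ nat (B j k) * mon a (B j)"
    "(\<Prod>i\<in>V. a i ^ nat (- B j i)) = a k ^ nat (- B j k) * mon a (\<lambda>i. - B j i)"
    unfolding rest_def using finite_V distinct k_in_V sign
    by (intro prod_power_split; force)+
  then show ?thesis using sign by (simp add: exchange_def b_def)
qed

lemma B1_kj: "B1 k j = B j k"
  using skew_onD(2)[OF skew, of k j] by (simp add: mutate_arr_def)

lemma B2_jk: "B2 j k = B j k"
  using distinct by (simp add: mutate_arr_def)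

lemma exchange_second:
  "exchange V B1 k a = a j ^ b * mon a (B1 k) + mon a (\<lambda>i. - B1 k i)"
proof -
  note skew1 = mutate_arr_skew[OF skew, of j]
  have "B1 k k = 0" using skew_onD(3)[OF skew1] .
  moreover have "j \<in> V" if "B1 k j \<noteq> 0" using skew_onD(5)[OF skew1 that] .
  moreover have "V - {k, j} = rest" by (auto simp: rest_def)
  ultimately have "(\<Prod>i\<in>V. a i ^ nat (B1 k i)) = a j ^ nat (B1 k j) * mon a (B1 k)"
    "(\<Prod>i\<in>V. a i ^ nat (- B1 k i)) = a j ^ nat (- B1 k j) * mon a (\<lambda>i. - B1 k i)"
    using finite_V distinct sign
      prod_power_split[of V "B1 k" k j a] prod_power_split[of V "\<lambda>i. - B1 k i" k j a]
    by force+
  then show ?thesis using sign by (simp add: exchange_def b_def B1_kj)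
qed

lemma exchange_third:
  "exchange V B2 j a = a k ^ b * mon a (B2 j) + mon a (\<lambda>i. - B2 j i)"
proof -
  note skew2 = mutate_arr_skew[OF mutate_arr_skew[OF skew, of j], of k]
  have "B2 j j = 0" using skew_onD(3)[OF skew2] .
  moreover have "k \<in> V" if "B2 j k \<noteq> 0" using skew_onD(5)[OF skew2 that] .
  ultimately have "(\<Prod>i\<in>V. a i ^ nat (B2 j i)) = a k ^ nat (B2 j k) * mon a (B2 j)"
    "(\<Prod>i\<in>V. a i ^ nat (- B2 j i)) = a k ^ nat (- B2 j k) * mon a (\<lambda>i. - B2 j i)"
    unfolding rest_def using finite_V distinct sign
      prod_power_split[of V "B2 j" j k a] prod_power_split[of V "\<lambda>i. - B2 j i" j k a]
    by force+
  then show ?thesis using sign by (simp add: exchange_def b_def B2_jk)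
qed

text \<open>
  Pointwise this is the mutation rule for the exponents.  It makes the third exchange relation
  compatible with the first one, which is the reason that the division by \<open>y\<close> in the third mutation is exact.
\<close>

lemma monomial_identity:
  fixes a :: "nat \<Rightarrow> 'a::comm_semiring_1"
  shows "mon a (B2 j) * mon a (\<lambda>i. - B1 k i) ^ b * mon a (B j) =
    mon a (\<lambda>i. - B2 j i) * mon a (\<lambda>i. - B j i)"
proof -
  have "nat (B2 j i) + nat (- B1 k i) * b + nat (B j i) = nat (- B2 j i) + nat (- B j i)"
    if "i \<in> rest" for i
  proof -
    have i: "i \<noteq> j" "i \<noteq> k" using that by (auto simp: rest_def)
    have "B2 j i = - B j i - int b * int (nat (- B1 k i))"
      using mutate_arr_mutate_arr_row[OF skew sign i distinct(1)] by (simp add: int_b)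
    moreover have "int (nat x) - int (nat (- x)) = x" for x by simp
    ultimately have "int (nat (B2 j i)) - int (nat (- B2 j i)) =
        - (int (nat (B j i)) - int (nat (- B j i))) - int b * int (nat (- B1 k i))"
      by metis
    then have "int (nat (B2 j i) + nat (- B1 k i) * b + nat (B j i)) =
        int (nat (- B2 j i) + nat (- B j i))"
      unfolding of_nat_add of_nat_mult by (simp only: mult.commute)
    then show ?thesis
      by (simp only: of_nat_eq_iff)
  qed
  then have "(\<Prod>i\<in>rest. a i ^ (nat (B2 j i) + nat (- B1 k i) * b + nat (B j i))) =
      (\<Prod>i\<in>rest. a i ^ (nat (- B2 j i) + nat (- B j i)))"
    by simp
  then show ?thesis
    by (simp only: power_add power_mult prod.distrib prod_power_distrib)
qed

text \<open>
  The new variables after mutating at \<open>j\<close> and then at \<open>k\<close>, as Laurent polynomials.  The unit \<open>W\<close> is the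
  ratio of the second monomial of the third exchange relation and the first monomial of the first
  one, the latter without its power of \<open>x\<^sub>k\<close>.
\<close>

definition "y = exchange V B j lvar * linv j"
definition "z = (mon lvar (B1 k) * y ^ b + mon lvar (\<lambda>i. - B1 k i)) * linv k"
definition "W = mon lvar (\<lambda>i. - B2 j i) * mon linv (B j)"

lemma linv_lvar: "linv i * lvar i = 1"
  by (subst mult.commute) (rule lvar_linv)

lemma mon_inverse: "mon lvar v * mon linv v = 1"
  by (simp flip: prod.distrib power_mult_distrib)

lemma y_exchange: "y * lvar j = exchange V B j lvar"
  by (simp add: y_def mult.assoc linv_lvar)

lemma z_exchange: "z * lvar k = exchange V B1 k (lvar(j := y))"
proof -
  have *: "mon (lvar(j := y)) v = mon lvar v" for v
    by (intro prod.cong) (auto simp: rest_def)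
  show ?thesis
    unfolding exchange_second * by (simp add: z_def mult.assoc linv_lvar mult.commute)
qed

text \<open>
  The third variable \<open>u\<close> is \<open>(C * z ^ b + D) / y\<close> for monomials \<open>C\<close> and \<open>D\<close>.  Expanding
  \<open>(A * y ^ b + N) ^ b\<close> modulo \<open>y\<close> exhibits the factor \<open>y\<close>; the value of \<open>u\<close> modulo \<open>y\<close> also needs the
  quotient \<open>G\<close> modulo \<open>y\<close>, which is nonzero only for \<open>b = 1\<close>.
\<close>

lemma binomial_power_remainder:
  obtains G where
    "G * y = (mon lvar (B1 k) * y ^ b + mon lvar (\<lambda>i. - B1 k i)) ^ b - mon lvar (\<lambda>i. - B1 k i) ^ b"
    "b = 1 \<and> G = mon lvar (B1 k) \<or> b \<noteq> 1 \<and> y dvd G"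
proof -
  let ?A = "mon lvar (B1 k)" and ?N = "mon lvar (\<lambda>i. - B1 k i)"
  have "?A * y ^ b dvd (?A * y ^ b + ?N) ^ b - ?N ^ b"
    using power_diff_sumr2[of "?A * y ^ b + ?N" b ?N] by simp
  then obtain H where H: "(?A * y ^ b + ?N) ^ b - ?N ^ b = ?A * y ^ b * H" by blast
  consider "b = 0" | "b = 1" | c where "b = c + 2"
    by (metis One_nat_def Suc_eq_plus1 add_2_eq_Suc' not0_implies_Suc)
  then show thesis
  proof cases
    case 1
    then show thesis by (intro that[of 0]) auto
  next
    case 2
    then show thesis by (intro that[of ?A]) auto
  next
    case 3
    then have "?A * y ^ b * H = (?A * y ^ c * H * y) * y"
      by (simp add: power_add power2_eq_square algebra_simps)
    with H 3 show thesis by (intro that[of "?A * y ^ c * H * y"]) auto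
  qed
qed

text \<open>
  A point at which \<open>y\<close> vanishes but \<open>z\<close> and the third variable do not, which certifies that \<open>y\<close>
  divides neither of them.  The value \<open>- 1\<close> at \<open>m\<close> cancels the two monomials of the exchange
  polynomial of \<open>j\<close>.  The value 2 at \<open>j\<close> keeps the two terms \<open>C * G\<close> and \<open>W * x\<^sub>j\<close> of \<open>u\<close> from
  cancelling when \<open>b = 1\<close>, as then they become \<open>\<plusminus> 1\<close> and \<open>\<plusminus> 2\<close>.
\<close>

definition "test = (laurent_eval (\<lambda>i. if i = m then - 1 else if i = j then 2 else 1)
  (\<lambda>i. if i = m then - 1 else if i = j then 1 / 2 else 1) :: laurent \<Rightarrow> rat)"

sublocale test: ring_morphism test
  unfolding test_def by (rule ring_morphism_laurent_eval) simp

lemma test_vars: "test (lvar i) = (if i = m then - 1 else if i = j then 2 else 1)"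
  "test (linv i) = (if i = m then - 1 else if i = j then 1 / 2 else 1)"
  by (simp_all add: test_def)

lemma prod_rest_m:
  "(\<Prod>i\<in>rest. (if i = m then - 1 else 1 :: rat) ^ nat (v i)) = (- 1) ^ nat (v m)"
proof -
  have "(\<Prod>i\<in>rest. (if i = m then - 1 else 1 :: rat) ^ nat (v i)) =
      (\<Prod>i\<in>rest. if i = m then (- 1) ^ nat (v m) else 1)"
    by (intro prod.cong) auto
  then show ?thesis
    using m_rest finite_rest by simp
qed

lemma test_mon: "test (mon lvar v) = (- 1) ^ nat (v m)"
  "test (mon linv v) = (- 1) ^ nat (v m)"
proof -
  have "test (lvar i) = (if i = m then - 1 else 1)" "test (linv i) = (if i = m then - 1 else 1)"
    if "i \<in> rest" for i
    using that distinct by (auto simp: test_vars rest_def)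
  then show "test (mon lvar v) = (- 1) ^ nat (v m)" "test (mon linv v) = (- 1) ^ nat (v m)"
    by (simp_all add: test.prod flip: prod_rest_m)
qed

lemma test_y: "test y = 0"
  using distinct coeff
  by (simp add: y_def exchange_first test_mon test_vars)

lemma test_z: "test z \<noteq> 0"
proof (cases "b = 0")
  case True
  have "B1 k m = B k m - B j k * int (nat (- B j m))"
    using mutate_arr_row[OF skew sign] distinct by blast
  then have "B1 k m = 0" using coeff by simp
  with True show ?thesis using distinct by (simp add: z_def test_mon test_vars)
next
  case False
  then show ?thesis using distinct by (simp add: z_def test_mon test_vars test_y zero_power)
qed

text \<open>
  By \<open>monomial_identity\<close> the \<open>y\<close>-free part of \<open>C * (A * y ^ b + N) ^ b + D * x\<^sub>k ^ b\<close> is \<open>W\<close> times the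
  exchange polynomial \<open>y * x\<^sub>j\<close>, so the sum is divisible by \<open>y\<close>.
\<close>

lemma third_variable:
  obtains u where "u * y = exchange V B2 j (lvar(j := y, k := z))" "test u \<noteq> 0"
proof -
  let ?A = "mon lvar (B1 k)" and ?N = "mon lvar (\<lambda>i. - B1 k i)"
  let ?C = "mon lvar (B2 j)" and ?D = "mon lvar (\<lambda>i. - B2 j i)"
  let ?E = "mon lvar (B j)" and ?F = "mon lvar (\<lambda>i. - B j i)"
  obtain G where G: "G * y = (?A * y ^ b + ?N) ^ b - ?N ^ b"
    and G_cases: "b = 1 \<and> G = ?A \<or> b \<noteq> 1 \<and> y dvd G"
    by (rule binomial_power_remainder)
  define u where "u = (?C * G + W * lvar j) * linv k ^ b"
  have kk: "lvar k ^ b * linv k ^ b = 1"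
    by (simp flip: power_mult_distrib)
  have WE: "W * ?E = ?D"
  proof -
    have "W * ?E = ?D * (?E * mon linv (B j))" by (simp only: W_def mult_ac)
    then show ?thesis by (simp only: mon_inverse mult_1_right)
  qed
  have "?C * ?N ^ b = ?C * ?N ^ b * (?E * mon linv (B j))"
    by (simp add: mon_inverse)
  also have "\<dots> = (?C * ?N ^ b * ?E) * mon linv (B j)"
    by (simp only: mult_ac)
  also have "\<dots> = W * ?F"
    unfolding monomial_identity W_def by (simp only: mult_ac)
  finally have CN: "?C * ?N ^ b = W * ?F" .
  have yj: "y * lvar j = lvar k ^ b * ?E + ?F"
    unfolding y_exchange by (rule exchange_first)
  have "u * y = (?C * (G * y) + W * (y * lvar j)) * linv k ^ b"
    by (simp add: u_def algebra_simps)
  also have "\<dots> = (?C * (?A * y ^ b + ?N) ^ b + (W * ?F - ?C * ?N ^ b) + W * ?E * lvar k ^ b) * linv k ^ b"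
    unfolding G yj by (simp add: algebra_simps)
  also have "\<dots> = (?C * (?A * y ^ b + ?N) ^ b + ?D * lvar k ^ b) * linv k ^ b"
    unfolding WE CN by simp
  also have "\<dots> = ?C * ((?A * y ^ b + ?N) * linv k) ^ b + ?D * (lvar k ^ b * linv k ^ b)"
    by (simp only: power_mult_distrib[of "?A * y ^ b + ?N" "linv k" b]
        distrib_right[of _ _ "linv k ^ b"] mult.assoc)
  also have "\<dots> = z ^ b * ?C + ?D"
    unfolding kk z_def[symmetric] by (simp only: mult.commute mult_1_left mult_1_right)
  also have "\<dots> = exchange V B2 j (lvar(j := y, k := z))"
  proof -
    have *: "mon (lvar(j := y, k := z)) v = mon lvar v" for v
      by (intro prod.cong) (auto simp: rest_def)
    show ?thesis unfolding exchange_third * by simp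
  qed
  finally have u: "u * y = exchange V B2 j (lvar(j := y, k := z))" .
  have pm: "(- 1 :: rat) ^ n = 1 \<or> (- 1 :: rat) ^ n = - 1" for n
    by (induction n) auto
  have "test u = test ?C * test G + test W * 2"
    using distinct by (simp add: u_def test_vars)
  moreover have "test W = 1 \<or> test W = - 1"
    using pm by (auto simp: W_def test_mon simp flip: power_add)
  moreover have "test ?C * test G = 1 \<or> test ?C * test G = - 1 \<or> test ?C * test G = 0"
    using G_cases
  proof
    assume "b = 1 \<and> G = ?A"
    then show ?thesis using pm by (simp add: test_mon flip: power_add)
  next
    assume "b \<noteq> 1 \<and> y dvd G"
    then obtain H where "G = y * H" by blast
    then show ?thesis by (simp add: test_y)
  qed
  ultimately have "test u \<noteq> 0" by auto
  with u show thesis by (rule that)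
qed

text \<open>
  Up to a unit, \<open>y\<close> is \<open>x\<^sub>m - v\<close> for a unit \<open>v\<close> in the other variables.  Substituting \<open>v\<close> for \<open>x\<^sub>m\<close> is
  therefore a morphism \<open>\<phi>\<close> into a domain whose kernel is generated by \<open>y\<close>, so \<open>y\<close> is prime; and
  \<open>g\<close> is not divisible by \<open>y\<close> because \<open>test y = 0\<close>.
\<close>

lemma y_prime_like:
  assumes "test g \<noteq> 0" "y dvd f * g"
  shows "y dvd f"
proof -
  let ?E = "\<Prod>i\<in>rest - {m}. lvar i ^ nat (B j i)" and ?E' = "\<Prod>i\<in>rest - {m}. linv i ^ nat (B j i)"
  let ?F = "mon lvar (\<lambda>i. - B j i)" and ?F' = "mon linv (\<lambda>i. - B j i)"
  have EE': "?E * ?E' = 1"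
    by (simp flip: prod.distrib power_mult_distrib)
  have FF': "?F * ?F' = 1"
    by (rule mon_inverse)
  have kk: "lvar k ^ b * linv k ^ b = 1"
    by (simp flip: power_mult_distrib)
  have E: "mon lvar (B j) = lvar m * ?E"
    using finite_rest m_rest coeff by (simp add: prod.remove)
  have ex: "exchange V B j lvar = lvar m * (lvar k ^ b * ?E) + ?F"
    unfolding exchange_first E by (simp add: mult_ac)
  define v where "v = - ?F * (linv k ^ b * ?E')"
  define v' where "v' = - ?F' * (lvar k ^ b * ?E)"
  have vv': "v * v' = 1"
  proof -
    have "v * v' = (?F * ?F') * (lvar k ^ b * linv k ^ b) * (?E * ?E')"
      by (simp add: v_def v'_def mult_ac)
    then show ?thesis by (simp add: EE' FF' kk)
  qed
  define \<phi> where "\<phi> = laurent_eval (lvar(m := v)) (linv(m := v'))"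
  interpret \<phi>: ring_morphism \<phi>
    unfolding \<phi>_def by (rule ring_morphism_laurent_eval) (auto simp: vv')
  have \<phi>_vars: "\<phi> (lvar i) = (if i = m then v else lvar i)"
    "\<phi> (linv i) = (if i = m then v' else linv i)" for i
    by (simp_all add: \<phi>_def)
  have vkE: "v * (lvar k ^ b * ?E) = - ?F"
  proof -
    have "v * (lvar k ^ b * ?E) = - ?F * (lvar k ^ b * linv k ^ b) * (?E * ?E')"
      by (simp add: v_def mult_ac)
    then show ?thesis by (simp add: EE' kk)
  qed
  have y_diff: "(lvar m - v) * (lvar k ^ b * ?E) = y * lvar j"
    unfolding y_exchange ex left_diff_distrib vkE by simp
  have m_diff: "y dvd lvar m - v"
  proof -
    have "lvar m - v = (lvar m - v) * (lvar k ^ b * ?E) * (linv k ^ b * ?E')"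
    proof -
      have "(lvar m - v) * (lvar k ^ b * ?E) * (linv k ^ b * ?E') =
          (lvar m - v) * ((lvar k ^ b * linv k ^ b) * (?E * ?E'))"
        by (simp only: mult_ac)
      then show ?thesis by (simp add: EE' kk)
    qed
    then have "lvar m - v = y * (lvar j * (linv k ^ b * ?E'))"
      unfolding y_diff mult.assoc .
    then show ?thesis by (rule dvdI)
  qed
  have \<phi>y: "\<phi> y = 0"
  proof -
    have \<phi>F: "\<phi> ?F = ?F"
    proof -
      have "\<phi> (lvar i ^ nat (- B j i)) = lvar i ^ nat (- B j i)" for i
        using coeff by (cases "i = m") (auto simp: \<phi>_vars)
      then show ?thesis by (simp only: \<phi>.prod)
    qed
    have "\<phi> ?E = ?E"
      unfolding \<phi>.prod by (rule prod.cong) (auto simp: \<phi>_vars)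
    then have "\<phi> (exchange V B j lvar) = 0"
      unfolding ex using vkE distinct \<phi>F by (simp add: \<phi>_vars)
    then show ?thesis by (simp add: y_def)
  qed
  have diff: "y dvd f - \<phi> f" for f
  proof -
    have "subring_set {f. y dvd f - \<phi> f}"
    proof (rule subring_setI)
      fix f g assume "f \<in> {f. y dvd f - \<phi> f}" "g \<in> {f. y dvd f - \<phi> f}"
      then have fg: "y dvd f - \<phi> f" "y dvd g - \<phi> g" by auto
      have "f + g - \<phi> (f + g) = (f - \<phi> f) + (g - \<phi> g)" by simp
      with dvd_add[OF fg] show "f + g \<in> {f. y dvd f - \<phi> f}" by (simp only: mem_Collect_eq)
      have "f * g - \<phi> (f * g) = (f - \<phi> f) * g + (g - \<phi> g) * \<phi> f"
        by (simp add: algebra_simps)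
      with fg show "f * g \<in> {f. y dvd f - \<phi> f}"
        by (simp only: mem_Collect_eq dvd_add dvd_mult2)
    next
      fix f assume "f \<in> {f. y dvd f - \<phi> f}"
      then have "y dvd - (f - \<phi> f)" by (simp only: mem_Collect_eq dvd_minus_iff)
      then show "- f \<in> {f. y dvd f - \<phi> f}" by (simp add: algebra_simps)
    qed simp
    moreover have "lvar i \<in> {f. y dvd f - \<phi> f}" for i
      using m_diff by (simp add: \<phi>_vars)
    moreover have "linv i \<in> {f. y dvd f - \<phi> f}" for i
    proof (cases "i = m")
      case True
      have "linv m - v' = linv m * (v * v') - (lvar m * linv m) * v'"
        by (simp add: vv')
      also have "\<dots> = (lvar m - v) * (- (linv m * v'))"
        by (simp add: algebra_simps)
      finally show ?thesis
        using m_diff True by (simp add: \<phi>_vars)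
    qed (simp add: \<phi>_vars)
    ultimately show ?thesis
      using laurent_in_subring[of "{f. y dvd f - \<phi> f}" f] by blast
  qed
  obtain h where "f * g = y * h" using assms(2) by blast
  then have "\<phi> f * \<phi> g = \<phi> (y * h)"
    by (simp only: flip: \<phi>.mult)
  then have "\<phi> f * \<phi> g = 0"
    using \<phi>y by simp
  moreover have "\<phi> g \<noteq> 0"
  proof
    assume "\<phi> g = 0"
    then have "y dvd g" using diff[of g] by simp
    then obtain h where "g = y * h" by blast
    then show False using assms(1) test_y by simp
  qed
  ultimately show ?thesis using diff[of f] by simp
qed

definition "start = (\<lambda>i. frac_of (lvar i))"

lemma start_cone: "range start \<subseteq> laurent_cone"
  using vars_in_laurent_cone by (auto simp: start_def)

lemma coeff_sum_mon: "coeff_sum (mon lvar v) = 1" "coeff_sum (mon linv v) = 1"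
  by (simp_all add: coeff_sum.prod)

lemma coeff_sum_y: "coeff_sum y = 2"
  by (simp add: y_def exchange_first coeff_sum_mon)

lemma coeff_sum_z: "coeff_sum z > 0"
  by (simp add: z_def coeff_sum_mon coeff_sum_y)

text \<open>
  Let \<open>L\<close> be the ring of Laurent polynomials.  The first hypothesis, evaluated at the seed after the
  mutation at \<open>j\<close>, shows that the rest of the path stays in \<open>L[y\<inverse>]\<close>.  The second one,
  evaluated at the seed after the mutations at \<open>j\<close>, \<open>k\<close>, \<open>j\<close>, for the path that first undoes the last of
  these, shows that it stays in \<open>L[(z u)\<inverse>]\<close>.  Since \<open>y\<close> is prime and divides neither \<open>z\<close> nor \<open>u\<close>, the path stays
  in \<open>L\<close>.
\<close>

lemma stays_in_step:
  assumes IH1: "stays_in V (range frac_of) (k # ks) B1 start"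
    and IH3: "stays_in V (range frac_of) (j # ks) (mutate_arr j B2) start"
  shows "stays_in V (range frac_of) (j # k # ks) B start"
proof -
  obtain u where u: "u * y = exchange V B2 j (lvar(j := y, k := z))" and test_u: "test u \<noteq> 0"
    by (rule third_variable)
  note cone = cone_laurent_cone
  have y0: "y \<noteq> 0" and z0: "z \<noteq> 0" and u0: "u \<noteq> 0"
    using coeff_sum_y coeff_sum_z test_u by auto
  have yc: "frac_of y \<in> laurent_cone" and zc: "frac_of z \<in> laurent_cone"
    using coeff_sum_y coeff_sum_z by (auto intro: frac_of_in_laurent_cone)
  let ?a1 = "start(j := frac_of y)"
  let ?a2 = "start(j := frac_of y, k := frac_of z)"
  let ?a3 = "start(j := frac_of u, k := frac_of z)"
  have a1: "range ?a1 \<subseteq> laurent_cone" and a2: "range ?a2 \<subseteq> laurent_cone"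
    using start_cone yc zc by auto
  have ex3: "frac_of u * frac_of y = exchange V B2 j ?a2"
  proof -
    have "frac_of u * frac_of y = exchange V B2 j (\<lambda>i. frac_of ((lvar(j := y, k := z)) i))"
      by (simp only: u frac.exchange flip: frac.mult)
    moreover have "(\<lambda>i. frac_of ((lvar(j := y, k := z)) i)) = ?a2"
      by (auto simp: start_def)
    ultimately show ?thesis by simp
  qed
  have uc: "frac_of u \<in> laurent_cone"
  proof -
    have "exchange V B2 j ?a2 / frac_of y \<in> laurent_cone"
      using cone_exchange[OF cone, of V ?a2] a2 yc cone unfolding cone_def by blast
    then show ?thesis using y0 by (simp flip: ex3)
  qed
  have a3: "range ?a3 \<subseteq> laurent_cone"
    using start_cone uc zc by auto

  have step1: "mutate_at V B j start = ?a1"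
    unfolding start_def by (auto simp: fun_eq_iff mutate_at_lvar y_def)
  have step2: "mutate_at V B1 k ?a1 = ?a2"
  proof -
    have "?a1 = (\<lambda>i. frac_of ((lvar(j := y)) i))" by (auto simp: start_def)
    then have "exchange V B1 k ?a1 = frac_of (z * lvar k)"
      by (simp only: z_exchange frac.exchange)
    then show ?thesis using distinct by (simp add: mutate_at_def start_def)
  qed
  \<comment> \<open>The third mutation, read backwards from its result \<open>?a3\<close>.\<close>
  have step3: "mutate_at V (mutate_arr j B2) j ?a3 = ?a2"
  proof -
    have "exchange V (mutate_arr j B2) j ?a3 = exchange V (\<lambda>i j. - B2 i j) j ?a3"
      by (simp add: exchange_def mutate_arr_def[of j])
    also have "\<dots> = exchange V B2 j ?a2"
      unfolding exchange_reverse
      using skew_onD(3)[OF mutate_arr_skew[OF mutate_arr_skew[OF skew]]]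
      by (intro exchange_cong) auto
    finally have "exchange V (mutate_arr j B2) j ?a3 / ?a3 j = frac_of y"
      using u0 distinct by (simp flip: ex3)
    then show ?thesis using distinct by (auto simp: mutate_at_def)
  qed
  have B2: "mutate_arr j (mutate_arr j B2) = B2"
    by (rule mutate_arr_involution[OF mutate_arr_skew[OF mutate_arr_skew[OF skew]]])

  \<comment> \<open>A path of Laurent polynomials, evaluated at a tuple of units of a localization, stays there.\<close>
  have transfer: "stays_in V (localization_at w) ls C a"
    if "stays_in V (range frac_of) ls C start" "range a \<subseteq> laurent_cone"
      "range a \<subseteq> localization_at w" "\<And>i. inverse (a i) \<in> localization_at w" for ls C a w
  proof -
    define h where "h = laurent_eval a (\<lambda>i. inverse (a i))"
    have "a i \<in> laurent_cone" for i
      using that(2) by auto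
    then have "a i \<noteq> 0" for i
      using cone unfolding cone_def by metis
    then have h: "ring_morphism h"
      unfolding h_def by (intro ring_morphism_laurent_eval) simp
    have ha: "(\<lambda>i. h (lvar i)) = a"
      by (simp add: h_def)
    have "stays_in V (range h) ls C (\<lambda>i. h (lvar i))"
      using stays_in_transfer[OF ring_morphism_frac_of inj_frac_of h, of V ls C lvar]
        that(1) stays_nonzero[OF cone start_cone] stays_nonzero[OF cone that(2)]
      by (simp add: start_def ha)
    moreover have "range h \<subseteq> localization_at w"
      using that(3,4) unfolding h_def
      by (auto intro!: laurent_eval_in_subring[OF subring_localization_at])
    ultimately show ?thesis
      using stays_in_mono by (fastforce simp: ha)
  qed
  have start_loc: "start i \<in> localization_at w" "inverse (start i) \<in> localization_at w" for i w
    by (auto simp: start_def inverse_lvar frac_of_in_localization)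
  have "stays_in V (localization_at y) (k # ks) B1 ?a1"
    by (rule transfer[OF IH1 a1])
       (use start_loc y0 in \<open>auto simp: frac_of_in_localization intro: inverse_in_localization\<close>)
  then have loc1: "stays_in V (localization_at y) ks B2 ?a2"
    by (simp add: step2)
  have "stays_in V (localization_at (z * u)) (j # ks) (mutate_arr j B2) ?a3"
    by (rule transfer[OF IH3 a3])
       (use start_loc z0 u0 in \<open>auto simp: frac_of_in_localization intro: inverse_in_localization\<close>)
  then have loc3: "stays_in V (localization_at (z * u)) ks B2 ?a2"
    by (simp add: step3 B2)
  have "localization_at y \<inter> localization_at (z * u) \<subseteq> range frac_of"
  proof
    fix x assume "x \<in> localization_at y \<inter> localization_at (z * u)"
    then obtain p q f g where f: "x * frac_of y ^ p = frac_of f"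
      and g: "x * frac_of (z * u) ^ q = frac_of g"
      by (auto simp: localization_at_def)
    have "frac_of (f * (z * u) ^ q) = frac_of (y ^ p * g)"
      by (simp flip: f g)
    then have "y ^ p dvd f * (z * u) ^ q"
      by (simp only: frac_of_eq_iff dvd_triv_left)
    then have "y ^ p dvd f"
    proof (rule dvd_power_cancel_prime_like[OF y0, rotated])
      have "test ((z * u) ^ q) \<noteq> 0"
        using test_z test_u by simp
      then show "y dvd f'" if "y dvd f' * (z * u) ^ q" for f'
        using that by (rule y_prime_like)
    qed
    then obtain h where "f = y ^ p * h" by blast
    then have "x = frac_of h"
      using f y0 by simp
    then show "x \<in> range frac_of" by blast
  qed
  then have "stays_in V (range frac_of) ks B2 ?a2"
    using stays_in_mono[OF stays_in_Int[OF loc1 loc3]] by blast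
  moreover have "range ?a1 \<subseteq> range frac_of" "range start \<subseteq> range frac_of"
    by (auto simp: start_def)
  ultimately show ?thesis
    by (simp add: step1 step2)
qed

end

lemma exchange_superset:
  assumes "skew_on V B" "V \<subseteq> V'" "finite V'"
  shows "exchange V' B k a = exchange V B k a"
proof -
  have "B k i = 0" if "i \<notin> V" for i
    using skew_onD(5)[OF assms(1)] that by blast
  then have "(\<Prod>i\<in>V. a i ^ nat (s * B k i)) = (\<Prod>i\<in>V'. a i ^ nat (s * B k i))" for s
    using assms(2,3) by (intro prod.mono_neutral_left) auto
  from this[of 1] this[of "-1"] show ?thesis
    by (simp add: exchange_def)
qed

lemma mutate_at_superset:
  assumes "skew_on V B" "V \<subseteq> V'" "finite V'"
  shows "mutate_at V' B k a = mutate_at V B k a"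
  by (simp add: mutate_at_def exchange_superset[OF assms])

lemma stays_in_superset:
  assumes "skew_on V B" "V \<subseteq> V'" "finite V'"
  shows "stays_in V' R ks B a \<longleftrightarrow> stays_in V R ks B a"
  using assms(1)
proof (induction ks arbitrary: B a)
  case (Cons k ks)
  then show ?case
    using Cons.IH[OF mutate_arr_skew[OF Cons.prems]]
    by (simp add: mutate_at_superset[OF Cons.prems assms(2,3)])
qed simp

text \<open>
  The coefficient vertex required by \<open>mutation_pair\<close> is a fresh vertex \<open>m\<close> with a single arrow from \<open>j\<close>.
  Setting its variable to 1 afterwards preserves Laurent polynomials and recovers the original
  path.
\<close>

lemma laurent_step:
  assumes IH: "\<And>V B ls. skew_on V B \<Longrightarrow> length ls \<le> Suc (length ks) \<Longrightarrow>
      stays_in V (range frac_of) ls B (\<lambda>i. frac_of (lvar i))"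
    and B: "skew_on V B" and "j \<noteq> k" "0 \<le> B j k"
  shows "stays_in V (range frac_of) (j # k # ks) B (\<lambda>i. frac_of (lvar i))"
proof -
  have finV: "finite V" using skew_onD(1)[OF B] .
  then have "finite (insert j (insert k (V \<union> set ks)))" by simp
  then obtain m where m: "m \<notin> insert j (insert k (V \<union> set ks))"
    using ex_new_if_finite[OF infinite_UNIV_nat] by blast
  have Bm: "B i m = 0" "B m i = 0" for i
    using skew_onD(4,5)[OF B] m by blast+
  define C where "C = (\<lambda>i l. if i = j \<and> l = m then 1 else if i = m \<and> l = j then - 1 else B i l)"
  have "C i l = - C l i" for i l
    using skew_onD(2)[OF B, of i l] m unfolding C_def by auto
  moreover have "i \<in> insert m (insert j V) \<and> l \<in> insert m (insert j V)" if "C i l \<noteq> 0" for i l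
    using that skew_onD(4,5)[OF B, of i l] by (auto simp: C_def split: if_splits)
  ultimately have C: "skew_on (insert m (insert j V)) C"
    using finV by (intro skew_onI) blast+
  interpret mutation_pair "insert m (insert j V)" C j k m
    by unfold_locales (use C assms(3,4) m Bm in \<open>auto simp: C_def\<close>)
  let ?V = "insert m (insert j V)"
  have long: "stays_in ?V (range frac_of) (j # k # ks) C start"
    unfolding start_def
    by (rule stays_in_step[unfolded start_def]; rule IH)
       (auto intro!: mutate_arr_skew C)
  let ?b = "start(m := 1)"
  have b_cone: "range ?b \<subseteq> laurent_cone"
    using start_cone cone_laurent_cone by (auto simp: cone_def)
  define h where "h = laurent_eval ?b (\<lambda>i. inverse (?b i))"
  have h: "ring_morphism h"
    unfolding h_def by (intro ring_morphism_laurent_eval) (auto simp: start_def)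
  have hb: "(\<lambda>i. h (lvar i)) = ?b"
    by (simp add: h_def fun_eq_iff)
  have R: "subring_set (range (frac_of :: laurent \<Rightarrow> _))"
    by (rule subring_setI) (auto simp flip: frac.one frac.add frac.mult frac.uminus)
  have "range h \<subseteq> range frac_of"
    unfolding h_def
    by (auto intro!: laurent_eval_in_subring[OF R] subring_set_one[OF R] simp: start_def inverse_lvar)
  moreover have "stays_in ?V (range h) (j # k # ks) C (\<lambda>i. h (lvar i))"
    using stays_in_transfer[OF ring_morphism_frac_of inj_frac_of h, of ?V "j # k # ks" C lvar]
      long stays_nonzero[OF cone_laurent_cone start_cone] stays_nonzero[OF cone_laurent_cone b_cone]
    unfolding start_def hb by blast
  ultimately have "stays_in ?V (range frac_of) (j # k # ks) C ?b"
    unfolding hb by (rule stays_in_mono[rotated])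
  then have "stays_in (insert j V) (range frac_of) (j # k # ks) B (\<lambda>i. frac_of (lvar i))"
  proof (rule stays_in_extend_vertex[rotated 3])
    show "C i l = B i l" if "i \<noteq> m" "l \<noteq> m" for i l
      using that by (simp add: C_def)
  qed (use finV m Bm in \<open>auto simp: start_def\<close>)
  then show ?thesis
    using stays_in_superset[OF B, of "insert j V"] finV by (simp del: stays_in.simps) blast
qed

text \<open>
  Induction on the length of the path: two equal consecutive mutations cancel, and for two different
  ones \<open>laurent_step\<close> reduces to shorter paths from other exchange matrices.  No vertex is treated
  as frozen: the variables of all vertices are inverted.
\<close>

theorem laurent_phenomenon:
  assumes "skew_on V B"
  shows "stays_in V (range frac_of) ks B (\<lambda>i. frac_of (lvar i))"
  using assms
proof (induction "length ks" arbitrary: ks V B rule: less_induct)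
  case less
  let ?a = "\<lambda>i. frac_of (lvar i)"
  consider "ks = []" | j where "ks = [j]" | j ls where "ks = j # j # ls"
    | j k ls where "ks = j # k # ls" "j \<noteq> k"
  proof (cases ks)
    case (Cons j ls)
    then show thesis using that by (cases ls) blast+
  qed (use that in blast)
  then show ?case
  proof cases
    case 1
    then show ?thesis by auto
  next
    case 2
    have "mutate_at V B j ?a i \<in> range frac_of" for i
      by (simp only: mutate_at_lvar range_eqI)
    with 2 show ?thesis by auto
  next
    case 3
    have "mutate_at V B j ?a i \<in> range frac_of" for i
      by (simp only: mutate_at_lvar range_eqI)
    moreover have "stays_in V (range frac_of) ls B ?a"
      using less 3 by simp
    moreover have "exchange V B j ?a \<noteq> 0"
      using cone_exchange[OF cone_laurent_cone, of V ?a B j] vars_in_laurent_cone cone_laurent_cone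
      by (auto simp: cone_def)
    then have "mutate_at V (mutate_arr j B) j (mutate_at V B j ?a) = ?a"
      by (intro mutate_at_involution[OF less.prems]) auto
    ultimately show ?thesis
      using 3 by (auto simp: mutate_arr_involution[OF less.prems])
  next
    case 4
    have IH: "stays_in V (range frac_of) ls' B ?a"
      if "skew_on V B" "length ls' \<le> Suc (length ls)" for V B ls'
      using less.hyps[of ls' V B] that 4 by simp
    show ?thesis
    proof (cases "0 \<le> B j k")
      case True
      with laurent_step[of ls V B j k] IH less.prems 4 show ?thesis by blast
    next
      case False
      let ?C = "\<lambda>i l. - B i l"
      have "skew_on V ?C"
        using skew_onD[OF less.prems] by (intro skew_onI) (auto simp flip: skew_onD(2)[OF less.prems])
      with laurent_step[of ls V ?C j k] IH 4 False
      have "stays_in V (range frac_of) ks ?C ?a" by simp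
      then show ?thesis by (simp only: stays_in_reverse)
    qed
  qed
qed

section \<open>Isolated mutable vertices\<close>

lemma laurent_eval_unit_monomial:
  "laurent_eval a b (unit_monomial lvar linv m) = unit_monomial a b m"
  by (simp add: unit_monomial_vars laurent_eval_def linear_extension_single ring_morphism_of_int)

locale graded_laurent =
  fixes M :: "nat set"
begin

definition degree_on :: "(nat \<Rightarrow>\<^sub>0 int) \<Rightarrow> nat \<Rightarrow> int"
  where "degree_on m = (\<lambda>i. if i \<in> M then Poly_Mapping.lookup m i else 0)"

definition component :: "(nat \<Rightarrow> int) \<Rightarrow> laurent \<Rightarrow> laurent"
  where "component \<alpha> f = (\<Sum>m\<in>{m \<in> Poly_Mapping.keys f. degree_on m = \<alpha>}.
    Poly_Mapping.single m (Poly_Mapping.lookup f m))"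

lemma lookup_component:
  "Poly_Mapping.lookup (component \<alpha> f) m =
    (if degree_on m = \<alpha> then Poly_Mapping.lookup f m else 0)"
  by (simp add: component_def lookup_sum lookup_single when_def in_keys_iff)

lemma component_add: "component \<alpha> (f + g) = component \<alpha> f + component \<alpha> g"
  by (rule poly_mapping_eqI) (simp add: lookup_component lookup_add)

lemma component_sum: "component \<alpha> (\<Sum>i\<in>A. f i) = (\<Sum>i\<in>A. component \<alpha> (f i))"
proof (induction A rule: infinite_finite_induct)
  case (insert x F)
  then show ?case by (simp add: component_add)
qed (simp_all add: component_def)

lemma component_single:
  "component \<alpha> (Poly_Mapping.single m c) = (if degree_on m = \<alpha> then Poly_Mapping.single m c else 0)"
  by (rule poly_mapping_eqI) (auto simp: lookup_component lookup_single when_def)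

lemma sum_components:
  "(\<Sum>\<alpha>\<in>degree_on ` Poly_Mapping.keys f. component \<alpha> f) = f"
  by (rule poly_mapping_eqI) (auto simp: lookup_sum lookup_component in_keys_iff)

definition degree_zero :: "laurent set"
  where "degree_zero = {f. \<forall>m\<in>Poly_Mapping.keys f. degree_on m = (\<lambda>_. 0)}"

lemma degree_on_add: "degree_on (m + n) = (\<lambda>i. degree_on m i + degree_on n i)"
  by (auto simp: degree_on_def lookup_add)

lemma subring_degree_zero: "subring_set degree_zero"
proof (rule subring_setI)
  show "1 \<in> degree_zero" by (auto simp: degree_zero_def degree_on_def)
  show "- f \<in> degree_zero" if "f \<in> degree_zero" for f
    using that by (simp add: degree_zero_def)
  show "f + g \<in> degree_zero" if "f \<in> degree_zero" "g \<in> degree_zero" for f g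
    using that keys_add[of f g] by (fastforce simp: degree_zero_def)
  show "f * g \<in> degree_zero" if "f \<in> degree_zero" "g \<in> degree_zero" for f g
    using that keys_mult[of f g] by (fastforce simp: degree_zero_def degree_on_add)
qed

lemma var_degree_zero: "i \<notin> M \<Longrightarrow> lvar i \<in> degree_zero"
  by (auto simp: degree_zero_def lvar_def degree_on_def lookup_single when_def)

lemma component_mult_degree_zero:
  assumes "f \<in> degree_zero"
  shows "component \<alpha> (f * g) = f * component \<alpha> g"
proof -
  let ?f = "\<lambda>m. Poly_Mapping.single m (Poly_Mapping.lookup f m)"
  let ?g = "\<lambda>m. Poly_Mapping.single m (Poly_Mapping.lookup g m)"
  have comp: "component \<alpha> (?f m * ?g n) = ?f m * component \<alpha> (?g n)"
    if "m \<in> Poly_Mapping.keys f" for m n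
  proof -
    have "degree_on (m + n) = degree_on n"
      using that assms by (simp add: degree_zero_def degree_on_add)
    then show ?thesis by (simp add: mult_single component_single)
  qed
  have f: "f = (\<Sum>m\<in>Poly_Mapping.keys f. ?f m)" and g: "g = (\<Sum>n\<in>Poly_Mapping.keys g. ?g n)"
    by (simp_all only: poly_mapping_sum_singles)
  have "f * g = (\<Sum>m\<in>Poly_Mapping.keys f. ?f m) * (\<Sum>n\<in>Poly_Mapping.keys g. ?g n)"
    by (simp only: poly_mapping_sum_singles)
  then have "component \<alpha> (f * g) =
      (\<Sum>m\<in>Poly_Mapping.keys f. \<Sum>n\<in>Poly_Mapping.keys g. component \<alpha> (?f m * ?g n))"
    by (simp only: sum_product component_sum)
  also have "\<dots> = (\<Sum>m\<in>Poly_Mapping.keys f. \<Sum>n\<in>Poly_Mapping.keys g. ?f m * component \<alpha> (?g n))"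
    by (intro sum.cong refl comp)
  also have "\<dots> = (\<Sum>m\<in>Poly_Mapping.keys f. ?f m) * component \<alpha> (\<Sum>n\<in>Poly_Mapping.keys g. ?g n)"
    by (simp only: sum_product component_sum)
  finally show ?thesis
    by (simp only: poly_mapping_sum_singles)
qed

end

text \<open>
  The set \<open>M\<close> is that of the mutable vertices of a seed without arrows between mutable vertices.
\<close>

locale isolated_vertices = graded_laurent M for M :: "nat set" +
  fixes V :: "nat set" and B :: "nat \<Rightarrow> nat \<Rightarrow> int"
  assumes skew: "skew_on V B" and M: "M \<subseteq> V"
    and isolated: "\<And>k l. k \<in> M \<Longrightarrow> l \<in> M \<Longrightarrow> B k l = 0"
begin

text \<open>
  The exchange polynomials of the isolated vertices.  They do not involve the variables in \<open>M\<close>, so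
  mutations at different vertices of \<open>M\<close> do not interact.
\<close>

definition E :: "nat \<Rightarrow> laurent"
  where "E k = exchange V B k lvar"

lemma finite_M: "finite M"
  using M skew_onD(1)[OF skew] by (rule finite_subset)

lemma exchange_isolated_cong:
  assumes "k \<in> M" "\<And>i. i \<notin> M \<Longrightarrow> a i = b i"
  shows "exchange V B k a = exchange V B k b"
  by (rule exchange_cong) (use assms isolated in blast)

lemma E_degree_zero: "k \<in> M \<Longrightarrow> E k \<in> degree_zero"
proof -
  assume k: "k \<in> M"
  let ?a = "\<lambda>i. if i \<in> M then 1 else lvar i"
  have "E k = exchange V B k ?a"
    unfolding E_def by (rule exchange_isolated_cong[OF k]) simp
  also have "\<dots> \<in> degree_zero"
    unfolding exchange_def using var_degree_zero
    by (intro subring_set_add subring_set_prod subring_set_power subring_degree_zero)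
       (auto intro: subring_set_one[OF subring_degree_zero])
  finally show ?thesis .
qed

lemma coeff_sum_E: "coeff_sum (E k) = 2"
  by (simp add: E_def coeff_sum.exchange) (simp add: exchange_def)

lemma E_nonzero: "E k \<noteq> 0"
  using coeff_sum_E[of k] by auto

text \<open>
  The cluster after mutating once at each vertex in \<open>N\<close>.
\<close>

definition flipped :: "nat set \<Rightarrow> nat \<Rightarrow> laurent fract"
  where "flipped N i = (if i \<in> N then frac_of (E i * linv i) else frac_of (lvar i))"

lemma flipped_cone: "range (flipped N) \<subseteq> laurent_cone"
  by (auto simp: flipped_def coeff_sum_E simp del: frac.mult intro!: frac_of_in_laurent_cone)

lemma flipped_nonzero: "flipped N i \<noteq> 0"
proof -
  have "flipped N i \<in> laurent_cone" using flipped_cone by auto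
  then show ?thesis using cone_laurent_cone unfolding cone_def by metis
qed

abbreviation eval_flipped :: "nat set \<Rightarrow> laurent \<Rightarrow> laurent fract"
  where "eval_flipped N \<equiv> laurent_eval (flipped N) (\<lambda>i. inverse (flipped N i))"

text \<open>
  Multiplication by a power of \<open>E i\<close> clears the denominators that the substitution of \<open>E i / x\<^sub>i\<close>
  creates in \<open>x\<^sub>i ^ z\<close>.
\<close>

lemma unit_power_flipped:
  assumes "- z \<le> int p"
  shows "unit_power (frac_of (E i * linv i)) (inverse (frac_of (E i * linv i))) z * frac_of (E i) ^ p =
    frac_of (unit_power (linv i) (lvar i) z * E i ^ nat (int p + z))"
proof (cases "0 \<le> z")
  case True
  then have "nat (int p + z) = nat z + p" by (simp add: nat_add_distrib add.commute)
  with True show ?thesis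
    by (simp add: unit_power_def power_mult_distrib power_add algebra_simps)
next
  case False
  have E: "frac_of (E i) \<noteq> 0" by (simp add: E_nonzero)
  have "frac_of (E i) ^ p = frac_of (E i) ^ nat (int p + z) * frac_of (E i) ^ nat (- z)"
    using False assms by (simp flip: power_add nat_add_distrib)
  moreover have "inverse (frac_of (linv i)) = frac_of (lvar i)"
    using inverse_lvar[of i] by (metis inverse_inverse_eq)
  then have "inverse (frac_of (E i * linv i)) * frac_of (E i) = frac_of (lvar i)"
    using E by (simp add: mult.commute)
  then have "inverse (frac_of (E i * linv i)) ^ nat (- z) * frac_of (E i) ^ nat (- z) =
      frac_of (lvar i) ^ nat (- z)"
    by (simp only: flip: power_mult_distrib)
  ultimately show ?thesis
    using False by (simp add: unit_power_def mult_ac)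
qed

text \<open>
  Substituting the flipped cluster turns a term of degree \<open>\<alpha>\<close> into one with denominator
  \<open>\<Prod>i\<in>N. E i ^ (- \<alpha> i)\<close>.  Terms of different degrees stay in different degrees, so the
  denominator must cancel within each degree separately.
\<close>

lemma component_divisible:
  assumes f: "eval_flipped {i \<in> M. \<alpha> i < 0} f \<in> range frac_of"
  shows "\<exists>g. component \<alpha> f = (\<Prod>i\<in>{i \<in> M. \<alpha> i < 0}. E i ^ nat (- \<alpha> i)) * component \<alpha> g"
proof -
  define N where "N = {i \<in> M. \<alpha> i < 0}"
  have N: "N \<subseteq> M" "finite N" using finite_M by (auto simp: N_def)
  obtain g where g: "eval_flipped N f = frac_of g"
    using f by (auto simp: N_def)
  \<comment> \<open>The involution \<open>\<theta>\<close> inverts the variables in \<open>N\<close>.  It undoes the change of exponents caused by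
    the substitution, so that terms keep their degree.\<close>
  define u where "u = (\<lambda>i. if i \<in> N then linv i else lvar i)"
  define v where "v = (\<lambda>i. if i \<in> N then lvar i else linv i)"
  have uv: "u i * v i = 1" for i
    using lvar_linv[of i] by (simp add: u_def v_def mult.commute)
  define \<theta> where "\<theta> = laurent_eval u v"
  interpret \<theta>: ring_morphism \<theta>
    unfolding \<theta>_def by (rule ring_morphism_laurent_eval[OF uv])
  have \<theta>_vars: "\<theta> (lvar i) = u i" "\<theta> (linv i) = v i" for i
    by (simp_all add: \<theta>_def)
  have \<theta>\<theta>: "\<theta> (\<theta> q) = q" for q
  proof (rule ring_morphism_laurent_unique[of "\<lambda>q. \<theta> (\<theta> q)" "\<lambda>q. q"])
    show "ring_morphism (\<lambda>q. \<theta> (\<theta> q))"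
      by (rule ring_morphism_comp) (rule \<theta>.ring_morphism_axioms)+
    show "ring_morphism (\<lambda>q :: laurent. q)" by unfold_locales auto
  qed (simp add: u_def v_def \<theta>_vars)
  have \<theta>E: "\<theta> (E k) = E k" if "k \<in> N" for k
  proof -
    have "\<theta> (E k) = exchange V B k u"
      by (simp add: E_def \<theta>.exchange \<theta>_vars)
    also have "\<dots> = E k"
      unfolding E_def by (rule exchange_isolated_cong) (use that N in \<open>auto simp: u_def\<close>)
    finally show ?thesis .
  qed
  have "\<exists>p. \<forall>m\<in>Poly_Mapping.keys f. \<forall>i\<in>N. - Poly_Mapping.lookup m i \<le> int p"
  proof -
    let ?S = "(\<lambda>(m, i). nat (- Poly_Mapping.lookup m i)) ` (Poly_Mapping.keys f \<times> N)"
    have "finite ?S" using N by simp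
    then obtain p where p: "\<forall>x\<in>?S. x \<le> p"
      using finite_nat_set_iff_bounded_le by blast
    have "- Poly_Mapping.lookup m i \<le> int p" if "m \<in> Poly_Mapping.keys f" "i \<in> N" for m i
    proof -
      have "nat (- Poly_Mapping.lookup m i) \<in> ?S" using that by force
      then have "nat (- Poly_Mapping.lookup m i) \<le> p" using p by blast
      then show ?thesis by linarith
    qed
    then show ?thesis by blast
  qed
  then obtain p where p: "\<And>m i. m \<in> Poly_Mapping.keys f \<Longrightarrow> i \<in> N \<Longrightarrow> - Poly_Mapping.lookup m i \<le> int p"
    by blast
  \<comment> \<open>The exponent \<open>p\<close> is large enough for \<open>?D\<close> to clear all denominators; \<open>?Q m\<close> is what remains
    of it after clearing those of the term \<open>m\<close>.\<close>
  let ?Q = "\<lambda>m. \<Prod>i\<in>N. E i ^ nat (int p + Poly_Mapping.lookup m i)"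
  let ?D = "\<Prod>i\<in>N. E i ^ p"
  have mono: "unit_monomial (flipped N) (\<lambda>i. inverse (flipped N i)) m * frac_of ?D =
      frac_of (unit_monomial u v m * ?Q m)" if m: "m \<in> Poly_Mapping.keys f" for m
  proof -
    let ?T = "Poly_Mapping.keys m \<union> N"
    have T: "finite ?T" "Poly_Mapping.keys m \<subseteq> ?T" using N by auto
    have if_prod: "(\<Prod>i\<in>N. c i) = (\<Prod>i\<in>?T. if i \<in> N then c i else 1)"
      for c :: "nat \<Rightarrow> 'c::comm_ring_1"
      using T(1) by (simp add: prod.If_cases Int_absorb1 flip: prod.inter_restrict)
    have "unit_monomial (flipped N) (\<lambda>i. inverse (flipped N i)) m * frac_of ?D =
        (\<Prod>i\<in>?T. unit_power (flipped N i) (inverse (flipped N i)) (Poly_Mapping.lookup m i) *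
          (if i \<in> N then frac_of (E i) ^ p else 1))"
    proof -
      have "frac_of ?D = (\<Prod>i\<in>?T. if i \<in> N then frac_of (E i) ^ p else 1)"
        unfolding frac.prod frac.power by (rule if_prod)
      then show ?thesis
        by (simp only: unit_monomial_superset[OF T] prod.distrib)
    qed
    also have "\<dots> = (\<Prod>i\<in>?T. frac_of (unit_power (u i) (v i) (Poly_Mapping.lookup m i) *
          (if i \<in> N then E i ^ nat (int p + Poly_Mapping.lookup m i) else 1)))"
    proof (rule prod.cong)
      fix i assume "i \<in> ?T"
      show "unit_power (flipped N i) (inverse (flipped N i)) (Poly_Mapping.lookup m i) *
          (if i \<in> N then frac_of (E i) ^ p else 1) =
        frac_of (unit_power (u i) (v i) (Poly_Mapping.lookup m i) *
          (if i \<in> N then E i ^ nat (int p + Poly_Mapping.lookup m i) else 1))"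
      proof (cases "i \<in> N")
        case True
        then show ?thesis
          using unit_power_flipped[OF p[OF m True]] by (simp add: flipped_def u_def v_def)
      next
        case False
        then show ?thesis
          by (simp add: flipped_def u_def v_def inverse_lvar unit_power_def)
      qed
    qed simp
    also have "\<dots> = frac_of (unit_monomial u v m * ?Q m)"
      unfolding unit_monomial_superset[OF T] if_prod frac.prod frac.mult prod.distrib ..
    finally show ?thesis .
  qed
  have "frac_of (g * ?D) = eval_flipped N f * frac_of ?D"
    by (simp add: g)
  also have "\<dots> = (\<Sum>m\<in>Poly_Mapping.keys f. of_int (Poly_Mapping.lookup f m) *
      (unit_monomial (flipped N) (\<lambda>i. inverse (flipped N i)) m * frac_of ?D))"
    unfolding laurent_eval_def linear_extension_def by (simp only: sum_distrib_right mult.assoc)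
  also have "\<dots> = (\<Sum>m\<in>Poly_Mapping.keys f. frac_of (of_int (Poly_Mapping.lookup f m)) *
      frac_of (unit_monomial u v m * ?Q m))"
  proof (rule sum.cong)
    have "(of_int c :: laurent fract) = frac_of (of_int c)" for c
      by (cases c rule: int_cases2) (simp_all add: frac_of_def of_nat_fract)
    then show "of_int (Poly_Mapping.lookup f m) *
        (unit_monomial (flipped N) (\<lambda>i. inverse (flipped N i)) m * frac_of ?D) =
      frac_of (of_int (Poly_Mapping.lookup f m)) * frac_of (unit_monomial u v m * ?Q m)"
      if "m \<in> Poly_Mapping.keys f" for m
      using mono[OF that] by simp
  qed simp
  also have "\<dots> = frac_of (\<Sum>m\<in>Poly_Mapping.keys f. of_int (Poly_Mapping.lookup f m) *
      (unit_monomial u v m * ?Q m))"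
    by (simp only: frac.sum frac.mult)
  finally have "g * ?D = (\<Sum>m\<in>Poly_Mapping.keys f. of_int (Poly_Mapping.lookup f m) *
      (unit_monomial u v m * ?Q m))"
    by (simp only: frac_of_eq_iff)
  then have "\<theta> g * \<theta> ?D = (\<Sum>m\<in>Poly_Mapping.keys f. \<theta> (of_int (Poly_Mapping.lookup f m)) *
      (\<theta> (unit_monomial u v m) * \<theta> (?Q m)))"
    by (simp only: \<theta>.sum flip: \<theta>.mult)
  also have "\<dots> = (\<Sum>m\<in>Poly_Mapping.keys f. ?Q m * Poly_Mapping.single m (Poly_Mapping.lookup f m))"
  proof (rule sum.cong)
    fix m
    have "\<theta> (of_int c) = of_int c" for c
      using \<theta>.zero \<theta>.one by (induction c rule: int_induct[of _ 0]) auto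
    moreover have "(of_int c :: laurent) = Poly_Mapping.single 0 c" for c
      using single_of_int[of c, where 'a="nat \<Rightarrow>\<^sub>0 int" and 'b=int] by simp
    moreover have "\<theta> (unit_monomial u v m) = Poly_Mapping.single m 1"
      using \<theta>\<theta>[of "unit_monomial lvar linv m"]
      by (simp add: \<theta>_def laurent_eval_unit_monomial) (simp add: unit_monomial_vars)
    moreover have "\<theta> (?Q m) = ?Q m"
      by (simp add: \<theta>.prod \<theta>E)
    ultimately show "\<theta> (of_int (Poly_Mapping.lookup f m)) * (\<theta> (unit_monomial u v m) * \<theta> (?Q m)) =
        ?Q m * Poly_Mapping.single m (Poly_Mapping.lookup f m)"
      by (simp add: mult_single mult.assoc[symmetric] mult.commute)
  qed simp
  finally have main: "\<theta> g * \<theta> ?D = \<dots>" .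
  have D_zero: "?D \<in> degree_zero" and Q_zero: "?Q m \<in> degree_zero" for m
    using N E_degree_zero
    by (auto intro!: subring_set_prod subring_set_power subring_degree_zero)
  have \<theta>D: "\<theta> ?D = ?D"
    by (simp add: \<theta>.prod \<theta>E)
  have QD: "?Q m * (\<Prod>i\<in>N. E i ^ nat (- \<alpha> i)) = ?D"
    if "m \<in> Poly_Mapping.keys f" "degree_on m = \<alpha>" for m
  proof -
    have "nat (int p + Poly_Mapping.lookup m i) + nat (- \<alpha> i) = p" if "i \<in> N" for i
    proof -
      have "Poly_Mapping.lookup m i = \<alpha> i"
        using that N \<open>degree_on m = \<alpha>\<close> by (auto simp: degree_on_def)
      moreover have "\<alpha> i < 0" using that by (simp add: N_def)
      ultimately show ?thesis using p[OF \<open>m \<in> Poly_Mapping.keys f\<close> that] by simp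
    qed
    then show ?thesis by (simp flip: prod.distrib power_add)
  qed
  have "?D * component \<alpha> (\<theta> g) = component \<alpha> (?D * \<theta> g)"
    by (simp only: component_mult_degree_zero[OF D_zero])
  also have "?D * \<theta> g =
      (\<Sum>m\<in>Poly_Mapping.keys f. ?Q m * Poly_Mapping.single m (Poly_Mapping.lookup f m))"
    using main unfolding \<theta>D by (simp only: mult.commute)
  also have "component \<alpha> \<dots> = (\<Sum>m\<in>Poly_Mapping.keys f.
      ?Q m * component \<alpha> (Poly_Mapping.single m (Poly_Mapping.lookup f m)))"
    by (simp only: component_sum component_mult_degree_zero[OF Q_zero])
  finally have "?D * component \<alpha> (\<theta> g) * (\<Prod>i\<in>N. E i ^ nat (- \<alpha> i)) =
      (\<Sum>m\<in>Poly_Mapping.keys f.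
        (?Q m * component \<alpha> (Poly_Mapping.single m (Poly_Mapping.lookup f m))) *
        (\<Prod>i\<in>N. E i ^ nat (- \<alpha> i)))"
    by (simp only: sum_distrib_right)
  also have "\<dots> = (\<Sum>m\<in>Poly_Mapping.keys f. ?D * component \<alpha> (Poly_Mapping.single m (Poly_Mapping.lookup f m)))"
  proof (rule sum.cong)
    fix m assume m: "m \<in> Poly_Mapping.keys f"
    show "(?Q m * component \<alpha> (Poly_Mapping.single m (Poly_Mapping.lookup f m))) *
        (\<Prod>i\<in>N. E i ^ nat (- \<alpha> i)) = ?D * component \<alpha> (Poly_Mapping.single m (Poly_Mapping.lookup f m))"
      using QD[OF m] by (auto simp: component_single mult_ac simp del: QD)
  qed simp
  also have "\<dots> = ?D * component \<alpha> f"
    by (simp only: flip: sum_distrib_left component_sum) (simp only: poly_mapping_sum_singles)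
  finally have "?D * ((\<Prod>i\<in>N. E i ^ nat (- \<alpha> i)) * component \<alpha> (\<theta> g)) = ?D * component \<alpha> f"
    by (simp only: mult_ac)
  moreover have "?D \<noteq> 0"
    using N by (simp add: E_nonzero)
  ultimately have "component \<alpha> f = (\<Prod>i\<in>N. E i ^ nat (- \<alpha> i)) * component \<alpha> (\<theta> g)"
    by (simp only: mult_cancel_left simp_thms)
  then show ?thesis unfolding N_def by (rule exI)
qed

text \<open>
  A monomial \<open>x ^ \<alpha>\<close> times \<open>E i ^ (- \<alpha> i)\<close> for all negative \<open>\<alpha> i\<close> is a monomial in the variables and the mutated
  variables \<open>E i / x\<^sub>i\<close>.
\<close>

lemma flipped_laurent_in_subring:
  assumes f: "\<And>N. N \<subseteq> M \<Longrightarrow> eval_flipped N f \<in> range frac_of"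
    and R: "subring_set R" "\<And>i. lvar i \<in> R" "\<And>i. i \<notin> M \<Longrightarrow> linv i \<in> R"
      "\<And>k. k \<in> M \<Longrightarrow> E k * linv k \<in> R"
  shows "f \<in> R"
proof -
  have "component \<alpha> f \<in> R" for \<alpha>
  proof -
    let ?N = "{i \<in> M. \<alpha> i < 0}"
    obtain g where g: "component \<alpha> f = (\<Prod>i\<in>?N. E i ^ nat (- \<alpha> i)) * component \<alpha> g"
      using component_divisible[OF f] by blast
    have "(\<Prod>i\<in>?N. E i ^ nat (- \<alpha> i)) * Poly_Mapping.single m c \<in> R" if m: "degree_on m = \<alpha>" for m c
    proof -
      have \<alpha>: "\<alpha> i = Poly_Mapping.lookup m i" if "i \<in> M" for i
        using m that by (auto simp: degree_on_def)
      have "?N \<subseteq> Poly_Mapping.keys m"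
        using \<alpha> by (auto simp: in_keys_iff)
      then have "Poly_Mapping.single m 1 =
          (\<Prod>i\<in>Poly_Mapping.keys m - ?N. unit_power (lvar i) (linv i) (Poly_Mapping.lookup m i)) *
          (\<Prod>i\<in>?N. unit_power (lvar i) (linv i) (Poly_Mapping.lookup m i))"
        unfolding unit_monomial_vars[symmetric] unit_monomial_def
        by (intro prod.subset_diff) auto
      also have "(\<Prod>i\<in>?N. unit_power (lvar i) (linv i) (Poly_Mapping.lookup m i)) =
          (\<Prod>i\<in>?N. linv i ^ nat (- \<alpha> i))"
        using \<alpha> by (intro prod.cong) (auto simp: unit_power_def)
      finally have 1: "Poly_Mapping.single m 1 =
          (\<Prod>i\<in>Poly_Mapping.keys m - ?N. unit_power (lvar i) (linv i) (Poly_Mapping.lookup m i)) *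
          (\<Prod>i\<in>?N. linv i ^ nat (- \<alpha> i))" .
      have "Poly_Mapping.single m c = of_int c * Poly_Mapping.single m 1"
        using single_of_int[of c, where 'a="nat \<Rightarrow>\<^sub>0 int" and 'b=int]
        by (simp add: mult_single flip: single_of_int)
      then have "(\<Prod>i\<in>?N. E i ^ nat (- \<alpha> i)) * Poly_Mapping.single m c = of_int c *
          (\<Prod>i\<in>Poly_Mapping.keys m - ?N. unit_power (lvar i) (linv i) (Poly_Mapping.lookup m i)) *
          (\<Prod>i\<in>?N. (E i * linv i) ^ nat (- \<alpha> i))"
        unfolding 1 power_mult_distrib prod.distrib by (simp only: mult_ac)
      moreover have "unit_power (lvar i) (linv i) (Poly_Mapping.lookup m i) \<in> R"
        if "i \<in> Poly_Mapping.keys m - ?N" for i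
      proof (cases "i \<in> M")
        case True
        then have "0 \<le> Poly_Mapping.lookup m i" using that \<alpha> by fastforce
        then show ?thesis using R(2) by (simp add: unit_power_def subring_set_power[OF R(1)])
      next
        case False
        then show ?thesis using R(2,3) by (simp add: unit_power_def subring_set_power[OF R(1)])
      qed
      then have "(\<Prod>i\<in>Poly_Mapping.keys m - ?N. unit_power (lvar i) (linv i) (Poly_Mapping.lookup m i)) \<in> R"
        by (rule subring_set_prod[OF R(1)])
      moreover have "(\<Prod>i\<in>?N. (E i * linv i) ^ nat (- \<alpha> i)) \<in> R"
        using R(4) by (intro subring_set_prod[OF R(1)] subring_set_power[OF R(1)]) blast
      ultimately show ?thesis
        by (simp only: subring_set_mult[OF R(1)] subring_set_of_int[OF R(1)])
    qed
    then show ?thesis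
      unfolding g component_def[of \<alpha> g] sum_distrib_left
      by (intro subring_set_sum[OF R(1)]) auto
  qed
  then have "(\<Sum>\<alpha>\<in>degree_on ` Poly_Mapping.keys f. component \<alpha> f) \<in> R"
    by (intro subring_set_sum[OF R(1)])
  then show ?thesis by (simp only: sum_components)
qed

text \<open>
  Mutating at vertices of \<open>M\<close> preserves the rows of \<open>M\<close> up to sign, hence the exchange polynomials
  there; arrows between frozen vertices may change.
\<close>

definition sign_equivalent :: "(nat \<Rightarrow> nat \<Rightarrow> int) \<Rightarrow> bool"
  where "sign_equivalent C \<longleftrightarrow> (\<forall>k\<in>M. C k = B k \<or> C k = (\<lambda>i. - B k i))"

lemma sign_equivalent_mutate:
  assumes C: "sign_equivalent C" and n: "n \<in> M"
  shows "sign_equivalent (mutate_arr n C)"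
  unfolding sign_equivalent_def
proof
  fix k assume k: "k \<in> M"
  show "mutate_arr n C k = B k \<or> mutate_arr n C k = (\<lambda>i. - B k i)"
  proof (cases "k = n")
    case True
    then have "mutate_arr n C k = (\<lambda>i. - C k i)" by (auto simp: mutate_arr_def)
    then show ?thesis using C k by (auto simp: sign_equivalent_def)
  next
    case False
    have "C k n = 0"
      using C k isolated[OF k n] by (auto simp: sign_equivalent_def)
    with False have "mutate_arr n C k = C k" by (auto simp: mutate_arr_def)
    then show ?thesis using C k by (simp add: sign_equivalent_def)
  qed
qed

lemma exchange_sign_equivalent:
  assumes "sign_equivalent C" "k \<in> M"
  shows "exchange V C k a = exchange V B k a"
proof -
  from assms consider "C k = B k" | "C k = (\<lambda>i. - B k i)"
    by (auto simp: sign_equivalent_def)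
  then show ?thesis
    by cases (simp_all add: exchange_def add.commute)
qed

lemma mutate_along_isolated:
  assumes "sign_equivalent C" "distinct ns" "set ns \<subseteq> M"
  shows "mutate_along V ns C a = (\<lambda>i. if i \<in> set ns then exchange V B i a / a i else a i)"
  using assms
proof (induction ns arbitrary: C a)
  case (Cons n ns)
  have n: "n \<in> M" using Cons.prems by simp
  let ?a = "mutate_at V C n a"
  have a: "?a = a(n := exchange V B n a / a n)"
    by (simp add: mutate_at_def exchange_sign_equivalent[OF Cons.prems(1) n])
  have "mutate_along V (n # ns) C a = (\<lambda>i. if i \<in> set ns then exchange V B i ?a / ?a i else ?a i)"
    using Cons.IH[OF sign_equivalent_mutate[OF Cons.prems(1) n]] Cons.prems by simp
  moreover have "exchange V B i ?a = exchange V B i a" if "i \<in> set ns" for i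
    using that Cons.prems(3) n by (intro exchange_isolated_cong) (auto simp: a)
  ultimately show ?case
    using Cons.prems(2) by (auto simp: a fun_eq_iff)
qed simp

lemma fold_mutate_arr_rev:
  assumes "skew_on V C"
  shows "fold mutate_arr (rev ns) (fold mutate_arr ns C) = C"
  using assms
proof (induction ns arbitrary: C)
  case (Cons n ns)
  then show ?case
    using Cons.IH[OF mutate_arr_skew[OF Cons.prems]] mutate_arr_involution[OF Cons.prems]
    by simp
qed simp

lemma fold_mutate_arr_skew: "skew_on V C \<Longrightarrow> skew_on V (fold mutate_arr ns C)"
  by (induction ns arbitrary: C) (auto intro: mutate_arr_skew)

lemma sign_equivalent_fold:
  "sign_equivalent C \<Longrightarrow> set ns \<subseteq> M \<Longrightarrow> sign_equivalent (fold mutate_arr ns C)"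
  by (induction ns arbitrary: C) (auto intro: sign_equivalent_mutate)

text \<open>
  Apply the Laurent phenomenon to the seed obtained by mutating at \<open>N\<close>, along the path that first
  undoes these mutations and then follows \<open>ks\<close>.
\<close>

lemma cluster_variable_flipped:
  assumes "N \<subseteq> M" "mutate_along V ks B (\<lambda>i. frac_of (lvar i)) l = frac_of f"
  shows "eval_flipped N f \<in> range frac_of"
proof -
  let ?a = "\<lambda>i. frac_of (lvar i)"
  have a: "range ?a \<subseteq> laurent_cone" using vars_in_laurent_cone by auto
  obtain ns where ns: "set ns = N" "distinct ns"
    using finite_distinct_list finite_subset[OF assms(1) finite_M] by blast
  let ?C = "fold mutate_arr ns B"
  have "sign_equivalent B" by (simp add: sign_equivalent_def)
  then have C: "sign_equivalent ?C"
    using sign_equivalent_fold ns assms(1) by blast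
  have "mutate_along V (rev ns) ?C ?a = (\<lambda>i. if i \<in> N then exchange V B i ?a / ?a i else ?a i)"
    using mutate_along_isolated[OF C, of "rev ns"] ns assms(1) by simp
  also have "\<dots> = flipped N"
    unfolding flipped_def E_def
    by (simp only: frac_of_div_lvar flip: frac.exchange)
  finally have start: "mutate_along V (rev ns) ?C ?a = flipped N" .
  have "stays_in V (range frac_of) (rev ns @ ks) ?C ?a"
    by (rule laurent_phenomenon[OF fold_mutate_arr_skew[OF skew]])
  then have "stays_in V (range frac_of) ks B (flipped N)"
    using stays_in_append[of V _ "rev ns" ks ?C ?a]
    unfolding start fold_mutate_arr_rev[OF skew] by blast
  then have "mutate_along V ks B (flipped N) l \<in> range frac_of"
    using stays_in_end by blast
  moreover have "mutate_along V ks B (flipped N) l = eval_flipped N f"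
  proof -
    have h: "ring_morphism (eval_flipped N)"
      by (rule ring_morphism_laurent_eval) (simp add: flipped_nonzero)
    obtain g where g: "mutate_along V ks B ?a = (\<lambda>i. frac_of (g i))"
      "mutate_along V ks B (\<lambda>i. eval_flipped N (lvar i)) = (\<lambda>i. eval_flipped N (g i))"
      using stays_in_transfer[OF ring_morphism_frac_of inj_frac_of h, of V ks B lvar]
        laurent_phenomenon[OF skew] stays_nonzero[OF cone_laurent_cone a]
        stays_nonzero[OF cone_laurent_cone flipped_cone] by auto
    then have "f = g l" using assms(2) by simp
    with g show ?thesis by simp
  qed
  ultimately show ?thesis by simp
qed

lemma cluster_variable_in_subring:
  fixes a :: "nat \<Rightarrow> 'k::field"
  assumes P: "cone P" "range a \<subseteq> P"
    and R: "subring_set R" "\<And>i. a i \<in> R" "\<And>i. i \<notin> M \<Longrightarrow> inverse (a i) \<in> R"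
      "\<And>k. k \<in> M \<Longrightarrow> exchange V B k a / a k \<in> R"
  shows "mutate_along V ks B a l \<in> R"
proof -
  define h where "h = laurent_eval a (\<lambda>i. inverse (a i))"
  have "a i \<in> P" for i using P(2) by auto
  then have a0: "a i \<noteq> 0" for i using P(1) unfolding cone_def by metis
  interpret h: ring_morphism h
    unfolding h_def by (rule ring_morphism_laurent_eval) (simp add: a0)
  have h_vars: "h (lvar i) = a i" "h (linv i) = inverse (a i)" for i
    by (simp_all add: h_def)
  have start: "range (\<lambda>i. frac_of (lvar i)) \<subseteq> laurent_cone"
    using vars_in_laurent_cone by auto
  obtain g where g: "mutate_along V ks B (\<lambda>i. frac_of (lvar i)) = (\<lambda>i. frac_of (g i))"
    "mutate_along V ks B (\<lambda>i. h (lvar i)) = (\<lambda>i. h (g i))"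
    using stays_in_transfer[OF ring_morphism_frac_of inj_frac_of h.ring_morphism_axioms, of V ks B lvar]
      laurent_phenomenon[OF skew] stays_nonzero[OF cone_laurent_cone start]
      stays_nonzero[OF P] by (auto simp: h_vars)
  have "g l \<in> {f. h f \<in> R}"
  proof (rule flipped_laurent_in_subring)
    show "eval_flipped N (g l) \<in> range frac_of" if "N \<subseteq> M" for N
      using that by (rule cluster_variable_flipped[of N ks l]) (simp add: g)
    show "subring_set {f. h f \<in> R}"
      using R(1) by (auto simp: subring_set_def)
    show "E k * linv k \<in> {f. h f \<in> R}" if "k \<in> M" for k
      using R(4)[OF that] by (simp add: E_def h.exchange h_vars divide_inverse)
  qed (use R in \<open>auto simp: h_vars\<close>)
  then show ?thesis
    using g by (simp add: h_vars)
qed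

end

section \<open>Generated subrings\<close>

lemma RF_simps [simp]:
  "carrier RF = UNIV" "monoid.mult RF = (*)" "monoid.one RF = 1" "ring.zero RF = 0"
  "ring.add RF = (+)"
  by (simp_all add: ring_of_type_algebra_def)

lemma RF_a_inv: "a_inv RF x = - x"
proof -
  interpret cring RF by (rule cring_from_type_algebra)
  show ?thesis using minus_equality[of "- x" x] by simp
qed

lemma subring_generate_ring: "subring_set (generate_ring RF H)"
  by (rule subring_setI)
     (use generate_ring.one[of RF H] generate_ring.a_inv[of _ RF H] generate_ring.eng_add[of _ RF H]
        generate_ring.eng_mult[of _ RF H] in \<open>simp_all add: RF_a_inv\<close>)

lemma generate_ring_superset: "H \<subseteq> generate_ring RF H"
  by (auto intro: generate_ring.incl)

lemma generate_ring_least: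
  assumes "subring_set R" "H \<subseteq> R"
  shows "generate_ring RF H \<subseteq> R"
proof
  fix x assume "x \<in> generate_ring RF H"
  then show "x \<in> R"
    by (induction rule: generate_ring.induct)
       (use assms in \<open>auto simp: subring_set_def RF_a_inv\<close>)
qed

lemma generate_ring_subring: "subring_set R \<Longrightarrow> generate_ring RF R = R"
  using generate_ring_least[of R R] generate_ring_superset[of R] by blast

lemma generate_ring_mono: "H \<subseteq> K \<Longrightarrow> generate_ring RF H \<subseteq> generate_ring RF K"
  using generate_ring_least[OF subring_generate_ring] generate_ring_superset by blast

section \<open>Positive seeds\<close>

text \<open>
  A consequence of algebraic independence that visibly passes from a cluster to its mutations, because
  the exchange relations contain no subtraction.
\<close>

definition positive_seed :: "seed \<Rightarrow> bool"
  where "positive_seed s \<longleftrightarrow>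
    is_ice_quiver s \<and> (\<exists>P. cone P \<and> clus s ` vertices s \<subseteq> P)"

lemma ring_morphism_ratfun_const: "ring_morphism ratfun_const"
proof
  show "ratfun_const 1 = 1"
    by (simp add: ratfun_const_def One_fract_def)
qed (simp_all add: ratfun_const_def single_add mult_single)

lemma qmpoly_eval_linear_extension:
  "(\<lambda>P. qmpoly_eval P a) = linear_extension ratfun_const
    (\<lambda>m. \<Prod>i\<in>Poly_Mapping.keys m. a i ^ Poly_Mapping.lookup m i)"
  by (simp add: fun_eq_iff qmpoly_eval_def linear_extension_def)

lemma ring_morphism_qmpoly_eval: "ring_morphism (\<lambda>P. qmpoly_eval P a)"
  unfolding qmpoly_eval_linear_extension
proof (rule ring_morphism_linear_extension[OF ring_morphism_ratfun_const])
  fix m n :: "nat \<Rightarrow>\<^sub>0 nat"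
  let ?A = "Poly_Mapping.keys m \<union> Poly_Mapping.keys n"
  have *: "(\<Prod>i\<in>Poly_Mapping.keys q. a i ^ Poly_Mapping.lookup q i) =
      (\<Prod>i\<in>?A. a i ^ Poly_Mapping.lookup q i)" if "Poly_Mapping.keys q \<subseteq> ?A" for q
    using that by (intro prod.mono_neutral_left) (auto simp: in_keys_iff)
  show "(\<Prod>i\<in>Poly_Mapping.keys (m + n). a i ^ Poly_Mapping.lookup (m + n) i) =
      (\<Prod>i\<in>Poly_Mapping.keys m. a i ^ Poly_Mapping.lookup m i) *
      (\<Prod>i\<in>Poly_Mapping.keys n. a i ^ Poly_Mapping.lookup n i)"
    using *[of "m + n"] *[of m] *[of n] keys_add[of m n]
    by (simp add: lookup_add power_add prod.distrib)
qed simp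

text \<open>
  The cone consists of the quotients of values at the cluster of polynomials with positive coefficient
  sum; such polynomials are not 0, so algebraic independence keeps the values from vanishing.
\<close>

lemma positive_seed_if_seed:
  assumes "is_seed s"
  shows "positive_seed s"
proof -
  let ?n = "nvert s" and ?a = "clus s"
  interpret ev: ring_morphism "\<lambda>P. qmpoly_eval P ?a"
    by (rule ring_morphism_qmpoly_eval)
  define \<epsilon> :: "qmpoly \<Rightarrow> rat" where "\<epsilon> = linear_extension (\<lambda>c. c) (\<lambda>_. 1)"
  have id: "ring_morphism (\<lambda>c :: rat. c)" by unfold_locales auto
  interpret \<epsilon>: ring_morphism \<epsilon>
    unfolding \<epsilon>_def by (rule ring_morphism_linear_extension[OF id]) auto
  define S where "S = {p :: qmpoly. (\<forall>m\<in>Poly_Mapping.keys p. Poly_Mapping.keys m \<subseteq> {1..?n}) \<and> 0 < \<epsilon> p}"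
  have "cone {qmpoly_eval p ?a / qmpoly_eval q ?a | p q. p \<in> S \<and> q \<in> S}" (is "cone ?P")
  proof (rule cone_of_fractions[OF ev.ring_morphism_axioms])
    show "1 \<in> S" by (simp add: S_def)
    show "p + q \<in> S" if "p \<in> S" "q \<in> S" for p q
      using that keys_add[of p q] unfolding S_def by fastforce
    show "p * q \<in> S" if "p \<in> S" "q \<in> S" for p q
    proof -
      have "Poly_Mapping.keys m \<subseteq> {1..?n}" if m: "m \<in> Poly_Mapping.keys (p * q)" for m
      proof -
        obtain b c where bc: "m = b + c" "b \<in> Poly_Mapping.keys p" "c \<in> Poly_Mapping.keys q"
          using keys_mult[of p q] m by blast
        then have "Poly_Mapping.keys b \<subseteq> {1..?n}" "Poly_Mapping.keys c \<subseteq> {1..?n}"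
          using \<open>p \<in> S\<close> \<open>q \<in> S\<close> unfolding S_def by blast+
        then show ?thesis using keys_add[of b c] bc(1) by blast
      qed
      then show ?thesis using that by (simp add: S_def)
    qed
    show "qmpoly_eval p ?a \<noteq> 0" if "p \<in> S" for p
    proof
      assume "qmpoly_eval p ?a = 0"
      then have "p = 0"
        using that assms unfolding S_def is_seed_def alg_indep_tuple_def by blast
      then show False using that by (simp add: S_def)
    qed
  qed
  moreover have "?a i \<in> ?P" if i: "i \<in> vertices s" for i
  proof -
    let ?x = "Poly_Mapping.single (Poly_Mapping.single i 1) 1 :: qmpoly"
    have "\<epsilon> ?x = 1"
      by (simp add: \<epsilon>_def linear_extension_single[OF id])
    then have "?x \<in> S" using i by (simp add: S_def vertices_def)
    moreover have "1 \<in> S" by (simp add: S_def)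
    moreover have "qmpoly_eval ?x ?a = ?a i"
      by (simp add: qmpoly_eval_def ring_morphism.one[OF ring_morphism_ratfun_const])
    then have "?a i = qmpoly_eval ?x ?a / qmpoly_eval 1 ?a" by simp
    ultimately show ?thesis by blast
  qed
  ultimately show ?thesis
    using assms unfolding positive_seed_def is_seed_def by blast
qed

lemma finite_vertices: "finite (vertices s)"
  by (simp add: vertices_def)

text \<open>
  Fixing the irrelevant values of \<open>clus\<close> outside the vertices as 1 makes all entries elements of the
  cone.
\<close>

definition full_clus :: "seed \<Rightarrow> nat \<Rightarrow> ratfun"
  where "full_clus s i = (if i \<in> vertices s then clus s i else 1)"

lemma full_clus_vertex [simp]: "i \<in> vertices s \<Longrightarrow> full_clus s i = clus s i"
  by (simp add: full_clus_def)

lemma positive_seed_cone: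
  assumes "positive_seed s"
  obtains P where "cone P" "range (full_clus s) \<subseteq> P"
proof -
  obtain P where "cone P" "clus s ` vertices s \<subseteq> P"
    using assms by (auto simp: positive_seed_def)
  then show thesis by (intro that[of P]) (auto simp: full_clus_def cone_def)
qed

lemma skew_on_ice_quiver: "is_ice_quiver s \<Longrightarrow> skew_on (vertices s) (arr s)"
  unfolding is_ice_quiver_def skew_on_def
  by (elim conjE, intro conjI finite_vertices) assumption+

lemma positive_seed_skew: "positive_seed s \<Longrightarrow> skew_on (vertices s) (arr s)"
  by (simp add: positive_seed_def skew_on_ice_quiver)

lemma positive_seed_frozen: "positive_seed s \<Longrightarrow> frozen s \<subseteq> vertices s"
  by (simp add: positive_seed_def is_ice_quiver_def)

lemma mutables_vertices: "k \<in> mutables s \<Longrightarrow> k \<in> vertices s"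
  by (simp add: mutables_def)

lemma positive_seed_nonzero: "positive_seed s \<Longrightarrow> i \<in> vertices s \<Longrightarrow> clus s i \<noteq> 0"
  unfolding positive_seed_def cone_def by (metis image_subset_iff)

lemma mutate_simps [simp]:
  "vertices (mutate k s) = vertices s" "frozen (mutate k s) = frozen s"
  "mutables (mutate k s) = mutables s" "arr (mutate k s) = mutate_arr k (arr s)"
  "clus (mutate k s) = mutate_clus k s"
  by (simp_all add: mutate_def vertices_def mutables_def)

lemma exchange_clus:
  "exchange (vertices s) (arr s) k (full_clus s) =
   (\<Prod>j\<in>{j \<in> vertices s. arr s k j > 0}. clus s j ^ nat (arr s k j)) +
   (\<Prod>j\<in>{j \<in> vertices s. arr s k j < 0}. clus s j ^ nat (- arr s k j))"
  unfolding exchange_def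
  by (intro arg_cong2[of _ _ _ _ "(+)"] prod.mono_neutral_cong_right)
     (auto simp: finite_vertices intro: ccontr)

lemma full_clus_mutate:
  assumes "k \<in> vertices s"
  shows "full_clus (mutate k s) = mutate_at (vertices s) (arr s) k (full_clus s)"
  unfolding mutate_at_def exchange_clus using assms
  by (auto simp: full_clus_def mutate_clus_def fun_eq_iff divide_inverse)

lemma positive_seed_mutate:
  assumes s: "positive_seed s" and k: "k \<in> vertices s"
  shows "positive_seed (mutate k s)"
proof -
  have "skew_on (vertices s) (mutate_arr k (arr s))"
    by (rule mutate_arr_skew[OF positive_seed_skew[OF s]])
  then have "is_ice_quiver (mutate k s)"
    using positive_seed_frozen[OF s] unfolding is_ice_quiver_def skew_on_def mutate_simps
    by (elim conjE, intro conjI) assumption+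
  moreover obtain P where P: "cone P" "range (full_clus s) \<subseteq> P"
    by (rule positive_seed_cone[OF s])
  then have "range (full_clus (mutate k s)) \<subseteq> P"
    using cone_mutate_at full_clus_mutate[OF k] by metis
  then have "full_clus (mutate k s) i \<in> P" for i by auto
  then have "clus (mutate k s) ` vertices (mutate k s) \<subseteq> P"
    by (auto simp: full_clus_def simp del: mutate_simps(5) split: if_splits) metis
  ultimately show ?thesis
    using P(1) unfolding positive_seed_def by blast
qed

lemma mutate_involution:
  assumes s: "positive_seed s" and k: "k \<in> vertices s"
  shows "mutate k (mutate k s) = s"
proof -
  have "full_clus (mutate k (mutate k s)) = full_clus s"
  proof -
    obtain P where P: "cone P" "range (full_clus s) \<subseteq> P"
      by (rule positive_seed_cone[OF s])
    have "full_clus s k \<noteq> 0"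
      using positive_seed_nonzero[OF s k] k by simp
    moreover have "exchange (vertices s) (arr s) k (full_clus s) \<noteq> 0"
      using cone_exchange[OF P(1)] P unfolding cone_def by (metis range_subsetD)
    ultimately show ?thesis
      using mutate_at_involution[OF positive_seed_skew[OF s], of "full_clus s" k] k
      by (simp add: full_clus_mutate)
  qed
  then have "clus (mutate k (mutate k s)) i = clus s i" for i
  proof (cases "i = k")
    case True
    assume "full_clus (mutate k (mutate k s)) = full_clus s"
    from fun_cong[OF this, of k] show ?thesis using True k by (simp add: full_clus_def)
  next
    case False
    then show ?thesis by (simp add: mutate_clus_def)
  qed
  then have "clus (mutate k (mutate k s)) = clus s" by blast
  moreover have "arr (mutate k (mutate k s)) = arr s"
    by (simp add: mutate_arr_involution[OF positive_seed_skew[OF s]])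
  moreover have "mutate k (mutate k s) =
      s\<lparr>arr := arr (mutate k (mutate k s)), clus := clus (mutate k (mutate k s))\<rparr>"
    by (simp add: mutate_def)
  ultimately show ?thesis by simp
qed

lemma mut_equiv_refl: "mut_equiv s s"
  by (simp add: mut_equiv_def)

lemma mut_equiv_trans: "mut_equiv s t \<Longrightarrow> mut_equiv t u \<Longrightarrow> mut_equiv s u"
  unfolding mut_equiv_def by (rule rtranclp_trans)

lemma mut_equiv_step: "mut_equiv s t \<Longrightarrow> k \<in> mutables t \<Longrightarrow> mut_equiv s (mutate k t)"
  unfolding mut_equiv_def by (auto intro: rtranclp.rtrancl_into_rtrancl)

lemma mut_equiv_induct [consumes 1, case_names refl step]:
  assumes "mut_equiv s t" "Q s"
    "\<And>t k. mut_equiv s t \<Longrightarrow> Q t \<Longrightarrow> k \<in> mutables t \<Longrightarrow> Q (mutate k t)"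
  shows "Q t"
  using assms(1,2) unfolding mut_equiv_def
  by (induction rule: rtranclp_induct) (use assms(3) in \<open>auto simp: mut_equiv_def\<close>)

lemma mut_equiv_invariants:
  assumes "mut_equiv s t"
  shows "vertices t = vertices s" "frozen t = frozen s" "mutables t = mutables s"
    "i \<notin> mutables s \<Longrightarrow> clus t i = clus s i"
proof -
  have "vertices t = vertices s \<and> frozen t = frozen s \<and> mutables t = mutables s \<and>
      (\<forall>i. i \<notin> mutables s \<longrightarrow> clus t i = clus s i)"
    using assms by (induction rule: mut_equiv_induct) (auto simp: mutate_clus_def)
  then show "vertices t = vertices s" "frozen t = frozen s" "mutables t = mutables s"
    "i \<notin> mutables s \<Longrightarrow> clus t i = clus s i" by auto
qed

lemma mut_equiv_positive:
  assumes "mut_equiv s t" "positive_seed s"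
  shows "positive_seed t"
  using assms by (induction rule: mut_equiv_induct) (auto intro: positive_seed_mutate mutables_vertices)

lemma mut_equiv_sym:
  assumes "mut_equiv s t" "positive_seed s"
  shows "mut_equiv t s"
  using assms(1)
proof (induction rule: mut_equiv_induct)
  case (step t k)
  have "mut_equiv (mutate k t) (mutate k (mutate k t))"
    using step.hyps by (intro mut_equiv_step mut_equiv_refl) simp
  moreover have "mutate k (mutate k t) = t"
    using mut_equiv_positive[OF step.hyps(1) assms(2)] step.hyps(2) mutables_vertices
    by (intro mutate_involution)
  ultimately show ?case using step.IH mut_equiv_trans by metis
qed (rule mut_equiv_refl)

section \<open>Reachable elements\<close>

text \<open>
  The frozen part of the seed does not occur here: the path \<open>ks\<close> may mutate at any index.  So the set
  is invariant under freezing, and by \<open>reachable_mut_equiv\<close> also under mutation of positive seeds.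
\<close>

definition reachable :: "seed \<Rightarrow> ratfun set"
  where "reachable s = {mutate_along (vertices s) ks (arr s) (full_clus s) i | ks i. True}"

lemma freeze_simps [simp]:
  "vertices (freeze S s) = vertices s" "frozen (freeze S s) = frozen s \<union> S"
  "mutables (freeze S s) = mutables s - S" "arr (freeze S s) = arr s" "clus (freeze S s) = clus s"
  "full_clus (freeze S s) = full_clus s"
  by (auto simp: freeze_def vertices_def mutables_def full_clus_def fun_eq_iff)

lemma reachable_freeze [simp]: "reachable (freeze S s) = reachable s"
  by (simp add: reachable_def)

lemma reachable_mutate_subset:
  assumes "k \<in> vertices s"
  shows "reachable (mutate k s) \<subseteq> reachable s"
proof
  fix x assume "x \<in> reachable (mutate k s)"
  then obtain ks i where "x = mutate_along (vertices s) ks (mutate_arr k (arr s)) (full_clus (mutate k s)) i"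
    by (auto simp: reachable_def)
  then have "x = mutate_along (vertices s) (k # ks) (arr s) (full_clus s) i"
    by (simp add: full_clus_mutate[OF assms])
  then show "x \<in> reachable s" unfolding reachable_def by blast
qed

lemma reachable_mut_equiv_subset: "mut_equiv s t \<Longrightarrow> reachable t \<subseteq> reachable s"
  by (induction rule: mut_equiv_induct)
     (use reachable_mutate_subset mutables_vertices in blast)+

lemma reachable_mut_equiv:
  "mut_equiv s t \<Longrightarrow> positive_seed s \<Longrightarrow> reachable t = reachable s"
  using reachable_mut_equiv_subset[of s t] reachable_mut_equiv_subset[of t s] mut_equiv_sym[of s t]
  by (intro subset_antisym) simp_all

lemma clus_reachable: "i \<in> vertices s \<Longrightarrow> clus s i \<in> reachable s"
  unfolding reachable_def by (intro CollectI exI[of _ "[]"] exI[of _ i]) simp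

lemma cluster_variables_reachable: "cluster_variables s \<subseteq> reachable s"
proof
  fix x assume "x \<in> cluster_variables s"
  then obtain t i where t: "mut_equiv s t" and "i \<in> vertices t" "x = clus t i"
    by (auto simp: cluster_variables_def)
  then have "x \<in> reachable t" using clus_reachable by simp
  then show "x \<in> reachable s" using reachable_mut_equiv_subset[OF t] by blast
qed

section \<open>Cluster algebras and freezing\<close>

lemma subring_cluster_algebra: "subring_set (cluster_algebra s)"
  unfolding cluster_algebra_def by (rule subring_generate_ring)

lemma cluster_algebra_least:
  assumes "subring_set R" "cluster_variables s \<subseteq> R" "\<And>i. i \<in> frozen s \<Longrightarrow> inverse (clus s i) \<in> R"
  shows "cluster_algebra s \<subseteq> R"
  unfolding cluster_algebra_def using assms by (intro generate_ring_least) auto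

lemma cluster_variables_in_algebra: "cluster_variables s \<subseteq> cluster_algebra s"
  unfolding cluster_algebra_def using generate_ring_superset by blast

lemma inverse_frozen_in_algebra: "i \<in> frozen s \<Longrightarrow> inverse (clus s i) \<in> cluster_algebra s"
  unfolding cluster_algebra_def by (intro generate_ring.incl UnI2 imageI)

lemma clus_in_algebra:
  assumes "mut_equiv s t" "i \<in> vertices s"
  shows "clus t i \<in> cluster_algebra s"
proof -
  have "clus t i \<in> cluster_variables s"
    using assms mut_equiv_invariants(1)[OF assms(1)] by (auto simp: cluster_variables_def)
  then show ?thesis using cluster_variables_in_algebra by blast
qed

lemma cluster_variables_mut_equiv_subset:
  "mut_equiv s t \<Longrightarrow> cluster_variables t \<subseteq> cluster_variables s"
  unfolding cluster_variables_def using mut_equiv_trans by blast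

lemma cluster_algebra_mut_equiv_subset:
  assumes "mut_equiv s t"
  shows "cluster_algebra t \<subseteq> cluster_algebra s"
proof (rule cluster_algebra_least[OF subring_cluster_algebra])
  show "cluster_variables t \<subseteq> cluster_algebra s"
    using cluster_variables_mut_equiv_subset[OF assms] cluster_variables_in_algebra by blast
  fix i assume "i \<in> frozen t"
  then have "i \<in> frozen s" "i \<notin> mutables s"
    using mut_equiv_invariants[OF assms] by (auto simp: mutables_def)
  then show "inverse (clus t i) \<in> cluster_algebra s"
    using inverse_frozen_in_algebra mut_equiv_invariants(4)[OF assms] by metis
qed

lemma cluster_algebra_mut_equiv:
  "mut_equiv s t \<Longrightarrow> positive_seed s \<Longrightarrow> cluster_algebra t = cluster_algebra s"
  using cluster_algebra_mut_equiv_subset[of s t] cluster_algebra_mut_equiv_subset[of t s] mut_equiv_sym[of s t]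
  by (intro subset_antisym) simp_all

lemma mutate_freeze: "mutate k (freeze S s) = freeze S (mutate k s)"
  by (simp add: mutate_def freeze_def mutate_clus_def vertices_def fun_eq_iff)

text \<open>
  The seeds of a freezing are seeds of the original algebra, with more vertices frozen.
\<close>

lemma mut_equiv_freeze:
  assumes "mut_equiv (freeze S s) t"
  shows "\<exists>u. mut_equiv s u \<and> t = freeze S u"
  using assms
proof (induction rule: mut_equiv_induct)
  case refl
  then show ?case using mut_equiv_refl by blast
next
  case (step t k)
  then obtain u where "mut_equiv s u" "t = freeze S u" by blast
  then show ?case
    using step.hyps(2) mut_equiv_step[of s u k] by (auto simp: mutate_freeze)
qed

lemma freeze_freeze: "freeze S (freeze S' s) = freeze (S' \<union> S) s"
  by (simp add: freeze_def Un_assoc)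

lemma freeze_empty: "freeze {} s = s"
  by (simp add: freeze_def)

lemma positive_seed_freeze:
  assumes "positive_seed s" "S \<subseteq> vertices s"
  shows "positive_seed (freeze S s)"
  using assms unfolding positive_seed_def is_ice_quiver_def freeze_simps
  by (elim conjE, intro conjI Un_least) assumption+

lemma cluster_variables_freeze: "cluster_variables (freeze S s) \<subseteq> cluster_variables s"
proof
  fix x assume "x \<in> cluster_variables (freeze S s)"
  then obtain t i where "mut_equiv (freeze S s) t" "x = clus t i" "i \<in> vertices t"
    by (auto simp: cluster_variables_def)
  moreover then obtain u where "mut_equiv s u" "t = freeze S u"
    using mut_equiv_freeze by blast
  ultimately show "x \<in> cluster_variables s"
    by (auto simp: cluster_variables_def)
qed

text \<open>
  A freezing is a cluster localization as soon as it contains the reachable elements: these include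
  the cluster variables of \<open>s\<close>.
\<close>

lemma cluster_algebra_freeze:
  assumes "k \<in> vertices s" "reachable s \<subseteq> cluster_algebra (freeze {k} s)"
  shows "cluster_algebra (freeze {k} s) =
    generate_ring RF (cluster_algebra s \<union> {inverse (clus s k)})" (is "?A = ?B")
proof
  show "?A \<subseteq> ?B"
  proof (rule cluster_algebra_least[OF subring_generate_ring])
    show "cluster_variables (freeze {k} s) \<subseteq> ?B"
      using cluster_variables_freeze cluster_variables_in_algebra generate_ring_superset by blast
    show "inverse (clus (freeze {k} s) i) \<in> ?B" if "i \<in> frozen (freeze {k} s)" for i
      using that inverse_frozen_in_algebra[of i s]
        generate_ring_superset[of "cluster_algebra s \<union> {inverse (clus s k)}"] by auto
  qed
  show "?B \<subseteq> ?A"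
  proof (rule generate_ring_least[OF subring_cluster_algebra])
    have "cluster_algebra s \<subseteq> ?A"
    proof (rule cluster_algebra_least[OF subring_cluster_algebra])
      show "cluster_variables s \<subseteq> ?A"
        using cluster_variables_reachable assms(2) by blast
      show "inverse (clus s i) \<in> ?A" if "i \<in> frozen s" for i
        using inverse_frozen_in_algebra[of i "freeze {k} s"] that by simp
    qed
    moreover have "inverse (clus s k) \<in> ?A"
      using inverse_frozen_in_algebra[of k "freeze {k} s"] by simp
    ultimately show "cluster_algebra s \<union> {inverse (clus s k)} \<subseteq> ?A" by blast
  qed
qed

section \<open>Comaximal elements\<close>

definition comaximal :: "'r::comm_ring_1 set \<Rightarrow> 'r \<Rightarrow> 'r \<Rightarrow> bool"
  where "comaximal R x y \<longleftrightarrow> (\<exists>p\<in>R. \<exists>q\<in>R. p * x + q * y = 1)"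

context
  fixes R :: "'r::comm_ring_1 set"
  assumes R: "subring_set R"
begin

lemma comaximal_sym: "comaximal R x y \<Longrightarrow> comaximal R y x"
  unfolding comaximal_def by (metis add.commute)

lemma comaximal_mult:
  assumes "x \<in> R" "y \<in> R" "comaximal R x y" "comaximal R x z"
  shows "comaximal R x (y * z)"
proof -
  obtain p q p' q' where pq: "p \<in> R" "q \<in> R" "p * x + q * y = 1"
    and pq': "p' \<in> R" "q' \<in> R" "p' * x + q' * z = 1"
    using assms(3,4) by (auto simp: comaximal_def)
  have "(p + q * y * p') * x + (q * q') * (y * z) = p * x + q * y * (p' * x + q' * z)"
    by (simp add: algebra_simps)
  also have "\<dots> = 1"
    using pq(3) pq'(3) by simp
  finally have "(p + q * y * p') * x + (q * q') * (y * z) = 1" .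
  moreover have "p + q * y * p' \<in> R" "q * q' \<in> R"
    using pq(1,2) pq'(1,2) assms(2) by (simp_all add: subring_set_add[OF R] subring_set_mult[OF R])
  ultimately show ?thesis
    unfolding comaximal_def by blast
qed

lemma comaximal_one: "comaximal R x 1"
  unfolding comaximal_def using subring_set_zero[OF R] subring_set_one[OF R] by force

lemma comaximal_power:
  assumes "x \<in> R" "y \<in> R" "comaximal R x y"
  shows "comaximal R x (y ^ n)"
  by (induction n) (use assms comaximal_one in \<open>auto intro: comaximal_mult\<close>)

lemma comaximal_prod:
  assumes "x \<in> R" "\<And>i. i \<in> S \<Longrightarrow> f i \<in> R" "\<And>i. i \<in> S \<Longrightarrow> comaximal R x (f i)"
  shows "comaximal R x (\<Prod>i\<in>S. f i)"
  using assms(2,3)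
  by (induction S rule: infinite_finite_induct)
     (auto intro: comaximal_mult comaximal_one assms(1))

lemma comaximal_unit:
  assumes "z \<in> R" "z * y = 1"
  shows "comaximal R x y"
  unfolding comaximal_def using subring_set_zero[OF R] assms by force

end

lemma generate_ring_inverse_clear:
  assumes R: "subring_set R" and a: "a \<in> R" "a \<noteq> 0"
    and x: "x \<in> generate_ring RF (R \<union> {inverse a})"
  shows "\<exists>n. a ^ n * x \<in> R"
proof -
  let ?L = "{x. \<exists>n. a ^ n * x \<in> R}"
  have up: "a ^ (m + n) * x \<in> R" if "a ^ n * x \<in> R" for m n x
  proof -
    have "a ^ (m + n) * x = a ^ m * (a ^ n * x)" by (simp add: power_add mult.assoc)
    then show ?thesis
      using subring_set_mult[OF R subring_set_power[OF R a(1), of m] that] by (simp only:)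
  qed
  have "subring_set ?L"
  proof (rule subring_setI)
    show "1 \<in> ?L"
      by (rule CollectI, rule exI[of _ 0]) (simp add: subring_set_one[OF R])
    show "- x \<in> ?L" if "x \<in> ?L" for x
      using that subring_set_uminus[OF R] by fastforce
    fix x y assume "x \<in> ?L" "y \<in> ?L"
    then obtain m n where mn: "a ^ m * x \<in> R" "a ^ n * y \<in> R" by blast
    have "a ^ (m + n) * (x + y) = a ^ (n + m) * x + a ^ (m + n) * y"
      by (simp add: algebra_simps)
    also have "\<dots> \<in> R" by (intro subring_set_add[OF R] up mn)
    finally show "x + y \<in> ?L" by blast
    have "a ^ (m + n) * (x * y) = (a ^ m * x) * (a ^ n * y)"
      by (simp add: power_add mult_ac)
    also have "\<dots> \<in> R" by (intro subring_set_mult[OF R] mn)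
    finally show "x * y \<in> ?L" by blast
  qed
  moreover have "R \<union> {inverse a} \<subseteq> ?L"
  proof -
    have "\<exists>n. a ^ n * x \<in> R" if "x \<in> R" for x
      by (rule exI[of _ 0]) (simp add: that)
    moreover have "\<exists>n. a ^ n * inverse a \<in> R"
      by (rule exI[of _ 1]) (simp add: a subring_set_one[OF R])
    ultimately show ?thesis by blast
  qed
  ultimately have "generate_ring RF (R \<union> {inverse a}) \<subseteq> ?L"
    by (rule generate_ring_least)
  with x show ?thesis by blast
qed

lemma comaximal_localizations:
  assumes R: "subring_set R" and a: "a \<in> R" "a \<noteq> 0" and b: "b \<in> R" "b \<noteq> 0"
    and ab: "comaximal R a b"
    and x: "x \<in> generate_ring RF (R \<union> {inverse a})" "x \<in> generate_ring RF (R \<union> {inverse b})"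
  shows "x \<in> R"
proof -
  obtain m n where mn: "a ^ m * x \<in> R" "b ^ n * x \<in> R"
    using generate_ring_inverse_clear[OF R a x(1)] generate_ring_inverse_clear[OF R b x(2)] by blast
  have "comaximal R a (b ^ n)"
    by (rule comaximal_power[OF R a(1) b(1) ab])
  then have "comaximal R (b ^ n) a"
    by (rule comaximal_sym[OF R])
  then have "comaximal R (b ^ n) (a ^ m)"
    by (rule comaximal_power[OF R subring_set_power[OF R b(1)] a(1)])
  then obtain p q where pq: "p \<in> R" "q \<in> R" "p * b ^ n + q * a ^ m = 1"
    by (auto simp: comaximal_def)
  have "x = (p * b ^ n + q * a ^ m) * x"
    using pq(3) by simp
  also have "\<dots> = p * (b ^ n * x) + q * (a ^ m * x)"
    by (simp add: algebra_simps)
  also have "\<dots> \<in> R"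
    using subring_set_add[OF R subring_set_mult[OF R pq(1) mn(2)] subring_set_mult[OF R pq(2) mn(1)]] .
  finally show ?thesis .
qed

section \<open>Covering pairs\<close>

text \<open>
  The pairs are ordered such that membership in the accessible part means that no infinite path starts
  at the vertex.  For the converse relation it means that no infinite path ends there.
\<close>

definition successors :: "nat set \<Rightarrow> (nat \<Rightarrow> nat \<Rightarrow> int) \<Rightarrow> (nat \<times> nat) set"
  where "successors M B = {(w, v). v \<in> M \<and> w \<in> M \<and> 0 < B v w}"

lemma infinite_chain_if_not_acc:
  assumes "x \<notin> Wellfounded.acc r"
  shows "\<exists>f. f 0 = x \<and> (\<forall>n :: nat. (f (Suc n), f n) \<in> r)"
proof -
  have step: "\<exists>y. y \<notin> Wellfounded.acc r \<and> (y, x) \<in> r" if "x \<notin> Wellfounded.acc r" for x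
  proof (rule ccontr)
    assume "\<nexists>y. y \<notin> Wellfounded.acc r \<and> (y, x) \<in> r"
    then have "x \<in> Wellfounded.acc r" by (auto intro: acc.intros)
    then show False using that by blast
  qed
  let ?Q = "\<lambda>n :: nat. \<lambda>y. y \<notin> Wellfounded.acc r \<and> (n = 0 \<longrightarrow> y = x)"
  have "\<exists>f. \<forall>n. ?Q n (f n) \<and> (f (Suc n), f n) \<in> r"
  proof (rule dependent_nat_choice)
    show "\<exists>y. ?Q 0 y" using assms by blast
    show "\<exists>z. ?Q (Suc n) z \<and> (z, y) \<in> r" if "?Q n y" for y n
      using step that by blast
  qed
  then show ?thesis by blast
qed

text \<open>
  The exchange relation at \<open>v\<close> equates a multiple of \<open>a v\<close> with the sum of a multiple of \<open>a u\<close> and the product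
  over the successors of \<open>v\<close>.  By induction mutable successors are units modulo \<open>a v\<close>, and frozen
  successors are units in \<open>R\<close>, so \<open>a u\<close> is a unit modulo \<open>a v\<close>.
\<close>

lemma comaximal_along_arrow:
  fixes a :: "nat \<Rightarrow> 'k::field"
  assumes R: "subring_set R" and skew: "skew_on V B" and M: "M \<subseteq> V"
    and a: "\<And>i. i \<in> V \<Longrightarrow> a i \<in> R"
    and frozen: "\<And>i. i \<in> V - M \<Longrightarrow> a i \<noteq> 0 \<and> inverse (a i) \<in> R"
    and exch: "\<And>k. k \<in> M \<Longrightarrow> \<exists>c\<in>R. c * a k = exchange V B k a"
    and v: "v \<in> Wellfounded.acc (successors M B)"
    and arrow: "u \<in> M" "v \<in> M" "0 < B u v"
  shows "comaximal R (a u) (a v)"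
  using v arrow
proof (induction v arbitrary: u rule: acc.induct)
  case (accI v)
  have finV: "finite V" by (rule skew_onD(1)[OF skew])
  have uV: "u \<in> V" and vV: "v \<in> V" using accI.prems M by auto
  obtain c where c: "c \<in> R" "c * a v = exchange V B v a"
    using exch accI.prems(2) by blast
  let ?p = "\<Prod>i\<in>V. a i ^ nat (B v i)" and ?q = "\<Prod>i\<in>V - {u}. a i ^ nat (- B v i)"
  have "comaximal R (a v) ?p"
  proof (rule comaximal_prod[OF R])
    fix w assume w: "w \<in> V"
    show "a w ^ nat (B v w) \<in> R" using w a subring_set_power[OF R] by blast
    show "comaximal R (a v) (a w ^ nat (B v w))"
    proof (cases "0 < B v w")
      case True
      have "comaximal R (a v) (a w)"
      proof (cases "w \<in> M")
        case wM: True
        then have "(w, v) \<in> successors M B"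
          using accI.prems True by (simp add: successors_def)
        then show ?thesis using accI.IH[of w v] accI.prems wM True by blast
      next
        case False
        then show ?thesis
          using frozen[of w] w by (intro comaximal_unit[OF R, of "inverse (a w)"]) auto
      qed
      then show ?thesis using comaximal_power[OF R] a vV w by blast
    next
      case False
      then show ?thesis using comaximal_one[OF R] by simp
    qed
  qed (use a vV in blast)
  then obtain s t where st: "s \<in> R" "t \<in> R" "s * a v + t * ?p = 1"
    by (auto simp: comaximal_def)
  have q: "?q \<in> R"
    using a by (intro subring_set_prod[OF R] subring_set_power[OF R]) auto
  have "0 < nat (- B v u)"
    using skew_onD(2)[OF skew, of v u] accI.prems(3) by simp
  then obtain n where n: "nat (- B v u) = Suc n" by (cases "nat (- B v u)") auto
  have "(\<Prod>i\<in>V. a i ^ nat (- B v i)) = a u * (a u ^ n * ?q)"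
    using uV finV n by (simp add: prod.remove mult.assoc)
  then have "?p = c * a v - a u * (a u ^ n * ?q)"
    using c(2) by (simp add: exchange_def)
  then have p: "c * a v - a u * (a u ^ n * ?q) = ?p" ..
  have "(- (t * (a u ^ n * ?q))) * a u + (s + t * c) * a v =
      s * a v + t * (c * a v - a u * (a u ^ n * ?q))"
    by (simp add: algebra_simps)
  also have "\<dots> = 1" unfolding p by (rule st)
  finally have "(- (t * (a u ^ n * ?q))) * a u + (s + t * c) * a v = 1" .
  moreover have "- (t * (a u ^ n * ?q)) \<in> R" "s + t * c \<in> R"
    using st c(1) q a[OF uV]
    by (auto intro!: subring_set_uminus[OF R] subring_set_mult[OF R] subring_set_add[OF R]
        subring_set_power[OF R])
  ultimately show ?case
    unfolding comaximal_def by blast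
qed

text \<open>
  An infinite path into \<open>i\<close>, the arrow from \<open>i\<close> to \<open>j\<close> and an infinite path out of \<open>j\<close> would combine to
  a bi-infinite path.
\<close>

lemma covering_pair_acc:
  assumes "covering_pair Q i j"
  shows "j \<in> Wellfounded.acc (successors (mutables Q) (arr Q)) \<or>
    i \<in> Wellfounded.acc ((successors (mutables Q) (arr Q))\<inverse>)"
proof (rule ccontr)
  assume "\<not> ?thesis"
  then obtain f g where f: "f 0 = j" "\<And>n :: nat. (f (Suc n), f n) \<in> successors (mutables Q) (arr Q)"
    and g: "g 0 = i" "\<And>n :: nat. (g (Suc n), g n) \<in> (successors (mutables Q) (arr Q))\<inverse>"
    using infinite_chain_if_not_acc by metis
  \<comment> \<open>The values at 1 and 2 are \<open>i\<close> and \<open>j\<close>.\<close>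
  define p where "p k = (if k \<le> 1 then g (nat (1 - k)) else f (nat (k - 2)))" for k :: int
  have "p k \<in> mutables Q" for k
    using f(2)[of "nat (k - 2)"] g(2)[of "nat (1 - k)"] by (auto simp: p_def successors_def)
  moreover have "0 < arr Q (p k) (p (k + 1))" for k
  proof -
    consider "k \<le> 0" | "k = 1" | "2 \<le> k" by linarith
    then show ?thesis
    proof cases
      case 1
      then have "nat (1 - k) = Suc (nat (- k))" by simp
      then show ?thesis using 1 g(2)[of "nat (- k)"] by (simp add: p_def successors_def)
    next
      case 2
      then show ?thesis
        using assms f(1) g(1) by (simp add: p_def covering_pair_def)
    next
      case 3
      then have "nat (k + 1 - 2) = Suc (nat (k - 2))" by simp
      then show ?thesis using 3 f(2)[of "nat (k - 2)"] by (simp add: p_def successors_def)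
    qed
  qed
  ultimately have "bi_infinite_path Q p" by (simp add: bi_infinite_path_def)
  moreover have "p 1 = i" "p 2 = j" using f g by (simp_all add: p_def)
  ultimately show False using assms unfolding covering_pair_def by blast
qed

lemma exchange_relation:
  assumes s: "positive_seed s" and k: "k \<in> mutables s"
  shows "clus (mutate k s) k * clus s k = exchange (vertices s) (arr s) k (full_clus s)"
    "clus (mutate k s) k \<in> cluster_algebra s"
proof -
  have kV: "k \<in> vertices s" by (rule mutables_vertices[OF k])
  have "full_clus (mutate k s) k = exchange (vertices s) (arr s) k (full_clus s) / clus s k"
    using full_clus_mutate[OF kV] kV by (simp add: mutate_at_def)
  then show "clus (mutate k s) k * clus s k = exchange (vertices s) (arr s) k (full_clus s)"
    using positive_seed_nonzero[OF s kV] kV by (simp add: full_clus_def)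
  show "clus (mutate k s) k \<in> cluster_algebra s"
    by (rule clus_in_algebra[OF mut_equiv_step[OF mut_equiv_refl k] kV])
qed

lemma covering_pair_comaximal:
  assumes s: "positive_seed s" and cp: "covering_pair s i j"
  shows "comaximal (cluster_algebra s) (clus s i) (clus s j)"
proof -
  let ?A = "cluster_algebra s" and ?V = "vertices s" and ?M = "mutables s" and ?a = "full_clus s"
  note A = subring_cluster_algebra[of s]
  have ij: "i \<in> ?M" "j \<in> ?M" "0 < arr s i j" using cp by (auto simp: covering_pair_def)
  have skew: "skew_on ?V (arr s)" by (rule positive_seed_skew[OF s])
  have skew': "skew_on ?V (\<lambda>i j. - arr s i j)"
    using skew_onD[OF skew] by (intro skew_onI) (auto simp flip: skew_onD(2)[OF skew])
  have M: "?M \<subseteq> ?V" by (auto simp: mutables_def)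
  have a: "?a l \<in> ?A" if "l \<in> ?V" for l
    using clus_in_algebra[OF mut_equiv_refl that] that by simp
  have frozen: "?a l \<noteq> 0 \<and> inverse (?a l) \<in> ?A" if "l \<in> ?V - ?M" for l
    using that positive_seed_nonzero[OF s] inverse_frozen_in_algebra[of l s]
    by (auto simp: mutables_def)
  have exch: "\<exists>c\<in>?A. c * ?a k = exchange ?V (arr s) k ?a" if "k \<in> ?M" for k
    using exchange_relation[OF s that] mutables_vertices[OF that] by (intro bexI) auto
  have "comaximal ?A (?a i) (?a j)"
  proof (cases "j \<in> Wellfounded.acc (successors ?M (arr s))")
    case True
    show ?thesis
      by (rule comaximal_along_arrow[OF A skew M]) (use a frozen exch True ij in auto)
  next
    case False
    then have "i \<in> Wellfounded.acc ((successors ?M (arr s))\<inverse>)"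
      using covering_pair_acc[OF cp] by blast
    moreover have "(w, v) \<in> (successors ?M (arr s))\<inverse> \<longleftrightarrow> (w, v) \<in> successors ?M (\<lambda>i j. - arr s i j)"
      for w v
      using skew_onD(2)[OF skew, of w v] by (auto simp: successors_def)
    then have "(successors ?M (arr s))\<inverse> = successors ?M (\<lambda>i j. - arr s i j)"
      by auto
    ultimately have acc: "i \<in> Wellfounded.acc (successors ?M (\<lambda>i j. - arr s i j))" by simp
    have "0 < - arr s j i"
      using ij(3) skew_onD(2)[OF skew, of i j] by simp
    then have "comaximal ?A (?a j) (?a i)"
      by (intro comaximal_along_arrow[OF A skew' M])
         (use a frozen exch acc ij in \<open>auto simp: exchange_reverse\<close>)
    then show ?thesis by (rule comaximal_sym[OF A])
  qed
  then show ?thesis using ij(1,2)[THEN mutables_vertices] by simp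
qed

section \<open>Reachable elements of locally acyclic seeds\<close>

lemma reachable_covering_pair:
  assumes s: "positive_seed s" and cp: "covering_pair s i j"
    and i: "reachable s \<subseteq> cluster_algebra (freeze {i} s)"
    and j: "reachable s \<subseteq> cluster_algebra (freeze {j} s)"
  shows "reachable s \<subseteq> cluster_algebra s"
proof
  fix x assume "x \<in> reachable s"
  have ij: "i \<in> vertices s" "j \<in> vertices s"
    using cp mutables_vertices by (auto simp: covering_pair_def)
  have "x \<in> generate_ring RF (cluster_algebra s \<union> {inverse (clus s i)})"
    using \<open>x \<in> reachable s\<close> i cluster_algebra_freeze[OF ij(1) i] by blast
  moreover have "x \<in> generate_ring RF (cluster_algebra s \<union> {inverse (clus s j)})"
    using \<open>x \<in> reachable s\<close> j cluster_algebra_freeze[OF ij(2) j] by blast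
  moreover note in_A = ij[THEN clus_in_algebra[OF mut_equiv_refl]]
    and nonzero = ij[THEN positive_seed_nonzero[OF s]]
  ultimately show "x \<in> cluster_algebra s"
    by (intro comaximal_localizations[OF subring_cluster_algebra in_A(1) nonzero(1) in_A(2) nonzero(2)
        covering_pair_comaximal[OF s cp]])
qed

text \<open>
  In a finite quiver a bi-infinite path repeats a vertex and hence contains a directed cycle.
\<close>

lemma acyclic_covering_pair:
  assumes "acyclic_seed s" "i \<in> mutables s" "j \<in> mutables s" "0 < arr s i j"
  shows "covering_pair s i j"
proof -
  have "\<not> bi_infinite_path s p" for p
  proof
    assume p: "bi_infinite_path s p"
    let ?r = "{(i, j). i \<in> mutables s \<and> j \<in> mutables s \<and> arr s i j > 0}"
    have step: "(p k, p (k + 1)) \<in> ?r" for k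
      using p by (simp add: bi_infinite_path_def)
    have path: "(p k, p (k + 1 + int n)) \<in> ?r\<^sup>+" for k n
    proof (induction n)
      case 0
      then show ?case using step[of k] by (simp add: r_into_trancl)
    next
      case (Suc n)
      then show ?case
        using step[of "k + 1 + int n"] by (auto intro: trancl_into_trancl simp: algebra_simps)
    qed
    have "range p \<subseteq> mutables s" using p by (auto simp: bi_infinite_path_def)
    moreover have "finite (mutables s)" using finite_vertices[of s] by (simp add: mutables_def)
    ultimately have "finite (range p)" by (rule finite_subset)
    then have "\<not> inj p" using finite_imageD[of p UNIV] infinite_UNIV_int by blast
    then obtain k l where "k \<noteq> l" "p k = p l"
      unfolding inj_def by blast
    then have "k < l \<or> l < k" "p l = p k" by auto
    with \<open>p k = p l\<close> obtain k l where "k < l" "p k = p l" by blast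
    then have "(p k, p k) \<in> ?r\<^sup>+"
      using path[of k "nat (l - k - 1)"] by simp
    moreover have "\<forall>x. (x, x) \<notin> ?r\<^sup>+"
      using assms(1) unfolding acyclic_seed_def acyclic_def .
    ultimately show False by simp
  qed
  then show ?thesis using assms by (auto simp: covering_pair_def)
qed

lemma reachable_isolated:
  assumes s: "positive_seed s"
    and isolated: "\<And>k l. k \<in> mutables s \<Longrightarrow> l \<in> mutables s \<Longrightarrow> arr s k l = 0"
  shows "reachable s \<subseteq> cluster_algebra s"
proof
  fix x assume "x \<in> reachable s"
  then obtain ks l where x: "x = mutate_along (vertices s) ks (arr s) (full_clus s) l"
    by (auto simp: reachable_def)
  obtain P where P: "cone P" "range (full_clus s) \<subseteq> P"
    by (rule positive_seed_cone[OF s])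
  interpret isolated_vertices "mutables s" "vertices s" "arr s"
    by unfold_locales (use positive_seed_skew[OF s] isolated in \<open>auto simp: mutables_def\<close>)
  note A = subring_cluster_algebra[of s]
  show "x \<in> cluster_algebra s"
    unfolding x
  proof (rule cluster_variable_in_subring[OF P A])
    show "full_clus s i \<in> cluster_algebra s" for i
      using clus_in_algebra[OF mut_equiv_refl, of i s] subring_set_one[OF A]
      by (simp add: full_clus_def)
    show "inverse (full_clus s i) \<in> cluster_algebra s" if "i \<notin> mutables s" for i
      using that inverse_frozen_in_algebra[of i s] subring_set_one[OF A]
      by (auto simp: full_clus_def mutables_def)
    show "exchange (vertices s) (arr s) k (full_clus s) / full_clus s k \<in> cluster_algebra s"
      if "k \<in> mutables s" for k
    proof -
      have "k \<in> vertices s" by (rule mutables_vertices[OF that])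
      then have "exchange (vertices s) (arr s) k (full_clus s) / full_clus s k = clus (mutate k s) k"
        using exchange_relation(1)[OF s that] positive_seed_nonzero[OF s, of k]
        by (simp add: divide_eq_eq)
      then show ?thesis using exchange_relation(2)[OF s that] by simp
    qed
  qed
qed

text \<open>
  Freezing either end of an arrow between mutable vertices keeps the seed acyclic and leaves fewer
  mutable vertices, until no such arrow is left.
\<close>

lemma reachable_acyclic:
  assumes "positive_seed s" "acyclic_seed s"
  shows "reachable s \<subseteq> cluster_algebra s"
  using assms
proof (induction "card (mutables s)" arbitrary: s rule: less_induct)
  case less
  show ?case
  proof (cases "\<exists>i\<in>mutables s. \<exists>j\<in>mutables s. 0 < arr s i j")
    case True
    then obtain i j where ij: "i \<in> mutables s" "j \<in> mutables s" "0 < arr s i j" by blast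
    have "reachable s \<subseteq> cluster_algebra (freeze {k} s)" if k: "k \<in> mutables s" for k
    proof -
      have "finite (mutables s)" using finite_vertices[of s] by (simp add: mutables_def)
      then have "card (mutables (freeze {k} s)) < card (mutables s)"
        using k by (intro psubset_card_mono) auto
      moreover have "positive_seed (freeze {k} s)"
        using less.prems(1) mutables_vertices[OF k] by (intro positive_seed_freeze) auto
      moreover have "acyclic_seed (freeze {k} s)"
        using less.prems(2) unfolding acyclic_seed_def by (rule acyclic_subset) auto
      ultimately show ?thesis using less.hyps by fastforce
    qed
    then show ?thesis
      using reachable_covering_pair[OF less.prems(1) acyclic_covering_pair[OF less.prems(2) ij]] ij
      by blast
  next
    case False
    have "arr s k l = 0" if "k \<in> mutables s" "l \<in> mutables s" for k l
    proof -
      have "\<not> 0 < arr s k l" "\<not> 0 < arr s l k" using False that by blast+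
      then show ?thesis
        using skew_onD(2)[OF positive_seed_skew[OF less.prems(1)], of k l] by simp
    qed
    then show ?thesis by (rule reachable_isolated[OF less.prems(1)])
  qed
qed

section \<open>Prime spectra\<close>

lemma Spec_iff:
  assumes A: "subring_set A"
  shows "P \<in> Spec A \<longleftrightarrow> P \<subseteq> A \<and> 0 \<in> P \<and> 1 \<notin> P \<and>
    (\<forall>x\<in>P. \<forall>y\<in>P. x + y \<in> P) \<and> (\<forall>x\<in>A. \<forall>y\<in>P. x * y \<in> P) \<and>
    (\<forall>x\<in>A. \<forall>y\<in>A. x * y \<in> P \<longrightarrow> x \<in> P \<or> y \<in> P)" (is "_ \<longleftrightarrow> ?prime")
proof -
  let ?R = "RF\<lparr>carrier := A\<rparr>"
  interpret RF: cring RF by (rule cring_from_type_algebra)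
  have "subring A RF"
    using A unfolding subring_set_def by (intro RF.subringI) (auto simp: RF_a_inv)
  then have "subcring A RF" by (rule RF.subcringI')
  then have cring: "cring ?R" using RF.subcring_iff[of A] by simp
  then interpret R: cring ?R .
  show ?thesis
  proof
    assume "P \<in> Spec A"
    then interpret primeideal P ?R by (simp add: Spec_def)
    show ?prime
    proof (intro conjI ballI impI)
      show "P \<subseteq> A" using a_subset by simp
      show "0 \<in> P" using zero_closed by simp
      show "1 \<notin> P" using one_imp_carrier I_notcarr by auto
      show "x + y \<in> P" if "x \<in> P" "y \<in> P" for x y
        using a_closed[OF that] by simp
      show "x * y \<in> P" if "x \<in> A" "y \<in> P" for x y
        using I_l_closed[of y x] that by simp
      show "x \<in> P \<or> y \<in> P" if "x \<in> A" "y \<in> A" "x * y \<in> P" for x y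
        using I_prime[of x y] that by simp
    qed
  next
    assume P: ?prime
    have "- x \<in> P" if "x \<in> P" for x
      using P that subring_set_uminus[OF A subring_set_one[OF A]] by force
    then have "subgroup P (add_monoid ?R)"
    proof -
      assume neg: "\<And>x. x \<in> P \<Longrightarrow> - x \<in> P"
      have "\<ominus>\<^bsub>?R\<^esub> x = - x" if "x \<in> P" for x
      proof -
        have "x \<in> A" "- x \<in> A" using P neg that by blast+
        then show ?thesis using R.minus_equality[of "- x" x] by simp
      qed
      then show ?thesis
        using P neg by (intro R.add.subgroupI) auto
    qed
    then have "ideal P ?R"
    proof (intro idealI R.ring_axioms)
      show "x \<otimes>\<^bsub>?R\<^esub> y \<in> P" if "y \<in> P" "x \<in> carrier ?R" for x y
        using P that by simp
      show "y \<otimes>\<^bsub>?R\<^esub> x \<in> P" if "y \<in> P" "x \<in> carrier ?R" for x y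
        using P that by (simp add: mult.commute[of y x])
    qed
    then have "primeideal P ?R"
    proof (rule primeidealI[OF _ cring])
      show "carrier ?R \<noteq> P" using P subring_set_one[OF A] by auto
    qed (use P in auto)
    then show "P \<in> Spec A" by (simp add: Spec_def)
  qed
qed

lemma SpecD:
  assumes "subring_set A" "P \<in> Spec A"
  shows "P \<subseteq> A" "0 \<in> P" "1 \<notin> P" "x \<in> P \<Longrightarrow> y \<in> P \<Longrightarrow> x + y \<in> P"
    "x \<in> A \<Longrightarrow> y \<in> P \<Longrightarrow> x * y \<in> P"
    "x \<in> A \<Longrightarrow> y \<in> A \<Longrightarrow> x * y \<in> P \<Longrightarrow> x \<in> P \<or> y \<in> P"
proof -
  note P = assms(2)[unfolded Spec_iff[OF assms(1)]]
  from P show "P \<subseteq> A" "0 \<in> P" "1 \<notin> P" by simp_all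
  from P have "\<forall>x\<in>P. \<forall>y\<in>P. x + y \<in> P" by (elim conjE) assumption
  then show "x \<in> P \<Longrightarrow> y \<in> P \<Longrightarrow> x + y \<in> P" by blast
  from P have "\<forall>x\<in>A. \<forall>y\<in>P. x * y \<in> P" by (elim conjE) assumption
  then show "x \<in> A \<Longrightarrow> y \<in> P \<Longrightarrow> x * y \<in> P" by blast
  from P have "\<forall>x\<in>A. \<forall>y\<in>A. x * y \<in> P \<longrightarrow> x \<in> P \<or> y \<in> P" by (elim conjE) assumption
  then show "x \<in> A \<Longrightarrow> y \<in> A \<Longrightarrow> x * y \<in> P \<Longrightarrow> x \<in> P \<or> y \<in> P" by blast
qed

lemma Spec_restrict:
  assumes A: "subring_set A" and B: "subring_set B" and AB: "A \<subseteq> B" and P: "P \<in> Spec B"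
  shows "P \<inter> A \<in> Spec A"
proof -
  note P' = SpecD[OF B P]
  show ?thesis
    unfolding Spec_iff[OF A]
  proof (intro conjI ballI impI)
    show "x + y \<in> P \<inter> A" if "x \<in> P \<inter> A" "y \<in> P \<inter> A" for x y
      using that P'(4)[of x y] subring_set_add[OF A, of x y] by simp
    show "x * y \<in> P \<inter> A" if "x \<in> A" "y \<in> P \<inter> A" for x y
    proof -
      have "x \<in> B" using that AB by blast
      then show ?thesis using that P'(5)[of x y] subring_set_mult[OF A, of x y] by simp
    qed
    show "x \<in> P \<inter> A \<or> y \<in> P \<inter> A" if "x \<in> A" "y \<in> A" "x * y \<in> P \<inter> A" for x y
    proof -
      have "x \<in> B" "y \<in> B" using that AB by blast+
      then show ?thesis using that P'(6)[of x y] by simp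
    qed
  qed (use P'(2,3) subring_set_zero[OF A] in simp_all)
qed

lemma Spec_image_subset:
  assumes "subring_set A" "subring_set B" "A \<subseteq> B"
  shows "Spec_image A B \<subseteq> Spec A"
  using Spec_restrict[OF assms] by (auto simp: Spec_image_def)

text \<open>
  The prime over \<open>P\<close> is its extension: all elements that a power of \<open>a\<close> multiplies into \<open>P\<close>.
\<close>

lemma Spec_image_localization:
  assumes A: "subring_set A" and a: "a \<in> A" "a \<noteq> 0" and P: "P \<in> Spec A" "a \<notin> P"
  shows "P \<in> Spec_image A (generate_ring RF (A \<union> {inverse a}))"
proof -
  let ?B = "generate_ring RF (A \<union> {inverse a})"
  note B = subring_generate_ring[of "A \<union> {inverse a}"]
  have AB: "A \<subseteq> ?B" using generate_ring_superset by blast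
  note P' = SpecD[OF A P(1)]
  have an: "a ^ n \<in> A" for n by (rule subring_set_power[OF A a(1)])
  have anP: "a ^ n \<notin> P" for n
  proof (induction n)
    case (Suc n)
    then show ?case using P(2) P'(6)[OF a(1) an, of n] by auto
  qed (use P'(3) in simp)
  define Q where "Q = {x \<in> ?B. \<exists>n. a ^ n * x \<in> P}"
  have up: "a ^ (m + n) * x \<in> P" if "a ^ n * x \<in> P" for m n x
  proof -
    have "a ^ (m + n) * x = a ^ m * (a ^ n * x)" by (simp add: power_add mult.assoc)
    then show ?thesis using P'(5)[OF an[of m] that] by (simp only:)
  qed
  have QA: "Q \<inter> A = P"
  proof
    show "Q \<inter> A \<subseteq> P"
    proof
      fix x assume "x \<in> Q \<inter> A"
      then obtain n where "a ^ n * x \<in> P" "x \<in> A" by (auto simp: Q_def)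
      then show "x \<in> P" using P'(6)[OF an[of n]] anP[of n] by blast
    qed
    have "\<exists>n. a ^ n * x \<in> P" if "x \<in> P" for x
      by (rule exI[of _ 0]) (simp add: that)
    then show "P \<subseteq> Q \<inter> A" using P'(1) AB by (auto simp: Q_def)
  qed
  have "Q \<in> Spec ?B"
    unfolding Spec_iff[OF B]
  proof (intro conjI ballI impI)
    show "Q \<subseteq> ?B" by (auto simp: Q_def)
    show "0 \<in> Q" using QA P'(2) by blast
    show "1 \<notin> Q" using QA P'(3) subring_set_one[OF A] by blast
  next
    fix x y assume xy: "x \<in> Q" "y \<in> Q"
    then obtain m n where mn: "a ^ m * x \<in> P" "a ^ n * y \<in> P" by (auto simp: Q_def)
    have "a ^ (m + n) * (x + y) = a ^ (n + m) * x + a ^ (m + n) * y"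
      by (simp add: algebra_simps)
    also have "\<dots> \<in> P" by (rule P'(4)[OF up[OF mn(1)] up[OF mn(2)]])
    finally show "x + y \<in> Q"
      using xy subring_set_add[OF B] by (auto simp: Q_def)
  next
    fix x y assume xy: "x \<in> ?B" "y \<in> Q"
    then obtain n where n: "a ^ n * y \<in> P" by (auto simp: Q_def)
    obtain m where m: "a ^ m * x \<in> A"
      using generate_ring_inverse_clear[OF A a xy(1)] by blast
    have "a ^ (m + n) * (x * y) = (a ^ m * x) * (a ^ n * y)"
      by (simp add: power_add mult_ac)
    also have "\<dots> \<in> P" by (rule P'(5)[OF m n])
    finally show "x * y \<in> Q"
      using xy subring_set_mult[OF B] by (auto simp: Q_def)
  next
    fix x y assume xy: "x \<in> ?B" "y \<in> ?B" "x * y \<in> Q"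
    then obtain l where l: "a ^ l * (x * y) \<in> P" by (auto simp: Q_def)
    obtain m n where mn: "a ^ m * x \<in> A" "a ^ n * y \<in> A"
      using generate_ring_inverse_clear[OF A a] xy by blast
    have "(a ^ m * x) * (a ^ n * y) * a ^ l = a ^ (m + n) * (a ^ l * (x * y))"
      by (simp add: power_add mult_ac)
    also have "\<dots> \<in> P" by (rule P'(5)[OF an l])
    finally have "(a ^ m * x) * (a ^ n * y) * a ^ l \<in> P" .
    then have "(a ^ m * x) * (a ^ n * y) \<in> P"
      using P'(6)[OF subring_set_mult[OF A mn] an[of l]] anP[of l] by blast
    then have "a ^ m * x \<in> P \<or> a ^ n * y \<in> P"
      by (rule P'(6)[OF mn])
    then show "x \<in> Q \<or> y \<in> Q" using xy by (auto simp: Q_def)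
  qed
  then show ?thesis using QA unfolding Spec_image_def by blast
qed

lemma Spec_image_trans:
  assumes "A \<subseteq> A'"
  shows "Spec_image A B = (\<lambda>P. P \<inter> A) ` Spec_image A' B"
  using assms unfolding Spec_image_def image_image by (intro image_cong) auto

section \<open>The Banff algorithm\<close>

text \<open>
  The freezings compose: the variable at \<open>k\<close> is frozen in \<open>freeze {k} s'\<close> and therefore the same in all
  its seeds, so freezing \<open>k\<close> and then \<open>S\<close> amounts to freezing \<open>{k} \<union> S\<close> in one seed.
\<close>

lemma acyclic_cluster_chart_freeze:
  assumes s: "positive_seed s" and s': "mut_equiv s s'" and k: "k \<in> mutables s'"
    and A: "cluster_algebra (freeze {k} s') =
      generate_ring RF (cluster_algebra s \<union> {inverse (clus s' k)})"
    and chart: "acyclic_cluster_chart (freeze {k} s') t"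
  shows "acyclic_cluster_chart s t"
proof -
  obtain r S where r: "mut_equiv (freeze {k} s') r" "S \<subseteq> mutables r" "mut_equiv (freeze S r) t"
    and At: "cluster_algebra t =
      generate_ring RF (cluster_algebra (freeze {k} s') \<union> inverse ` clus r ` S)"
    using chart by (auto simp: acyclic_cluster_chart_def cluster_localization_def is_freezing_def)
  obtain u where u: "mut_equiv s' u" "r = freeze {k} u"
    using mut_equiv_freeze[OF r(1)] by blast
  have "mutables u = mutables s'" by (rule mut_equiv_invariants(3)[OF u(1)])
  then have "is_freezing s u ({k} \<union> S) t"
    using r u s' k mut_equiv_trans by (auto simp: is_freezing_def freeze_freeze)
  moreover have "clus u k = clus s' k"
    using mut_equiv_invariants(4)[OF r(1), of k] u(2) by simp
  then have "cluster_algebra t = generate_ring RF (cluster_algebra s \<union> inverse ` clus u ` ({k} \<union> S))"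
    (is "_ = generate_ring RF ?H")
  proof -
    assume k': "clus u k = clus s' k"
    let ?H' = "cluster_algebra (freeze {k} s') \<union> inverse ` clus r ` S"
    have "?H' \<subseteq> generate_ring RF ?H"
    proof -
      have "cluster_algebra s \<union> {inverse (clus s' k)} \<subseteq> ?H" using k' by auto
      then have "cluster_algebra (freeze {k} s') \<subseteq> generate_ring RF ?H"
        unfolding A by (rule generate_ring_mono)
      moreover have "inverse ` clus r ` S \<subseteq> ?H" using u(2) by auto
      ultimately show ?thesis using generate_ring_superset[of ?H] by blast
    qed
    moreover have "?H \<subseteq> generate_ring RF ?H'"
    proof -
      have "?H \<subseteq> ?H'"
        using generate_ring_superset[of "cluster_algebra s \<union> {inverse (clus s' k)}"] k' u(2)
        unfolding A by auto
      then show ?thesis using generate_ring_superset[of ?H'] by blast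
    qed
    ultimately show ?thesis
      unfolding At using generate_ring_least[OF subring_generate_ring] by blast
  qed
  ultimately show ?thesis
    using chart unfolding acyclic_cluster_chart_def cluster_localization_def by blast
qed

lemma finite_acyclic_cover_trivial:
  assumes s: "positive_seed s" and t: "mut_equiv s t" "acyclic_seed t"
  shows "finite_acyclic_cover s {t}"
proof -
  have A: "cluster_algebra t = cluster_algebra s"
    by (rule cluster_algebra_mut_equiv[OF t(1) s])
  have "is_freezing s s {} t"
    using t by (simp add: is_freezing_def mut_equiv_refl freeze_empty)
  then have "cluster_localization s t"
    unfolding cluster_localization_def A
    using generate_ring_subring[OF subring_cluster_algebra, of s]
    by (intro exI[of _ s] exI[of _ "{}"]) simp
  moreover have "acyclic_cluster_algebra t"
    using t(2) mut_equiv_refl by (auto simp: acyclic_cluster_algebra_def)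
  moreover have "Spec_image (cluster_algebra s) (cluster_algebra s) = Spec (cluster_algebra s)"
  proof -
    have "P \<inter> cluster_algebra s = P" if "P \<in> Spec (cluster_algebra s)" for P
      using SpecD(1)[OF subring_cluster_algebra that] by blast
    then show ?thesis by (simp add: Spec_image_def)
  qed
  ultimately show ?thesis
    by (simp add: finite_acyclic_cover_def acyclic_cluster_chart_def A)
qed

lemma finite_acyclic_cover_branch:
  assumes s: "positive_seed s" "mut_equiv s s'" and cp: "covering_pair s' i j"
    and i: "reachable s' \<subseteq> cluster_algebra (freeze {i} s')" "finite_acyclic_cover (freeze {i} s') T"
    and j: "reachable s' \<subseteq> cluster_algebra (freeze {j} s')" "finite_acyclic_cover (freeze {j} s') T'"
  shows "finite_acyclic_cover s (T \<union> T')"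
proof -
  let ?A = "cluster_algebra s"
  have s': "positive_seed s'" by (rule mut_equiv_positive[OF s(2,1)])
  have A: "cluster_algebra s' = ?A" by (rule cluster_algebra_mut_equiv[OF s(2,1)])
  have ij: "i \<in> mutables s'" "j \<in> mutables s'" using cp by (auto simp: covering_pair_def)
  note ijV = ij[THEN mutables_vertices]
  note freeze_i = cluster_algebra_freeze[OF ijV(1) i(1), unfolded A]
  note freeze_j = cluster_algebra_freeze[OF ijV(2) j(1), unfolded A]
  have sub: "?A \<subseteq> generate_ring RF (?A \<union> H)" for H
    using generate_ring_superset by blast
  have cover: "(\<Union>t\<in>T. Spec_image ?A (cluster_algebra t)) =
      Spec_image ?A (cluster_algebra (freeze {k} s'))"
    if "finite_acyclic_cover (freeze {k} s') T" "?A \<subseteq> cluster_algebra (freeze {k} s')" for k T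
  proof -
    have "(\<Union>t\<in>T. Spec_image ?A (cluster_algebra t)) =
        (\<lambda>P. P \<inter> ?A) ` (\<Union>t\<in>T. Spec_image (cluster_algebra (freeze {k} s')) (cluster_algebra t))"
      unfolding image_UN by (simp only: Spec_image_trans[OF that(2)])
    also have "\<dots> = Spec_image ?A (cluster_algebra (freeze {k} s'))"
      using that(1) by (simp add: finite_acyclic_cover_def Spec_image_def)
    finally show ?thesis .
  qed
  have "(\<Union>t\<in>T \<union> T'. Spec_image ?A (cluster_algebra t)) =
      Spec_image ?A (cluster_algebra (freeze {i} s')) \<union> Spec_image ?A (cluster_algebra (freeze {j} s'))"
  proof -
    have "?A \<subseteq> cluster_algebra (freeze {i} s')" "?A \<subseteq> cluster_algebra (freeze {j} s')"
      unfolding freeze_i freeze_j by (rule sub)+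
    then show ?thesis
      unfolding UN_Un by (simp only: cover[OF i(2)] cover[OF j(2)])
  qed
  also have "\<dots> = Spec ?A"
  proof
    show "Spec_image ?A (cluster_algebra (freeze {i} s')) \<union>
        Spec_image ?A (cluster_algebra (freeze {j} s')) \<subseteq> Spec ?A"
      unfolding freeze_i freeze_j
      by (intro Un_least Spec_image_subset subring_cluster_algebra subring_generate_ring sub)
    show "Spec ?A \<subseteq> Spec_image ?A (cluster_algebra (freeze {i} s')) \<union>
        Spec_image ?A (cluster_algebra (freeze {j} s'))"
    proof
      fix P assume P: "P \<in> Spec ?A"
      have in_A: "clus s' k \<in> ?A" "clus s' k \<noteq> 0" if "k \<in> vertices s'" for k
        using clus_in_algebra[OF mut_equiv_refl that] positive_seed_nonzero[OF s' that] A by auto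
      have "clus s' i \<notin> P \<or> clus s' j \<notin> P"
      proof (rule ccontr)
        assume "\<not> ?thesis"
        moreover obtain p q where "p \<in> ?A" "q \<in> ?A" "p * clus s' i + q * clus s' j = 1"
          using covering_pair_comaximal[OF s' cp] A by (auto simp: comaximal_def)
        ultimately have "1 \<in> P"
          using SpecD(4,5)[OF subring_cluster_algebra P] by metis
        then show False
          using SpecD(3)[OF subring_cluster_algebra P] by blast
      qed
      then show "P \<in> Spec_image ?A (cluster_algebra (freeze {i} s')) \<union>
          Spec_image ?A (cluster_algebra (freeze {j} s'))"
        unfolding freeze_i freeze_j
        using Spec_image_localization[OF subring_cluster_algebra in_A[OF ijV(1)] P]
          Spec_image_localization[OF subring_cluster_algebra in_A[OF ijV(2)] P] by blast
    qed
  qed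
  finally have "(\<Union>t\<in>T \<union> T'. Spec_image ?A (cluster_algebra t)) = Spec ?A" .
  moreover have "acyclic_cluster_chart s t" if "t \<in> T \<union> T'" for t
    using that i(2) j(2) acyclic_cluster_chart_freeze[OF s ij(1) freeze_i]
      acyclic_cluster_chart_freeze[OF s ij(2) freeze_j]
    by (auto simp: finite_acyclic_cover_def)
  ultimately show ?thesis
    using i(2) j(2) by (simp add: finite_acyclic_cover_def)
qed

text \<open>
  The bound on the reachable elements is carried along because the covering property of a branch
  needs it for both freezings.
\<close>

lemma banff_run_cover:
  assumes "banff_run s T" "positive_seed s"
  shows "finite_acyclic_cover s T \<and> reachable s \<subseteq> cluster_algebra s"
  using assms
proof (induction rule: banff_run.induct)
  case (stop s t)
  have "reachable t \<subseteq> cluster_algebra t"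
    using reachable_acyclic mut_equiv_positive stop by blast
  then show ?case
    using finite_acyclic_cover_trivial stop reachable_mut_equiv cluster_algebra_mut_equiv by metis
next
  case (branch s s' i j T T')
  have s': "positive_seed s'"
    using mut_equiv_positive branch by blast
  have ij: "i \<in> vertices s'" "j \<in> vertices s'"
    using branch.hyps(3) mutables_vertices by (auto simp: covering_pair_def)
  then have "positive_seed (freeze {i} s')" "positive_seed (freeze {j} s')"
    using positive_seed_freeze[OF s'] by auto
  then have IH: "finite_acyclic_cover (freeze {i} s') T" "reachable s' \<subseteq> cluster_algebra (freeze {i} s')"
    "finite_acyclic_cover (freeze {j} s') T'" "reachable s' \<subseteq> cluster_algebra (freeze {j} s')"
    using branch.IH by auto
  have "finite_acyclic_cover s (T \<union> T')"
    using finite_acyclic_cover_branch[OF branch.prems branch.hyps(2,3)] IH by blast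
  moreover have "reachable s' \<subseteq> cluster_algebra s'"
    using reachable_covering_pair[OF s' branch.hyps(3)] IH by blast
  then have "reachable s \<subseteq> cluster_algebra s"
    using reachable_mut_equiv[OF branch.hyps(2) branch.prems]
      cluster_algebra_mut_equiv[OF branch.hyps(2) branch.prems] by simp
  ultimately show ?case ..
qed

theorem theorem5p5:
  fixes s :: seed and T :: "seed set"
  assumes "is_seed s" and "banff_run s T"
  shows "finite_acyclic_cover s T \<and> locally_acyclic s"
  using banff_run_cover[OF assms(2) positive_seed_if_seed[OF assms(1)]]
  unfolding locally_acyclic_def by blast

end
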